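(* Let $n\ge 2$ and let $G^+\in C^\infty(\overline{B}\times[0,\infty))$ be a solution of the Darboux equation $$\mathcal{D}G^+(x,t)=0,\qquad (x,t)\in B\times\mathbb{R}_+,$$ such that $G^+_t(x,0)=0$ for $x\in B$ and $G^+(x,t)=0$ for $t>2$ and $x\in B$. Suppose that the boundary value $g=G^+|_{\Gamma}$, $\Gamma=S\times\mathbb{R}_+$, belongs to $C_0^\infty(S\times[0,2])$. Let $f^*$ denote the function on $\mathbb{R}^n$ equal to $G^+(x,0)$ for $x\in \overline B$ and equal to $0$ for $x\notin \overline B$. Then $f^*\in C^\infty(\mathbb{R}^n)$, and $G^+$ extends to a global solution $G$ of $$\begin{cases}\mathcal{D}G(x,t)=0, & (x,t)\in\mathbb{R}^n\times\mathbb{R}_+,\\ G(x,t)=g(x,t), & (x,t)\in\Gamma,\\ G(x,0)=f^*(x),\quad G_t(x,0)=0, & x\in\mathbb{R}^n,\end{cases}$$ that is, there is such a $G$ on $\mathbb{R}^n\times[0,\infty)$ with $G=G^+$ on $B\times\mathbb{R}_+$.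
   Context: $\mathbb{R}_+=(0,\infty)$; $B=\{x\in\mathbb{R}^n:|x|<1\}$ is the open unit ball and $S=\partial B$ the unit sphere. The Darboux operator is $\mathcal{D}=\partial_t^2+\frac{n-1}{t}\partial_t-\Delta_x$. A global solution is understood to be at least of class $C^2$ on $\mathbb{R}^n\times[0,\infty)$. $C_0^\infty(S\times[0,2])$ is the set of functions $g$ that are smooth, vanish for $t>2$, and vanish to infinite order at $t=0$; equivalently, the extension of $g$ by zero to $S\times\mathbb{R}$ is $C^\infty$ with support in $S\times[0,2]$. *)

theory Defs
  imports "HOL-Analysis.Analysis"
begin

text \<open>
  Class C^k on a set, with derivatives taken relative to the set. This is meant for convex sets
  with nonempty interior (here the closed cylinder over the unit ball, closed half-spaces, the
  whole space) and for open sets, where the relative derivative is unique; at boundary points it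
  is one-sided, so that regularity is required up to the boundary.
\<close>

fun Ck_on :: "nat \<Rightarrow> 'a::euclidean_space set \<Rightarrow> ('a \<Rightarrow> real) \<Rightarrow> bool" where
  "Ck_on 0 X f \<longleftrightarrow> continuous_on X f"
| "Ck_on (Suc k) X f \<longleftrightarrow>
    (\<exists>f'. (\<forall>x\<in>X. (f has_derivative f' x) (at x within X)) \<and> (\<forall>v. Ck_on k X (\<lambda>x. f' x v)))"

definition smooth_on :: "'a::euclidean_space set \<Rightarrow> ('a \<Rightarrow> real) \<Rightarrow> bool" where
  "smooth_on X f \<longleftrightarrow> (\<forall>k. Ck_on k X f)"

text \<open>
  On an embedded submanifold such as the cylinder over the unit sphere the relative derivative is
  not unique, and smoothness means that the function extends locally to a smooth function on an
  open subset of the ambient space.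
\<close>

definition smooth_on_submanifold :: "'a::euclidean_space set \<Rightarrow> ('a \<Rightarrow> real) \<Rightarrow> bool" where
  "smooth_on_submanifold M h \<longleftrightarrow>
    (\<forall>p\<in>M. \<exists>U F. open U \<and> p \<in> U \<and> smooth_on U F \<and> (\<forall>q\<in>M \<inter> U. F q = h q))"

definition extend_by_zero :: "'a set \<Rightarrow> ('a \<Rightarrow> real) \<Rightarrow> 'a \<Rightarrow> real" where
  "extend_by_zero X h p = (if p \<in> X then h p else 0)"

definition lateral_boundary :: "((real^'n) \<times> real) set" where
  "lateral_boundary = sphere 0 1 \<times> {0<..}"

text \<open>
  The space of smooth functions on \<open>S \<times> [0,2]\<close> vanishing to infinite order at \<open>t = 0\<close> and at
  \<open>t = 2\<close>: only the values of \<open>g\<close> on the lateral boundary (\<open>t > 0\<close>) matter.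
\<close>

definition C0_infinity_cylinder :: "((real^'n) \<times> real \<Rightarrow> real) \<Rightarrow> bool" where
  "C0_infinity_cylinder g \<longleftrightarrow>
    (let h = extend_by_zero lateral_boundary g
     in smooth_on_submanifold (sphere 0 1 \<times> UNIV) h \<and>
        closure {p \<in> sphere 0 1 \<times> UNIV. h p \<noteq> 0} \<subseteq> sphere 0 1 \<times> {0..2})"

definition laplacian :: "(real^'n \<Rightarrow> real) \<Rightarrow> real^'n \<Rightarrow> real" where
  "laplacian u x = (\<Sum>i\<in>UNIV. (deriv ^^ 2) (\<lambda>s. u (x + s *\<^sub>R axis i 1)) 0)"

definition darboux :: "((real^'n) \<times> real \<Rightarrow> real) \<Rightarrow> real^'n \<Rightarrow> real \<Rightarrow> real" where
  "darboux G x t =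
    (deriv ^^ 2) (\<lambda>s. G (x, s)) t
    + (real CARD('n) - 1) / t * deriv (\<lambda>s. G (x, s)) t
    - laplacian (\<lambda>y. G (y, t)) x"

definition initial_velocity_zero :: "((real^'n) \<times> real \<Rightarrow> real) \<Rightarrow> real^'n \<Rightarrow> bool" where
  "initial_velocity_zero G x \<longleftrightarrow>
    ((\<lambda>t. G (x, t)) has_real_derivative 0) (at 0 within {0..})"

definition global_solution ::
    "((real^'n) \<times> real \<Rightarrow> real) \<Rightarrow> (real^'n \<Rightarrow> real) \<Rightarrow> ((real^'n) \<times> real \<Rightarrow> real) \<Rightarrow> bool" where
  "global_solution g f G \<longleftrightarrow>
    Ck_on 2 (UNIV \<times> {0..}) G \<and>
    (\<forall>x t. t > 0 \<longrightarrow> darboux G x t = 0) \<and>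
    (\<forall>p\<in>lateral_boundary. G p = g p) \<and>
    (\<forall>x. G (x, 0) = f x \<and> initial_velocity_zero G x)"

end

theory Submission
  imports Defs
begin

text \<open>
The idea is to replace the problem in \<open>n\<close> variables by one in two radial variables. Averaging a
solution \<open>H\<close> of the Darboux equation over the spheres \<open>\<bar>x\<bar> = r\<close> gives a function \<open>U(r,t)\<close> with
\<open>U_rr + (n-1)/r U_r = U_tt + (n-1)/t U_t\<close>, an equation that is symmetric in \<open>r\<close> and \<open>t\<close>. Energy
estimates in these two variables give three facts: \<open>U(r,0) = U(0,r)\<close>, which is Asgeirsson's mean
value theorem (\<open>radial_darboux_swap\<close>); if \<open>U = 0\<close> for \<open>t \<ge> 2\<close>, then \<open>U(0,t) = 0\<close> for \<open>t \<ge> 1\<close>, by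
domain of dependence (\<open>radial_darboux_vanishes_late\<close>); and if moreover \<open>U(0,t) = 0\<close> for all \<open>t\<close>,
then \<open>U = 0\<close> (\<open>radial_darboux_lateral_uniqueness\<close>). Only averages about the origin occur, but this
is enough, because the space derivatives of a solution in the cylinder are again solutions.

Let \<open>f\<close> be the initial value of the given solution. By the first two facts, the average of any
derivative of \<open>f\<close> over \<open>\<bar>x\<bar> = r\<close> is the restriction to \<open>r \<le> 1\<close> of a smooth function that vanishes
for \<open>r \<ge> 1\<close>, so it is flat at \<open>r = 1\<close>: all its derivatives vanish there (\<open>initial_value_flat\<close>).
Integration by parts on spheres turns this into a statement on the average of \<open>p f\<close> for a
homogeneous polynomial \<open>p\<close> of degree \<open>k\<close>: up to a flat function, it is a combination of the powers
\<open>r^(2j-n+2)\<close> with \<open>j < k\<close> (\<open>flat_euler_shifts_hom_poly\<close>). These powers come from functions that are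
annihilated by powers of the Laplacian, and they are excluded by the boundary condition: since \<open>g\<close>
vanishes to infinite order at \<open>t = 0\<close>, the equation gives \<open>\<Delta>^m f = 0\<close> on the sphere for all \<open>m\<close>
(\<open>flat_in_time_xlap_pow\<close>, \<open>flat_hom_poly_iterated_lap\<close>). So the averages of \<open>p f\<close> are flat for all
polynomials \<open>p\<close>, the same follows for the derivatives of \<open>f\<close>, and by the Weierstrass theorem all
derivatives of \<open>f\<close> vanish on the sphere. Hence the extension of \<open>f\<close> by zero is smooth.

The extended solution \<open>G\<close> is the function of spherical means of this extension. On the cylinder, its
difference from the given solution is a solution with zero initial value that vanishes for \<open>t \<ge> 2\<close>.
By the three facts, the averages of all its space derivatives about the origin vanish. Integrating
by parts again, the averages against all polynomials vanish, so the difference is zero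
(\<open>cyl_darboux_unique\<close>).
\<close>

section \<open>Derivatives relative to a convex body\<close>

text \<open>
Boundedness is not part of it: half-lines, closed cylinders and the whole space are included.
\<close>
definition convex_body :: "'a::euclidean_space set \<Rightarrow> bool" where
  "convex_body X \<longleftrightarrow> convex X \<and> interior X \<noteq> {}"

text \<open>
The directional derivative relative to \<open>X\<close>, as an operator on functions: iterating it gives the
higher derivatives. Outside of \<open>X\<close> its values are arbitrary.
\<close>
definition dd :: "'a::euclidean_space set \<Rightarrow> 'a \<Rightarrow> ('a \<Rightarrow> real) \<Rightarrow> 'a \<Rightarrow> real" where
  "dd X v f x = frechet_derivative f (at x within X) v"

text \<open>
Two derivatives agree along the segments from \<open>x\<close> to the points of \<open>X\<close>, and the directions of these
segments span the space, because \<open>X\<close> has interior points. So directional derivatives are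
well defined also at boundary points, where no full neighbourhood is available.
\<close>
lemma convex_body_deriv_unique:
  assumes X: "convex_body X" and x: "x \<in> X"
    and A: "(f has_derivative A) (at x within X)" and B: "(f has_derivative B) (at x within X)"
  shows "A = (B :: _ \<Rightarrow> real)"
proof -
  interpret A: bounded_linear A using A by (rule has_derivative_bounded_linear)
  interpret B: bounded_linear B using B by (rule has_derivative_bounded_linear)
  have conv: "convex X" using X by (simp add: convex_body_def)
  have seg: "A (y - x) = B (y - x)" if y: "y \<in> X" for y
  proof -
    have sub: "(\<lambda>s. x + s *\<^sub>R (y - x)) ` {0..1} \<subseteq> X"
    proof clarify
      fix s :: real assume "s \<in> {0..1}"
      then have "(1 - s) *\<^sub>R x + s *\<^sub>R y \<in> X"
        using conv x y unfolding convex_alt by auto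
      then show "x + s *\<^sub>R (y - x) \<in> X" by (simp add: algebra_simps)
    qed
    have der: "((\<lambda>s. f (x + s *\<^sub>R (y - x))) has_vector_derivative C (y - x)) (at 0 within {0..1})"
      if C: "(f has_derivative C) (at x within X)" for C
    proof -
      interpret C: bounded_linear C using C by (rule has_derivative_bounded_linear)
      have 1: "((\<lambda>s. x + s *\<^sub>R (y - x)) has_derivative (\<lambda>s. s *\<^sub>R (y - x))) (at 0 within {0..1})"
        by (auto intro!: derivative_eq_intros)
      have 2: "(f has_derivative C) (at (x + 0 *\<^sub>R (y - x)) within (\<lambda>s. x + s *\<^sub>R (y - x)) ` {0..1})"
        using has_derivative_subset[OF C sub] by simp
      from has_derivative_in_compose[OF 1 2] show ?thesis
        by (simp add: has_vector_derivative_def o_def C.scaleR)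
    qed
    have "at (0::real) within {0..1} \<noteq> bot"
      by (simp add: at_within_Icc_at_right)
    from vector_derivative_unique_within[OF this der[OF A] der[OF B]] show ?thesis .
  qed
  obtain y0 where y0: "y0 \<in> interior X" using X by (auto simp: convex_body_def)
  then obtain e where e: "e > 0" "cball y0 e \<subseteq> X" using mem_interior_cball by blast
  show ?thesis
  proof
    fix v
    show "A v = B v"
    proof (cases "v = 0")
      case False
      define c where "c = e / norm v"
      have c: "c > 0" using e False by (simp add: c_def)
      have "y0 + c *\<^sub>R v \<in> cball y0 e" using e False by (simp add: c_def dist_norm)
      then have "A (y0 + c *\<^sub>R v - x) = B (y0 + c *\<^sub>R v - x)" using e seg by blast
      moreover have "A (y0 - x) = B (y0 - x)" using seg y0 interior_subset by blast
      ultimately have "A (y0 + c *\<^sub>R v - x) - A (y0 - x) = B (y0 + c *\<^sub>R v - x) - B (y0 - x)"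
        by simp
      then have "c * A v = c * B v"
        by (simp add: A.add A.diff B.add B.diff A.scaleR B.scaleR)
      then show ?thesis using c by simp
    qed (simp add: A.zero B.zero)
  qed
qed

lemma dd_eqI:
  assumes "convex_body X" "x \<in> X" "(f has_derivative A) (at x within X)"
  shows "dd X v f x = A v"
proof -
  have "(f has_derivative frechet_derivative f (at x within X)) (at x within X)"
    using assms frechet_derivative_works differentiable_def by blast
  then show ?thesis unfolding dd_def using convex_body_deriv_unique[OF assms(1,2) _ assms(3)] by metis
qed

lemma Ck_on_cong:
  assumes "Ck_on k X f" "\<And>x. x \<in> X \<Longrightarrow> f x = g x"
  shows "Ck_on k X g"
proof (cases k)
  case 0
  then show ?thesis using assms continuous_on_cong by (metis Ck_on.simps(1))
next
  case (Suc j)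
  then obtain f' where f': "\<forall>x\<in>X. (f has_derivative f' x) (at x within X)" "\<forall>v. Ck_on j X (\<lambda>x. f' x v)"
    using assms(1) by auto
  have "\<forall>x\<in>X. (g has_derivative f' x) (at x within X)"
    using f'(1) assms(2) by (metis has_derivative_transform)
  then show ?thesis using f'(2) Suc by auto
qed

lemma Ck_on_subset: "Ck_on k X f \<Longrightarrow> Y \<subseteq> X \<Longrightarrow> Ck_on k Y f"
proof (induction k arbitrary: f)
  case 0 then show ?case using continuous_on_subset by auto
next
  case (Suc k)
  then obtain f' where f': "\<forall>x\<in>X. (f has_derivative f' x) (at x within X)" "\<forall>v. Ck_on k X (\<lambda>x. f' x v)"
    by auto
  have "\<forall>x\<in>Y. (f has_derivative f' x) (at x within Y)"
    using f' Suc.prems(2) has_derivative_subset by blast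
  moreover have "\<forall>v. Ck_on k Y (\<lambda>x. f' x v)" using Suc f' by auto
  ultimately show ?case by auto
qed

lemma Ck_on_SucD: "Ck_on (Suc k) X f \<Longrightarrow> Ck_on k X f"
proof (induction k arbitrary: f)
  case 0
  then show ?case
    by (metis Ck_on.simps has_derivative_continuous continuous_on_eq_continuous_within)
next
  case (Suc k)
  then obtain f' where "\<forall>x\<in>X. (f has_derivative f' x) (at x within X)" "\<forall>v. Ck_on (Suc k) X (\<lambda>x. f' x v)"
    by (metis Ck_on.simps(2))
  then show ?case using Suc.IH by (metis Ck_on.simps(2))
qed

lemma smooth_on_cong:
  "smooth_on X f \<Longrightarrow> (\<And>x. x \<in> X \<Longrightarrow> f x = g x) \<Longrightarrow> smooth_on X g"
  unfolding smooth_on_def using Ck_on_cong by blast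

lemma smooth_on_subset: "smooth_on X f \<Longrightarrow> Y \<subseteq> X \<Longrightarrow> smooth_on Y f"
  unfolding smooth_on_def using Ck_on_subset by blast

lemma smooth_on_continuous: "smooth_on X f \<Longrightarrow> continuous_on X f"
  unfolding smooth_on_def by (metis Ck_on.simps(1))

lemma smooth_on_has_derivative:
  assumes "convex_body X" "smooth_on X f" "x \<in> X"
  shows "(f has_derivative (\<lambda>v. dd X v f x)) (at x within X)"
proof -
  have "Ck_on (Suc 0) X f" using assms by (simp only: smooth_on_def)
  then obtain f' where "(f has_derivative f' x) (at x within X)" using assms(3) by auto
  then show ?thesis using dd_eqI[OF assms(1,3)] by simp
qed

lemma smooth_on_dd:
  assumes "convex_body X" "smooth_on X f"
  shows "smooth_on X (dd X v f)"
  unfolding smooth_on_def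
proof
  fix k
  have "Ck_on (Suc k) X f" using assms by (simp only: smooth_on_def)
  then obtain f' where f': "\<forall>x\<in>X. (f has_derivative f' x) (at x within X)" "\<forall>v. Ck_on k X (\<lambda>x. f' x v)"
    by auto
  have "f' x v = dd X v f x" if "x \<in> X" for x
    using dd_eqI[OF assms(1) that] f'(1) that by metis
  then show "Ck_on k X (dd X v f)" using f'(2) Ck_on_cong by blast
qed

lemma dd_cong:
  assumes "convex_body X" "x \<in> X" "smooth_on X f" "\<And>y. y \<in> X \<Longrightarrow> f y = g y"
  shows "dd X v f x = dd X v g x"
proof -
  have "(g has_derivative (\<lambda>v. dd X v f x)) (at x within X)"
    using smooth_on_has_derivative[OF assms(1,3,2)] assms(2,4) by (metis has_derivative_transform)
  then show ?thesis using dd_eqI[OF assms(1,2)] by metis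
qed

text \<open>
Smoothness can be shown by exhibiting a class of functions that is closed under differentiation.
\<close>
lemma smooth_on_coinduct:
  assumes step: "\<And>f. P f \<Longrightarrow> \<exists>f'. (\<forall>x\<in>X. (f has_derivative f' x) (at x within X)) \<and> (\<forall>v. P (\<lambda>x. f' x v))"
    and "P f"
  shows "smooth_on X f"
proof -
  have "Ck_on k X f" if "P f" for k f
    using that
  proof (induction k arbitrary: f)
    case 0
    then show ?case using step[OF 0]
      by (metis Ck_on.simps(1) has_derivative_continuous continuous_on_eq_continuous_within)
  next
    case (Suc k)
    then show ?case using step[OF Suc.prems] by (metis Ck_on.simps(2))
  qed
  then show ?thesis using assms(2) by (simp add: smooth_on_def)
qed

lemma Ck_on_const: "Ck_on k X (\<lambda>x. c)"
proof (induction k arbitrary: c)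
  case (Suc k)
  have "\<forall>x\<in>X. ((\<lambda>x. c) has_derivative (\<lambda>v. 0)) (at x within X)" by auto
  moreover have "\<forall>v. Ck_on k X (\<lambda>x. (\<lambda>v. 0::real) v)" using Suc by simp
  ultimately show ?case unfolding Ck_on.simps by (intro exI[of _ "\<lambda>x v. 0"]) auto
qed auto

lemma smooth_on_const: "smooth_on X (\<lambda>x. c)"
  unfolding smooth_on_def by (simp add: Ck_on_const)

lemma smooth_on_linear:
  assumes "bounded_linear f" shows "smooth_on X f"
  unfolding smooth_on_def
proof
  fix k show "Ck_on k X f"
  proof (cases k)
    case 0 then show ?thesis
      using assms linear_continuous_on by auto
  next
    case (Suc j)
    have "\<forall>x\<in>X. (f has_derivative f) (at x within X)"
      using assms bounded_linear_imp_has_derivative by blast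
    then show ?thesis using Ck_on_const[of j X] unfolding Suc Ck_on.simps
      by (intro exI[of _ "\<lambda>x. f"]) auto
  qed
qed

lemma Ck_on_add: "Ck_on k X f \<Longrightarrow> Ck_on k X g \<Longrightarrow> Ck_on k X (\<lambda>x. f x + g x)"
proof (induction k arbitrary: f g)
  case 0 then show ?case using continuous_on_add by auto
next
  case (Suc k)
  obtain f' where f': "\<forall>x\<in>X. (f has_derivative f' x) (at x within X)" "\<forall>v. Ck_on k X (\<lambda>x. f' x v)"
    using Suc.prems by auto
  obtain g' where g': "\<forall>x\<in>X. (g has_derivative g' x) (at x within X)" "\<forall>v. Ck_on k X (\<lambda>x. g' x v)"
    using Suc.prems by auto
  have "\<forall>x\<in>X. ((\<lambda>x. f x + g x) has_derivative (\<lambda>v. f' x v + g' x v)) (at x within X)"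
    using f'(1) g'(1) has_derivative_add by blast
  moreover have "\<forall>v. Ck_on k X (\<lambda>x. f' x v + g' x v)" using Suc.IH f'(2) g'(2) by blast
  ultimately show ?case unfolding Ck_on.simps by (intro exI[of _ "\<lambda>x v. f' x v + g' x v"]) auto
qed

lemma Ck_on_mult: "Ck_on k X f \<Longrightarrow> Ck_on k X g \<Longrightarrow> Ck_on k X (\<lambda>x. f x * g x)"
proof (induction k arbitrary: f g)
  case 0 then show ?case using continuous_on_mult by auto
next
  case (Suc k)
  obtain f' where f': "\<forall>x\<in>X. (f has_derivative f' x) (at x within X)" "\<forall>v. Ck_on k X (\<lambda>x. f' x v)"
    using Suc.prems by auto
  obtain g' where g': "\<forall>x\<in>X. (g has_derivative g' x) (at x within X)" "\<forall>v. Ck_on k X (\<lambda>x. g' x v)"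
    using Suc.prems by auto
  have "\<forall>x\<in>X. ((\<lambda>x. f x * g x) has_derivative (\<lambda>v. f x * g' x v + f' x v * g x)) (at x within X)"
    using f'(1) g'(1) has_derivative_mult by blast
  moreover have "\<forall>v. Ck_on k X (\<lambda>x. f x * g' x v + f' x v * g x)"
    by (intro allI Ck_on_add Suc.IH) (use f'(2) g'(2) Suc.prems[THEN Ck_on_SucD] in auto)
  ultimately show ?case unfolding Ck_on.simps
    by (intro exI[of _ "\<lambda>x v. f x * g' x v + f' x v * g x"]) auto
qed

lemma smooth_on_add: "smooth_on X f \<Longrightarrow> smooth_on X g \<Longrightarrow> smooth_on X (\<lambda>x. f x + g x)"
  unfolding smooth_on_def by (simp add: Ck_on_add)

lemma smooth_on_mult: "smooth_on X f \<Longrightarrow> smooth_on X g \<Longrightarrow> smooth_on X (\<lambda>x. f x * g x)"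
  unfolding smooth_on_def by (simp add: Ck_on_mult)

lemma smooth_on_cmult: "smooth_on X f \<Longrightarrow> smooth_on X (\<lambda>x. c * f x)"
  using smooth_on_mult smooth_on_const by blast

lemma smooth_on_diff: "smooth_on X f \<Longrightarrow> smooth_on X g \<Longrightarrow> smooth_on X (\<lambda>x. f x - g x)"
  using smooth_on_add[of X f "\<lambda>x. -1 * g x"] smooth_on_cmult[of X g "-1"] by simp

lemma smooth_on_sum:
  "(\<And>i. i \<in> I \<Longrightarrow> smooth_on X (f i)) \<Longrightarrow> smooth_on X (\<lambda>x. \<Sum>i\<in>I. f i x)"
  by (induction I rule: infinite_finite_induct) (auto intro: smooth_on_add smooth_on_const)

lemma dd_const: "convex_body X \<Longrightarrow> x \<in> X \<Longrightarrow> dd X v (\<lambda>x. c) x = 0"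
  by (rule dd_eqI) auto

lemma dd_linear: "convex_body X \<Longrightarrow> x \<in> X \<Longrightarrow> bounded_linear f \<Longrightarrow> dd X v f x = f v"
  by (rule dd_eqI) (auto intro: bounded_linear_imp_has_derivative)

lemma dd_add:
  assumes "convex_body X" "x \<in> X" "smooth_on X f" "smooth_on X g"
  shows "dd X v (\<lambda>x. f x + g x) x = dd X v f x + dd X v g x"
  by (rule dd_eqI) (use assms in \<open>auto intro: has_derivative_add smooth_on_has_derivative\<close>)

lemma dd_diff:
  assumes "convex_body X" "x \<in> X" "smooth_on X f" "smooth_on X g"
  shows "dd X v (\<lambda>x. f x - g x) x = dd X v f x - dd X v g x"
  by (rule dd_eqI) (use assms in \<open>auto intro: has_derivative_diff smooth_on_has_derivative\<close>)

lemma dd_mult: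
  assumes "convex_body X" "x \<in> X" "smooth_on X f" "smooth_on X g"
  shows "dd X v (\<lambda>x. f x * g x) x = f x * dd X v g x + dd X v f x * g x"
  by (rule dd_eqI) (use assms in \<open>auto intro: has_derivative_mult smooth_on_has_derivative\<close>)

lemma dd_cmult:
  assumes "convex_body X" "x \<in> X" "smooth_on X f"
  shows "dd X v (\<lambda>x. c * f x) x = c * dd X v f x"
  using dd_mult[OF assms(1,2) smooth_on_const assms(3)] dd_const[OF assms(1,2)] by simp

lemma dd_sum:
  assumes "convex_body X" "x \<in> X" "\<And>i. i \<in> I \<Longrightarrow> smooth_on X (f i)"
  shows "dd X v (\<lambda>x. \<Sum>i\<in>I. f i x) x = (\<Sum>i\<in>I. dd X v (f i) x)"
  by (rule dd_eqI) (use assms in \<open>auto intro!: has_derivative_sum smooth_on_has_derivative\<close>)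

lemma dd_bounded_linear:
  assumes "convex_body X" "smooth_on X f" "x \<in> X"
  shows "bounded_linear (\<lambda>v. dd X v f x)"
  using smooth_on_has_derivative[OF assms] has_derivative_bounded_linear by blast

lemma dd_direction_sum:
  assumes "convex_body X" "smooth_on X f" "x \<in> X"
  shows "dd X v f x = (\<Sum>b\<in>Basis. (v \<bullet> b) * dd X b f x)"
proof -
  interpret bounded_linear "\<lambda>v. dd X v f x" using dd_bounded_linear[OF assms] .
  have "dd X v f x = dd X (\<Sum>b\<in>Basis. (v \<bullet> b) *\<^sub>R b) f x" by (simp add: euclidean_representation)
  then show ?thesis by (simp add: sum scaleR)
qed

text \<open>
Used to pass equations from the interior to the boundary, in particular to the bottom and the lateral
boundary of the cylinder and to the degenerate radius \<open>r = 0\<close>.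
\<close>
lemma eq_of_eq_on_interior:
  assumes "convex_body X" "continuous_on X f" "continuous_on X g" "\<And>x. x \<in> interior X \<Longrightarrow> f x = g x" "x \<in> X"
  shows "f x = (g x :: real)"
proof -
  have "x \<in> closure (interior X)"
    using assms convex_closure_interior closure_subset unfolding convex_body_def by fast
  then obtain s where s: "\<And>n. s n \<in> interior X" "s \<longlonglongrightarrow> x" by (auto simp: closure_sequential)
  have sX: "s n \<in> X" for n using s(1) interior_subset by blast
  have "(\<lambda>n. f (s n)) \<longlonglongrightarrow> f x"
    using assms(2,5) s(2) sX unfolding continuous_on_sequentially o_def by blast
  moreover have "(\<lambda>n. g (s n)) \<longlonglongrightarrow> g x"
    using assms(3,5) s(2) sX unfolding continuous_on_sequentially o_def by blast
  moreover have "(\<lambda>n. f (s n)) = (\<lambda>n. g (s n))" using assms(4) s(1) by auto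
  ultimately show ?thesis using LIMSEQ_unique by metis
qed

lemma dd_line_derivative:
  assumes "convex_body X" "smooth_on X f" "x + s *\<^sub>R v \<in> interior X"
  shows "((\<lambda>s. f (x + s *\<^sub>R v)) has_real_derivative dd X v f (x + s *\<^sub>R v)) (at s)"
proof -
  have "x + s *\<^sub>R v \<in> X" using assms(3) interior_subset by blast
  then have "(f has_derivative (\<lambda>v'. dd X v' f (x + s *\<^sub>R v))) (at (x + s *\<^sub>R v))"
    using smooth_on_has_derivative[OF assms(1,2)] at_within_interior[OF assms(3)] by metis
  moreover have "((\<lambda>s. x + s *\<^sub>R v) has_derivative (\<lambda>h. h *\<^sub>R v)) (at s)"
    by (auto intro!: derivative_eq_intros)
  ultimately have "((\<lambda>s. f (x + s *\<^sub>R v)) has_derivative (\<lambda>h. dd X (h *\<^sub>R v) f (x + s *\<^sub>R v))) (at s)"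
    using has_derivative_compose by blast
  moreover have "dd X (h *\<^sub>R v) f (x + s *\<^sub>R v) = dd X v f (x + s *\<^sub>R v) * h" for h
    using linear_scale[OF bounded_linear.linear[OF dd_bounded_linear[OF assms(1,2) \<open>x + s *\<^sub>R v \<in> X\<close>]], of h v]
    by simp
  ultimately show ?thesis by (simp add: has_field_derivative_def)
qed

text \<open>
Schwarz's theorem follows by comparing the two ways of writing the second difference as an
iterated derivative.
\<close>
lemma second_difference_mean_value:
  assumes X: "convex_body X" "smooth_on X f" and h: "h > 0"
    and in_X: "\<And>s t. 0 \<le> s \<Longrightarrow> s \<le> h \<Longrightarrow> 0 \<le> t \<Longrightarrow> t \<le> h \<Longrightarrow> x + s *\<^sub>R v + t *\<^sub>R w \<in> interior X"
  shows "\<exists>s t. 0 < s \<and> s < h \<and> 0 < t \<and> t < h \<and>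
    f (x + h *\<^sub>R v + h *\<^sub>R w) - f (x + h *\<^sub>R v) - f (x + h *\<^sub>R w) + f x
      = h\<^sup>2 * dd X w (dd X v f) (x + s *\<^sub>R v + t *\<^sub>R w)"
proof -
  define g where "g = (\<lambda>s. f ((x + h *\<^sub>R w) + s *\<^sub>R v) - f (x + s *\<^sub>R v))"
  have g': "(g has_real_derivative dd X v f ((x + h *\<^sub>R w) + s *\<^sub>R v) - dd X v f (x + s *\<^sub>R v)) (at s)"
    if "0 \<le> s" "s \<le> h" for s
    unfolding g_def
    apply (intro DERIV_diff dd_line_derivative X)
    using in_X[OF that, of h] in_X[OF that, of 0] h by (auto simp: algebra_simps)
  obtain s where s: "0 < s" "s < h"
    "g h - g 0 = (h - 0) * (dd X v f ((x + h *\<^sub>R w) + s *\<^sub>R v) - dd X v f (x + s *\<^sub>R v))"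
    using MVT2[OF h g'] by auto
  define k where "k = (\<lambda>t. dd X v f ((x + s *\<^sub>R v) + t *\<^sub>R w))"
  have k': "(k has_real_derivative dd X w (dd X v f) ((x + s *\<^sub>R v) + t *\<^sub>R w)) (at t)"
    if "0 \<le> t" "t \<le> h" for t
    unfolding k_def
    apply (intro dd_line_derivative X smooth_on_dd)
    using in_X[of s t] that s by auto
  obtain t where t: "0 < t" "t < h" "k h - k 0 = (h - 0) * dd X w (dd X v f) ((x + s *\<^sub>R v) + t *\<^sub>R w)"
    using MVT2[OF h k'] by auto
  have "g h - g 0 = h * (k h - k 0)" using s(3) by (simp add: k_def algebra_simps)
  also have "\<dots> = h\<^sup>2 * dd X w (dd X v f) ((x + s *\<^sub>R v) + t *\<^sub>R w)"
    using t(3) by (simp add: power2_eq_square)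
  finally show ?thesis using s t by (intro exI[of _ s] exI[of _ t]) (simp add: g_def algebra_simps)
qed

lemma dd_commute_interior:
  assumes X: "convex_body X" "smooth_on X f" and x: "x \<in> interior X"
  shows "dd X v (dd X w f) x = dd X w (dd X v f) x"
proof (rule ccontr)
  define A where "A = dd X w (dd X v f)"
  define B where "B = dd X v (dd X w f)"
  assume "\<not> ?thesis"
  then have ne: "\<bar>A x - B x\<bar> / 2 > 0" (is "?e > 0") by (auto simp: A_def B_def)
  have cA: "continuous (at x) A" and cB: "continuous (at x) B"
    unfolding A_def B_def
    by (rule continuous_on_interior[OF smooth_on_continuous[OF smooth_on_dd[OF X(1) smooth_on_dd[OF X]]] x])+
  obtain d1 where d1: "d1 > 0" "\<And>y. dist y x < d1 \<Longrightarrow> dist (A y) (A x) < ?e"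
    using cA ne unfolding continuous_at_eps_delta by blast
  obtain d2 where d2: "d2 > 0" "\<And>y. dist y x < d2 \<Longrightarrow> dist (B y) (B x) < ?e"
    using cB ne unfolding continuous_at_eps_delta by blast
  obtain d3 where d3: "d3 > 0" "ball x d3 \<subseteq> interior X" using x open_interior open_contains_ball by blast
  define d where "d = min d1 (min d2 d3)"
  define N where "N = norm v + norm w + 1"
  define h where "h = d / (2 * N)"
  have d: "d > 0" using d1 d2 d3 by (simp add: d_def)
  have nn: "N > 0" by (simp add: N_def add_nonneg_pos)
  have h: "h > 0" using d nn by (simp add: h_def)
  have near: "dist (x + s *\<^sub>R v + t *\<^sub>R w) x < d" if "0 \<le> s" "s \<le> h" "0 \<le> t" "t \<le> h" for s t
  proof -
    have "dist (x + s *\<^sub>R v + t *\<^sub>R w) x \<le> s * norm v + t * norm w"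
      using that norm_triangle_ineq[of "s *\<^sub>R v" "t *\<^sub>R w"] by (simp add: dist_norm add.assoc)
    also have "\<dots> \<le> h * norm v + h * norm w" using that by (intro add_mono mult_right_mono) auto
    also have "\<dots> \<le> h * N" using h by (simp add: N_def algebra_simps)
    also have "\<dots> = d / 2" using nn by (simp add: h_def)
    finally show ?thesis using d by simp
  qed
  have nX: "x + s *\<^sub>R v + t *\<^sub>R w \<in> interior X" if "0 \<le> s" "s \<le> h" "0 \<le> t" "t \<le> h" for s t
    using near[OF that] d3(2) by (auto simp: d_def dist_commute subset_iff)
  have nX': "x + s *\<^sub>R w + t *\<^sub>R v \<in> interior X" if "0 \<le> s" "s \<le> h" "0 \<le> t" "t \<le> h" for s t
    using nX[OF that(3,4,1,2)] by (simp add: algebra_simps)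
  obtain s t where st: "0 < s" "s < h" "0 < t" "t < h"
    "f (x + h *\<^sub>R v + h *\<^sub>R w) - f (x + h *\<^sub>R v) - f (x + h *\<^sub>R w) + f x = h\<^sup>2 * A (x + s *\<^sub>R v + t *\<^sub>R w)"
    using second_difference_mean_value[OF X h nX] unfolding A_def by blast
  obtain s' t' where st': "0 < s'" "s' < h" "0 < t'" "t' < h"
    "f (x + h *\<^sub>R w + h *\<^sub>R v) - f (x + h *\<^sub>R w) - f (x + h *\<^sub>R v) + f x = h\<^sup>2 * B (x + s' *\<^sub>R w + t' *\<^sub>R v)"
    using second_difference_mean_value[OF X h nX'] unfolding B_def by blast
  have "h\<^sup>2 * A (x + s *\<^sub>R v + t *\<^sub>R w) = h\<^sup>2 * B (x + s' *\<^sub>R w + t' *\<^sub>R v)"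
  proof -
    have "f (x + h *\<^sub>R w + h *\<^sub>R v) = f (x + h *\<^sub>R v + h *\<^sub>R w)" by (simp add: add_ac)
    then show ?thesis using st(5) st'(5) by linarith
  qed
  then have eq: "A (x + s *\<^sub>R v + t *\<^sub>R w) = B (x + t' *\<^sub>R v + s' *\<^sub>R w)" using h by (simp add: add_ac)
  have "dist (A (x + s *\<^sub>R v + t *\<^sub>R w)) (A x) < ?e"
    using d1(2) near[of s t] st by (simp add: d_def)
  moreover have "dist (B (x + t' *\<^sub>R v + s' *\<^sub>R w)) (B x) < ?e"
    using d2(2) near[of t' s'] st' by (simp add: d_def)
  ultimately show False unfolding eq dist_real_def by (smt (verit) field_sum_of_halves)
qed

lemma dd_commute:
  assumes "convex_body X" "smooth_on X f" "x \<in> X"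
  shows "dd X v (dd X w f) x = dd X w (dd X v f) x"
  by (rule eq_of_eq_on_interior[OF assms(1)])
    (use assms in \<open>auto intro: smooth_on_continuous smooth_on_dd dd_commute_interior\<close>)

lemma affine_has_derivative:
  assumes X: "convex_body X" and L: "bounded_linear L" and maps: "\<And>y. y \<in> Y \<Longrightarrow> a + L y \<in> X"
    and f: "smooth_on X f" and y: "y \<in> Y"
  shows "((\<lambda>y. f (a + L y)) has_derivative (\<lambda>v. dd X (L v) f (a + L y))) (at y within Y)"
proof (rule has_derivative_in_compose2[where t=X and f="\<lambda>y. a + L y" and g=f and g'="\<lambda>x v. dd X v f x"])
  show "\<And>x. x \<in> X \<Longrightarrow> (f has_derivative (\<lambda>v. dd X v f x)) (at x within X)"
    using smooth_on_has_derivative[OF X f] by blast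
  show "((\<lambda>y. a + L y) has_derivative L) (at y within Y)"
    using bounded_linear_imp_has_derivative[OF L] by (auto intro!: derivative_eq_intros)
qed (use maps y in auto)

lemma smooth_on_affine:
  assumes X: "convex_body X" and L: "bounded_linear L" and maps: "\<And>y. y \<in> Y \<Longrightarrow> a + L y \<in> X"
    and f: "smooth_on X f"
  shows "smooth_on Y (\<lambda>y. f (a + L y))"
proof (rule smooth_on_coinduct[where P="\<lambda>h. \<exists>f. smooth_on X f \<and> h = (\<lambda>y. f (a + L y))"])
  fix h assume "\<exists>f. smooth_on X f \<and> h = (\<lambda>y. f (a + L y))"
  then obtain f where f: "smooth_on X f" "h = (\<lambda>y. f (a + L y))" by blast
  show "\<exists>f'. (\<forall>x\<in>Y. (h has_derivative f' x) (at x within Y)) \<and>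
      (\<forall>v. \<exists>f. smooth_on X f \<and> (\<lambda>x. f' x v) = (\<lambda>y. f (a + L y)))"
    using affine_has_derivative[OF X L maps f(1)] smooth_on_dd[OF X f(1)] unfolding f(2)
    by (intro exI[of _ "\<lambda>y v. dd X (L v) f (a + L y)"]) auto
qed (use f in auto)

lemma dd_affine:
  assumes "convex_body X" "bounded_linear L" "\<And>y. y \<in> Y \<Longrightarrow> a + L y \<in> X" "smooth_on X f" "convex_body Y" "y \<in> Y"
  shows "dd Y v (\<lambda>y. f (a + L y)) y = dd X (L v) f (a + L y)"
  using dd_eqI[OF assms(5,6) affine_has_derivative[OF assms(1-4,6)]] by simp

section \<open>Averages over the unit sphere\<close>

text \<open>
A radial weight of class \<open>C^1\<close>, positive exactly on the shell \<open>2 < \<bar>z\<bar> < 3\<close>. The average over the unit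
sphere is realised as a weighted volume integral over this shell of the function \<open>z \<mapsto> \<phi> (z / \<bar>z\<bar>)\<close>.
Averages are then integrals over a fixed box, which can be differentiated under the integral sign.
\<close>
definition bump :: "'a::euclidean_space \<Rightarrow> real" where
  "bump z = (max 0 ((z \<bullet> z - 4) * (9 - z \<bullet> z)))\<^sup>2"

text \<open>
The radial retraction onto the ball. On the shell it is \<open>z / \<bar>z\<bar>\<close>, and it is continuous at the origin.
\<close>
definition retr :: "'a::euclidean_space \<Rightarrow> 'a" where
  "retr z = z /\<^sub>R max 1 (norm z)"

definition bump_box :: "'a::euclidean_space set" where
  "bump_box = cbox (-3 *\<^sub>R One) (3 *\<^sub>R One)"

definition mean :: "('a::euclidean_space \<Rightarrow> real) \<Rightarrow> real" where
  "mean \<phi> = integral bump_box (\<lambda>z. bump z * \<phi> (retr z)) / integral bump_box (bump :: 'a \<Rightarrow> real)"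

lemma bump_nonneg: "bump z \<ge> 0" by (simp add: bump_def)

lemma continuous_on_bump [continuous_intros]: "continuous_on A bump"
  unfolding bump_def by (intro continuous_intros)

lemma continuous_on_retr [continuous_intros]: "continuous_on A retr"
  unfolding retr_def by (intro continuous_intros) auto

lemma retr_in_cball: "retr z \<in> cball 0 1"
  by (auto simp: retr_def divide_simps max_def)

lemma retr_in_sphere: "norm z \<ge> 1 \<Longrightarrow> retr z \<in> sphere 0 1"
  by (auto simp: retr_def divide_simps max_def)

lemma retr_scale: "norm w = 1 \<Longrightarrow> c \<ge> 1 \<Longrightarrow> retr (c *\<^sub>R w) = w"
  by (auto simp: retr_def max_def)

lemma bump_eq_0:
  assumes "norm z \<le> 2 \<or> norm z \<ge> 3" shows "bump z = 0"
proof -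
  have "z \<bullet> z \<le> 4 \<or> z \<bullet> z \<ge> 9"
    using assms power_mono[of "norm z" 2 2] power_mono[of 3 "norm z" 2]
    by (auto simp: power2_norm_eq_inner)
  then have "(z \<bullet> z - 4) * (9 - z \<bullet> z) \<le> 0"
    by (auto simp: mult_le_0_iff)
  then show ?thesis by (simp add: bump_def)
qed

lemma bump_pos:
  assumes "norm w = 1" shows "bump ((5/2) *\<^sub>R w) > 0"
proof -
  have "w \<bullet> w = 1" using assms by (simp add: norm_eq_1)
  then show ?thesis by (simp add: bump_def)
qed

lemma mem_bump_box: "norm z \<le> 3 \<Longrightarrow> z \<in> bump_box"
proof -
  assume z: "norm z \<le> 3"
  have "\<bar>z \<bullet> b\<bar> \<le> 3" if "b \<in> Basis" for b using Basis_le_norm[OF that, of z] z by simp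
  then show ?thesis by (auto simp: bump_box_def mem_box abs_le_iff minus_le_iff)
qed

lemma bump_mult_integrable:
  "continuous_on (cball 0 1) \<phi> \<Longrightarrow> (\<lambda>z. bump z * \<phi> (retr z)) integrable_on bump_box"
  unfolding bump_box_def
  by (intro integrable_continuous continuous_intros continuous_on_compose2[of "cball 0 1" \<phi> _ retr])
    (use retr_in_cball in blast)+

lemma exists_norm_1: "\<exists>w::'a::euclidean_space. norm w = 1"
  using SOME_Basis norm_Basis by blast

text \<open>
The retraction maps the support of the weight into the sphere, so only the values there count.
\<close>
lemma mean_cong_sphere: "(\<And>w. w \<in> sphere 0 1 \<Longrightarrow> \<phi> w = \<psi> w) \<Longrightarrow> mean \<phi> = mean \<psi>"
proof -
  assume *: "\<And>w. w \<in> sphere 0 1 \<Longrightarrow> \<phi> w = \<psi> w"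
  have "bump z * \<phi> (retr z) = bump z * \<psi> (retr z)" for z
    using *[OF retr_in_sphere, of z] bump_eq_0[of z] by (cases "norm z \<ge> 1") auto
  then have "(\<lambda>z. bump z * \<phi> (retr z)) = (\<lambda>z. bump z * \<psi> (retr z))" by blast
  then show ?thesis unfolding mean_def by presburger
qed

text \<open>
Strict positivity of the average: a continuous nonnegative integrand with integral zero vanishes, and
the weight is positive at \<open>(5/2) w\<close>.
\<close>
lemma bump_integral_eq_0:
  fixes \<phi> :: "'a::euclidean_space \<Rightarrow> real"
  assumes "continuous_on (cball 0 1) \<phi>" "\<And>w. w \<in> sphere 0 1 \<Longrightarrow> \<phi> w \<ge> 0"
    "integral bump_box (\<lambda>z. bump z * \<phi> (retr z)) = 0" "w \<in> sphere 0 1"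
  shows "\<phi> w = 0"
proof -
  have nn: "bump z * \<phi> (retr z) \<ge> 0" for z
    using assms(2)[OF retr_in_sphere, of z] bump_eq_0[of z] bump_nonneg[of z] by (cases "norm z \<ge> 1") auto
  have c: "continuous_on bump_box (\<lambda>z. bump z * \<phi> (retr z))"
    by (intro continuous_intros continuous_on_compose2[OF assms(1), of _ retr]) (use retr_in_cball in blast)
  have "bump ((5/2) *\<^sub>R w) * \<phi> (retr ((5/2) *\<^sub>R w)) = 0"
  proof (rule has_integral_0_cbox_imp_0[where f="\<lambda>z. bump z * \<phi> (retr z)"])
    show "continuous_on (cbox (-3 *\<^sub>R One) (3 *\<^sub>R One)) (\<lambda>z. bump z * \<phi> (retr z))"
      using c by (simp add: bump_box_def)
    show "((\<lambda>z. bump z * \<phi> (retr z)) has_integral 0) (cbox (-3 *\<^sub>R One) (3 *\<^sub>R One))"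
      using integrable_integral[OF bump_mult_integrable[OF assms(1)]] assms(3) by (simp add: bump_box_def)
    show "box (-3 *\<^sub>R One) (3 *\<^sub>R (One::'a)) \<noteq> {}"
      by (simp add: box_ne_empty inner_Basis)
    show "(5/2) *\<^sub>R w \<in> cbox (-3 *\<^sub>R One) (3 *\<^sub>R One)"
      using mem_bump_box[of "(5/2) *\<^sub>R w"] assms(4) by (simp add: bump_box_def)
  qed (use nn in auto)
  then show ?thesis using bump_pos[of w] assms(4) retr_scale[of w "5/2"] by auto
qed

lemma bump_integral_pos: "integral bump_box (bump :: 'a::euclidean_space \<Rightarrow> real) > 0"
proof -
  obtain w :: 'a where w: "norm w = 1" using exists_norm_1 by blast
  have "integral bump_box (bump :: 'a \<Rightarrow> real) \<noteq> 0"
    using bump_integral_eq_0[of "\<lambda>_. 1" w] w by auto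
  moreover have "integral bump_box (bump :: 'a \<Rightarrow> real) \<ge> 0"
    using bump_mult_integrable[of "\<lambda>_. 1"] bump_nonneg by (intro integral_nonneg) auto
  ultimately show ?thesis by simp
qed

lemma mean_eq_0_imp:
  assumes "continuous_on (cball 0 1) \<phi>" "\<And>w. w \<in> sphere 0 1 \<Longrightarrow> \<phi> w \<ge> 0" "mean \<phi> = 0" "w \<in> sphere 0 1"
  shows "\<phi> w = 0"
  using bump_integral_eq_0[OF assms(1,2) _ assms(4)] assms(3) bump_integral_pos
  by (auto simp: mean_def less_le)

lemma mean_const: "mean (\<lambda>w::'a::euclidean_space. c) = c"
  using bump_integral_pos[where 'a='a] by (auto simp: mean_def)

lemma mean_add:
  "continuous_on (cball 0 1) f \<Longrightarrow> continuous_on (cball 0 1) g \<Longrightarrow> mean (\<lambda>w. f w + g w) = mean f + mean g"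
  by (simp add: mean_def distrib_left integral_add bump_mult_integrable add_divide_distrib)

lemma mean_cmult: "mean (\<lambda>w. c * f w) = c * mean f"
proof -
  have "(\<lambda>z. bump z * (c * f (retr z))) = (\<lambda>z. c * (bump z * f (retr z)))" by (simp add: mult_ac)
  then show ?thesis by (simp add: mean_def)
qed

lemma mean_diff:
  "continuous_on (cball 0 1) f \<Longrightarrow> continuous_on (cball 0 1) g \<Longrightarrow> mean (\<lambda>w. f w - g w) = mean f - mean g"
  by (simp add: mean_def right_diff_distrib integral_diff bump_mult_integrable diff_divide_distrib)

lemma mean_sum:
  "(\<And>i. i \<in> I \<Longrightarrow> continuous_on (cball 0 1) (f i)) \<Longrightarrow> mean (\<lambda>w. \<Sum>i\<in>I. f i w) = (\<Sum>i\<in>I. mean (f i))"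
proof (induction I rule: infinite_finite_induct)
  case (insert x F)
  then show ?case by (simp add: mean_add continuous_on_sum)
qed (simp_all add: mean_const)

lemma mean_has_derivative:
  fixes F :: "'y::euclidean_space \<Rightarrow> 'a::euclidean_space \<Rightarrow> real"
  assumes der: "\<And>y w. y \<in> Y \<Longrightarrow> w \<in> cball 0 1 \<Longrightarrow>
      ((\<lambda>y. F y w) has_derivative (\<lambda>v. \<Sum>b\<in>Basis. (v \<bullet> b) * F' b y w)) (at y within Y)"
    and cF: "\<And>y. y \<in> Y \<Longrightarrow> continuous_on (cball 0 1) (F y)"
    and cF': "\<And>b. b \<in> Basis \<Longrightarrow> continuous_on (Y \<times> cball 0 1) (\<lambda>p. F' b (fst p) (snd p))"
    and y: "y \<in> Y" "convex Y"
  shows "((\<lambda>y. mean (F y)) has_derivative (\<lambda>v. \<Sum>b\<in>Basis. (v \<bullet> b) * mean (F' b y))) (at y within Y)"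
proof -
  define fx where "fx = (\<lambda>y z. \<Sum>b\<in>Basis. (bump z * F' b y (retr z)) *\<^sub>R blinfun_inner_left (b::'y))"
  have cF'y: "continuous_on (cball 0 1) (F' b y)" if "b \<in> Basis" for b
  proof -
    have "continuous_on (cball 0 1) (\<lambda>w::'a. (y, w))" by (intro continuous_intros)
    then show ?thesis
      using continuous_on_compose2[OF cF'[OF that], of "cball 0 1" "\<lambda>w. (y, w)"] y by auto
  qed
  have "((\<lambda>y. integral (cbox (-3 *\<^sub>R One) (3 *\<^sub>R One)) (\<lambda>z. bump z * F y (retr z))) has_derivative
      integral (cbox (-3 *\<^sub>R One) (3 *\<^sub>R One)) (fx y)) (at y within Y)"
  proof (rule leibniz_rule[OF _ _ _ y])
    fix y z assume y: "y \<in> Y"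
    have "blinfun_apply (fx y z) = (\<lambda>v. bump z * (\<Sum>b\<in>Basis. (v \<bullet> b) * F' b y (retr z)))"
      by (auto simp: fx_def blinfun.sum_left blinfun.scaleR_left sum_distrib_left mult_ac inner_commute)
    then show "((\<lambda>y. bump z * F y (retr z)) has_derivative blinfun_apply (fx y z)) (at y within Y)"
      using has_derivative_mult_right[OF der[OF y retr_in_cball]] by simp
  next
    fix y assume "y \<in> Y"
    then show "(\<lambda>z. bump z * F y (retr z)) integrable_on cbox (- 3 *\<^sub>R One) (3 *\<^sub>R One)"
      using bump_mult_integrable[OF cF] by (simp add: bump_box_def)
  next
    show "continuous_on (Y \<times> cbox (- 3 *\<^sub>R One) (3 *\<^sub>R One)) (\<lambda>(x, t). fx x t)"
      unfolding fx_def split_beta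
    proof (intro continuous_intros)
      fix b :: 'y assume b: "b \<in> Basis"
      show "continuous_on (Y \<times> cbox (- 3 *\<^sub>R One) (3 *\<^sub>R One)) (\<lambda>x. bump (snd x))"
        by (intro continuous_on_compose2[OF continuous_on_bump[of UNIV]] continuous_intros) auto
      have "continuous_on (Y \<times> cbox (- 3 *\<^sub>R One) (3 *\<^sub>R One)) (\<lambda>x. (fst x, retr (snd x :: 'a)))"
        by (intro continuous_intros continuous_on_compose2[OF continuous_on_retr[of UNIV]]) auto
      then show "continuous_on (Y \<times> cbox (- 3 *\<^sub>R One) (3 *\<^sub>R One)) (\<lambda>x. F' b (fst x) (retr (snd x)))"
        using continuous_on_compose2[OF cF'[OF b], of "Y \<times> cbox (- 3 *\<^sub>R One) (3 *\<^sub>R One)"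
            "\<lambda>x. (fst x, retr (snd x :: 'a))"] retr_in_cball
        by (auto simp: image_subset_iff)
    qed
  qed
  moreover have "blinfun_apply (integral (cbox (-3 *\<^sub>R One) (3 *\<^sub>R One)) (fx y))
      = (\<lambda>v. \<Sum>b\<in>Basis. (v \<bullet> b) * integral bump_box (\<lambda>z. bump z * F' b y (retr z)))"
  proof (rule ext)
    fix v
    have i: "((\<lambda>z. bump z * F' b y (retr z)) has_integral integral bump_box (\<lambda>z. bump z * F' b y (retr z))) bump_box"
      if "b \<in> Basis" for b using bump_mult_integrable[OF cF'y[OF that]] by (simp add: integrable_integral)
    have "(fx y has_integral (\<Sum>b\<in>Basis. integral bump_box (\<lambda>z. bump z * F' b y (retr z)) *\<^sub>R blinfun_inner_left b)) bump_box"
      unfolding fx_def by (intro has_integral_sum has_integral_scaleR_left i) auto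
    then have "integral bump_box (fx y) = (\<Sum>b\<in>Basis. integral bump_box (\<lambda>z. bump z * F' b y (retr z)) *\<^sub>R blinfun_inner_left b)"
      by (rule integral_unique)
    then show "blinfun_apply (integral (cbox (-3 *\<^sub>R One) (3 *\<^sub>R One)) (fx y)) v
      = (\<Sum>b\<in>Basis. (v \<bullet> b) * integral bump_box (\<lambda>z. bump z * F' b y (retr z)))"
      unfolding bump_box_def[symmetric]
      by (auto simp: blinfun.sum_left blinfun.scaleR_left mult_ac inner_commute intro!: sum.cong)
  qed
  ultimately have "((\<lambda>y. integral bump_box (\<lambda>z. bump z * F y (retr z))) has_derivative
     (\<lambda>v. \<Sum>b\<in>Basis. (v \<bullet> b) * integral bump_box (\<lambda>z. bump z * F' b y (retr z)))) (at y within Y)"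
    unfolding bump_box_def by simp
  from has_derivative_mult_right[OF this, of "inverse (integral bump_box (bump :: 'a \<Rightarrow> real))"]
  show ?thesis by (simp add: mean_def divide_inverse sum_distrib_left mult_ac)
qed

text \<open>
Three families of linear maps \<open>l w\<close> are used: \<open>r \<mapsto> r w\<close>, \<open>(r, t) \<mapsto> (r w, t)\<close>, and \<open>(x, t) \<mapsto> x + t w\<close>. The
weight \<open>c\<close> is needed because differentiation in the parameter produces factors that depend on \<open>w\<close>.
\<close>
definition pmean :: "('a::euclidean_space \<Rightarrow> real) \<Rightarrow> ('a \<Rightarrow> 'y \<Rightarrow> 'q) \<Rightarrow> ('q \<Rightarrow> real) \<Rightarrow> 'y \<Rightarrow> real" where
  "pmean c l \<phi> y = mean (\<lambda>w. c w * \<phi> (l w y))"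

locale pullback =
  fixes X :: "'q::euclidean_space set" and Y :: "'y::euclidean_space set"
    and l :: "'a::euclidean_space \<Rightarrow> 'y \<Rightarrow> 'q"
  assumes X: "convex_body X" and Y: "convex Y"
    and lin: "\<And>w. bounded_linear (l w)"
    and contl: "continuous_on UNIV (\<lambda>p. l (fst p) (snd p))"
    and maps: "\<And>w y. w \<in> cball 0 1 \<Longrightarrow> y \<in> Y \<Longrightarrow> l w y \<in> X"
begin

lemma pcont:
  fixes \<phi> :: "'q \<Rightarrow> real"
  assumes "continuous_on (cball 0 1) c" "continuous_on X \<phi>"
  shows "continuous_on (Y \<times> cball 0 1) (\<lambda>p. c (snd p) * \<phi> (l (snd p) (fst p)))"
proof -
  have "continuous_on (Y \<times> cball 0 1) (\<lambda>p. l (snd p) (fst p))"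
  proof -
    have "continuous_on (Y \<times> cball 0 1) (\<lambda>p::'y \<times> 'a. (snd p, fst p))" by (intro continuous_intros)
    then show ?thesis
      using continuous_on_compose2[OF contl, of _ "\<lambda>p. (snd p, fst p)"] by auto
  qed
  moreover have "(\<lambda>p. l (snd p) (fst p)) ` (Y \<times> cball 0 1) \<subseteq> X" using maps by auto
  ultimately have 1: "continuous_on (Y \<times> cball 0 1) (\<lambda>p. \<phi> (l (snd p) (fst p)))"
    using continuous_on_compose2[OF assms(2), of "Y \<times> cball 0 1" "\<lambda>p. l (snd p) (fst p)"] by simp
  have "continuous_on (Y \<times> cball 0 1) (\<lambda>p. c (snd p))"
    by (rule continuous_on_compose2[OF assms(1) continuous_on_snd[OF continuous_on_id]]) auto
  with 1 show ?thesis by (intro continuous_intros)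
qed

lemma pcont_w:
  fixes \<phi> :: "'q \<Rightarrow> real"
  assumes "continuous_on (cball 0 1) c" "continuous_on X \<phi>" "y \<in> Y"
  shows "continuous_on (cball 0 1) (\<lambda>w. c w * \<phi> (l w y))"
proof -
  have "continuous_on (cball 0 1) (\<lambda>w::'a. (y, w))" by (intro continuous_intros)
  then show ?thesis
    using continuous_on_compose2[OF pcont[OF assms(1,2)], of "cball 0 1" "\<lambda>w. (y, w)"] assms(3) by auto
qed

lemma contl_w: "continuous_on A (\<lambda>w. l w y)"
proof -
  have "continuous_on A (\<lambda>w::'a. (w, y))" by (intro continuous_intros)
  then show ?thesis using continuous_on_compose2[OF contl, of A "\<lambda>w. (w, y)"] by auto
qed

lemma pmean_has_derivative_aux:
  assumes c: "continuous_on (cball 0 1) c" and s: "smooth_on X \<phi>" and y: "y \<in> Y"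
  shows "(pmean c l \<phi> has_derivative
    (\<lambda>v. \<Sum>b\<in>Basis. (v \<bullet> b) * (\<Sum>d\<in>Basis. pmean (\<lambda>w. c w * (l w b \<bullet> d)) l (dd X d \<phi>) y))) (at y within Y)"
proof -
  define F' where "F' = (\<lambda>b y w. \<Sum>d\<in>Basis. (c w * (l w b \<bullet> d)) * dd X d \<phi> (l w y))"
  have cc: "continuous_on (cball 0 1) (\<lambda>w. c w * (l w b \<bullet> d))" for b d
    by (intro continuous_intros c contl_w)
  have "((\<lambda>y. mean (\<lambda>w. c w * \<phi> (l w y))) has_derivative (\<lambda>v. \<Sum>b\<in>Basis. (v \<bullet> b) * mean (F' b y))) (at y within Y)"
  proof (rule mean_has_derivative[OF _ _ _ y Y])
    fix y and w :: 'a assume y: "y \<in> Y" and w: "w \<in> cball 0 1"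
    interpret lw: bounded_linear "l w" by (rule lin)
    have "((\<lambda>y. \<phi> (l w y)) has_derivative (\<lambda>v. dd X (l w v) \<phi> (l w y))) (at y within Y)"
    proof (rule has_derivative_in_compose2[where t=X and f="l w" and g="\<phi>" and g'="\<lambda>x v. dd X v \<phi> x"])
      show "\<And>x. x \<in> X \<Longrightarrow> (\<phi> has_derivative (\<lambda>v. dd X v \<phi> x)) (at x within X)"
        using smooth_on_has_derivative[OF X s] by blast
      show "l w ` Y \<subseteq> X" using maps w by auto
      show "(l w has_derivative l w) (at y within Y)" using lin bounded_linear_imp_has_derivative by blast
    qed (use y in auto)
    then have 1: "((\<lambda>y. c w * \<phi> (l w y)) has_derivative (\<lambda>v. c w * dd X (l w v) \<phi> (l w y))) (at y within Y)"
      by (rule has_derivative_mult_right)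
    have "c w * dd X (l w v) \<phi> (l w y) = (\<Sum>b\<in>Basis. (v \<bullet> b) * F' b y w)" for v
    proof -
      have "l w v = (\<Sum>b\<in>Basis. (v \<bullet> b) *\<^sub>R l w b)"
        by (metis (no_types, lifting) euclidean_representation lw.scaleR lw.sum sum.cong)
      then have "l w v \<bullet> d = (\<Sum>b\<in>Basis. (v \<bullet> b) * (l w b \<bullet> d))" for d
        by (simp add: inner_sum_left)
      then have "c w * dd X (l w v) \<phi> (l w y) =
         (\<Sum>d\<in>Basis. \<Sum>b\<in>Basis. (v \<bullet> b) * (c w * (l w b \<bullet> d) * dd X d \<phi> (l w y)))"
        using dd_direction_sum[OF X s maps[OF w y], of "l w v"]
        by (simp add: sum_distrib_left sum_distrib_right mult_ac)
      then show ?thesis unfolding F'_def sum_distrib_left by (subst sum.swap) simp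
    qed
    then show "((\<lambda>y. c w * \<phi> (l w y)) has_derivative (\<lambda>v. \<Sum>b\<in>Basis. (v \<bullet> b) * F' b y w)) (at y within Y)"
      using 1 by simp
  next
    fix y assume "y \<in> Y"
    then show "continuous_on (cball 0 1) (\<lambda>w. c w * \<phi> (l w y))"
      using pcont_w[OF c smooth_on_continuous[OF s]] by simp
  next
    fix b :: 'y
    show "continuous_on (Y \<times> cball 0 1) (\<lambda>p. F' b (fst p) (snd p))"
      unfolding F'_def
      by (intro continuous_on_sum pcont cc smooth_on_continuous[OF smooth_on_dd[OF X s]])
  qed
  moreover have "mean (F' b y) = (\<Sum>d\<in>Basis. pmean (\<lambda>w. c w * (l w b \<bullet> d)) l (dd X d \<phi>) y)" for b
    unfolding F'_def pmean_def
    by (intro mean_sum pcont_w cc smooth_on_continuous[OF smooth_on_dd[OF X s]] y)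
  ultimately show ?thesis by (simp add: pmean_def[abs_def])
qed

text \<open>
The derivative of an average of this kind is a sum of averages of the same kind, with other weights
and with the derivatives of \<open>\<phi>\<close>.
\<close>
lemma pmean_smooth:
  assumes "continuous_on (cball 0 1) c" "smooth_on X \<phi>"
  shows "smooth_on Y (pmean c l \<phi>)"
  unfolding smooth_on_def
proof
  fix k
  show "Ck_on k Y (pmean c l \<phi>)" using assms
  proof (induction k arbitrary: c \<phi>)
    case 0
    have "continuous_on Y (pmean c l \<phi>)"
      using pmean_has_derivative_aux[OF 0] has_derivative_continuous continuous_on_eq_continuous_within by blast
    then show ?case by simp
  next
    case (Suc k)
    have *: "Ck_on k Y (\<lambda>y. \<Sum>b\<in>I. (v \<bullet> b) * (\<Sum>d\<in>J. pmean (\<lambda>w. c w * (l w b \<bullet> d)) l (dd X d \<phi>) y))"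
      if "finite I" "finite J" for I J v
    proof -
      have s: "Ck_on k Y (\<lambda>y. \<Sum>i\<in>A. f i y)" if "finite A" "\<And>i. Ck_on k Y (f i)"
        for A :: "'z set" and f
        using that by (induction A) (auto intro: Ck_on_add Ck_on_const)
      have s2: "Ck_on k Y (\<lambda>y. \<Sum>i\<in>A. f i y)" if "finite A" "\<And>i. Ck_on k Y (f i)"
        for A :: "'y set" and f
        using that by (induction A) (auto intro: Ck_on_add Ck_on_const)
      have s3: "Ck_on k Y (\<lambda>y. \<Sum>i\<in>A. f i y)" if "finite A" "\<And>i. Ck_on k Y (f i)"
        for A :: "'q set" and f
        using that by (induction A) (auto intro: Ck_on_add Ck_on_const)
      show ?thesis
        by (intro s2 s3 that Ck_on_mult Ck_on_const Suc.IH smooth_on_dd X Suc.prems continuous_intros contl_w)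
    qed
    show ?case unfolding Ck_on.simps
      by (rule exI[of _ "\<lambda>y v. \<Sum>b\<in>Basis. (v \<bullet> b) * (\<Sum>d\<in>Basis. pmean (\<lambda>w. c w * (l w b \<bullet> d)) l (dd X d \<phi>) y)"])
        (use pmean_has_derivative_aux[OF Suc.prems] *[OF finite_Basis finite_Basis] in auto)
  qed
qed

lemma dd_pmean:
  assumes "convex_body Y" "continuous_on (cball 0 1) c" "smooth_on X \<phi>" "y \<in> Y"
  shows "dd Y v (pmean c l \<phi>) y = mean (\<lambda>w. c w * dd X (l w v) \<phi> (l w y))"
proof -
  have "dd Y v (pmean c l \<phi>) y =
      (\<Sum>b\<in>Basis. (v \<bullet> b) * (\<Sum>d\<in>Basis. pmean (\<lambda>w. c w * (l w b \<bullet> d)) l (dd X d \<phi>) y))"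
    using dd_eqI[OF assms(1,4) pmean_has_derivative_aux[OF assms(2-4)]] .
  also have "\<dots> = (\<Sum>b\<in>Basis. \<Sum>d\<in>Basis. mean (\<lambda>w. (v \<bullet> b) * ((c w * (l w b \<bullet> d)) * dd X d \<phi> (l w y))))"
    by (simp add: pmean_def mean_cmult sum_distrib_left)
  also have "\<dots> = mean (\<lambda>w. \<Sum>b\<in>Basis. \<Sum>d\<in>Basis. (v \<bullet> b) * ((c w * (l w b \<bullet> d)) * dd X d \<phi> (l w y)))"
    by (subst mean_sum, intro continuous_on_sum continuous_on_mult_left pcont_w continuous_intros contl_w assms smooth_on_continuous
        smooth_on_dd X, subst mean_sum, intro continuous_on_sum continuous_on_mult_left pcont_w continuous_intros contl_w assms smooth_on_continuous
        smooth_on_dd X, simp)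
  also have "\<dots> = mean (\<lambda>w. c w * dd X (l w v) \<phi> (l w y))"
  proof (rule mean_cong_sphere)
    fix w :: 'a assume w: "w \<in> sphere 0 1"
    interpret lw: bounded_linear "l w" by (rule lin)
    have "l w v = (\<Sum>b\<in>Basis. (v \<bullet> b) *\<^sub>R l w b)"
      by (metis (no_types, lifting) euclidean_representation lw.scaleR lw.sum sum.cong)
    then have "l w v \<bullet> d = (\<Sum>b\<in>Basis. (v \<bullet> b) * (l w b \<bullet> d))" for d
      by (simp add: inner_sum_left)
    then have "c w * dd X (l w v) \<phi> (l w y) =
         (\<Sum>d\<in>Basis. \<Sum>b\<in>Basis. (v \<bullet> b) * ((c w * (l w b \<bullet> d)) * dd X d \<phi> (l w y)))"
      using dd_direction_sum[OF X assms(3) maps[of w y], of "l w v"] w assms(4)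
      by (simp add: sum_distrib_left sum_distrib_right mult_ac)
    then show "(\<Sum>b\<in>Basis. \<Sum>d\<in>Basis. (v \<bullet> b) * ((c w * (l w b \<bullet> d)) * dd X d \<phi> (l w y))) = c w * dd X (l w v) \<phi> (l w y)"
      by (subst sum.swap) simp
  qed
  finally show ?thesis .
qed

end

section \<open>Integration by parts on spheres\<close>

lemma positive_part_square_derivative: "((\<lambda>s::real. (max 0 s)\<^sup>2) has_real_derivative 2 * max 0 s) (at s)"
proof -
  consider "s > 0" | "s < 0" | "s = 0" by linarith
  then show ?thesis
  proof cases
    case 1
    have "((\<lambda>s::real. s\<^sup>2) has_real_derivative 2 * s) (at s)" by (auto intro!: derivative_eq_intros)
    then have "((\<lambda>s::real. (max 0 s)\<^sup>2) has_real_derivative 2 * s) (at s)"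
      by (rule has_field_derivative_transform_within_open[where S="{0<..}"]) (use 1 in auto)
    then show ?thesis using 1 by simp
  next
    case 2
    have "((\<lambda>s::real. 0) has_real_derivative 0) (at s)" by auto
    then have "((\<lambda>s::real. (max 0 s)\<^sup>2) has_real_derivative 0) (at s)"
      by (rule has_field_derivative_transform_within_open[where S="{..<0}"]) (use 2 in auto)
    then show ?thesis using 2 by simp
  next
    case 3
    have "((\<lambda>h::real. ((max 0 h)\<^sup>2) / h) \<longlongrightarrow> 0) (at 0)"
    proof (rule Lim_null_comparison)
      show "\<forall>\<^sub>F h in at (0::real). norm ((max 0 h)\<^sup>2 / h) \<le> \<bar>h\<bar>"
        by (auto simp: eventually_at_filter max_def power2_eq_square intro!: always_eventually)
      show "((\<lambda>h::real. \<bar>h\<bar>) \<longlongrightarrow> 0) (at 0)" by (intro tendsto_eq_intros) auto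
    qed
    then show ?thesis using 3 by (simp add: DERIV_def)
  qed
qed

text \<open>
The integral of a compactly supported function does not change under translations; differentiate
this in the direction \<open>v\<close>.
\<close>
lemma integral_directional_derivative_eq_0:
  fixes \<Phi> :: "'a::euclidean_space \<Rightarrow> real"
  assumes der: "\<And>z. (\<Phi> has_derivative \<Phi>' z) (at z)"
    and cont: "continuous_on UNIV (\<lambda>z. \<Phi>' z v)"
    and supp: "\<And>z. norm z \<ge> 3 \<Longrightarrow> \<Phi> z = 0" "\<And>z. norm z \<ge> 3 \<Longrightarrow> \<Phi>' z v = 0"
  shows "integral bump_box (\<lambda>z. \<Phi>' z v) = 0"
proof -
  define B :: "'a set" where "B = cbox (-4 *\<^sub>R One) (4 *\<^sub>R One)"
  define d where "d = 1 / (norm v + 1)"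
  have nv: "norm v + 1 > 0" by (simp add: add_nonneg_pos)
  have d: "d > 0" "d * norm v \<le> 1" using nv by (auto simp: d_def divide_simps)
  have outside: "norm z \<ge> 3" if "z \<notin> bump_box" for z :: 'a using mem_bump_box that by force
  have c\<Phi>: "continuous_on A \<Phi>" for A
    by (intro continuous_at_imp_continuous_on ballI has_derivative_continuous[OF der])
  have sub: "bump_box \<subseteq> B" unfolding bump_box_def B_def
    by (rule subset_box_imp) (auto simp: inner_Basis)
  have int_big: "integral C f = integral bump_box f"
    if "bump_box \<subseteq> C" "\<And>z. norm z \<ge> 3 \<Longrightarrow> f z = 0" "continuous_on UNIV f" for C and f :: "'a \<Rightarrow> real"
  proof (rule integral_unique, rule has_integral_on_superset)
    show "(f has_integral integral bump_box f) bump_box"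
      unfolding bump_box_def by (rule integrable_integral, rule integrable_continuous) (use that(3) continuous_on_subset in blast)
    show "f x = 0" if "x \<notin> bump_box" for x using that outside \<open>\<And>z. norm z \<ge> 3 \<Longrightarrow> f z = 0\<close> by blast
  qed fact
  have const: "integral B (\<lambda>z. \<Phi> (z + s *\<^sub>R v)) = integral bump_box \<Phi>" if s: "s \<in> {-d..d}" for s
  proof -
    have "norm (s *\<^sub>R v) \<le> d * norm v" using s by (auto intro!: mult_right_mono)
    then have sv: "\<bar>(s *\<^sub>R v) \<bullet> b\<bar> \<le> 1" if "b \<in> Basis" for b
      using Basis_le_norm[OF that, of "s *\<^sub>R v"] d(2) by linarith
    have "integral B (\<lambda>z. \<Phi> (z + s *\<^sub>R v)) = integral (cbox (-4 *\<^sub>R One + s *\<^sub>R v) (4 *\<^sub>R One + s *\<^sub>R v)) \<Phi>"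
      unfolding B_def
      using integral_shift_cbox_plus[of "-4 *\<^sub>R One" "4 *\<^sub>R One" \<Phi> "s *\<^sub>R v"] by (simp add: o_def add.commute)
    also have "\<dots> = integral bump_box \<Phi>"
    proof (rule int_big[OF _ supp(1) c\<Phi>])
      show "bump_box \<subseteq> cbox (-4 *\<^sub>R One + s *\<^sub>R v) (4 *\<^sub>R One + s *\<^sub>R v)"
        unfolding bump_box_def
      proof (rule subset_box_imp, rule ballI)
        fix i :: 'a assume i: "i \<in> Basis"
        then show "(-4 *\<^sub>R One + s *\<^sub>R v) \<bullet> i \<le> (-3 *\<^sub>R One) \<bullet> i \<and> (3 *\<^sub>R One) \<bullet> i \<le> (4 *\<^sub>R One + s *\<^sub>R v) \<bullet> i"
        proof -
          have "(One::'a) \<bullet> i = 1" using i by simp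
          then show ?thesis using sv[OF i] by (simp only: inner_add_left abs_le_iff inner_scaleR_left) linarith
        qed
      qed
    qed
    finally show ?thesis .
  qed
  have "((\<lambda>s. integral B (\<lambda>z. \<Phi> (z + s *\<^sub>R v))) has_field_derivative integral B (\<lambda>z. \<Phi>' (z + 0 *\<^sub>R v) v)) (at 0 within {-d..d})"
    unfolding B_def
  proof (rule leibniz_rule_field_derivative)
    fix s :: real and z :: 'a
    have "((\<lambda>s. z + s *\<^sub>R v) has_derivative (\<lambda>h. h *\<^sub>R v)) (at s within {-d..d})"
      by (auto intro!: derivative_eq_intros)
    from has_derivative_compose[OF this der]
    have "((\<lambda>s. \<Phi> (z + s *\<^sub>R v)) has_derivative (\<lambda>h. \<Phi>' (z + s *\<^sub>R v) (h *\<^sub>R v))) (at s within {-d..d})" .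
    moreover have "\<Phi>' (z + s *\<^sub>R v) (h *\<^sub>R v) = \<Phi>' (z + s *\<^sub>R v) v * h" for h
      using linear_scale[OF has_derivative_linear[OF der]] by simp
    ultimately show "((\<lambda>s. \<Phi> (z + s *\<^sub>R v)) has_field_derivative \<Phi>' (z + s *\<^sub>R v) v) (at s within {-d..d})"
      by (simp add: has_field_derivative_def)
  next
    fix s show "(\<lambda>z. \<Phi> (z + s *\<^sub>R v)) integrable_on cbox (- 4 *\<^sub>R One) (4 *\<^sub>R One)"
      by (intro integrable_continuous continuous_on_compose2[OF c\<Phi>[of UNIV]] continuous_intros) auto
  next
    show "continuous_on ({- d..d} \<times> cbox (- 4 *\<^sub>R One) (4 *\<^sub>R One)) (\<lambda>(x, t). \<Phi>' (t + x *\<^sub>R v) v)"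
      unfolding split_beta by (intro continuous_on_compose2[OF cont] continuous_intros) auto
  qed (use d in auto)
  then have "((\<lambda>s. integral bump_box \<Phi>) has_field_derivative integral B (\<lambda>z. \<Phi>' z v)) (at 0 within {-d..d})"
    using has_field_derivative_transform_within[where d=1 and S="{-d..d}" and g="\<lambda>s. integral bump_box \<Phi>"] const d
    by fastforce
  moreover have "((\<lambda>s. integral bump_box \<Phi>) has_field_derivative 0) (at 0)" by simp
  moreover have "at 0 within {-d..d} = at 0" using d by (intro at_within_interior) simp
  ultimately have "integral B (\<lambda>z. \<Phi>' z v) = 0" using DERIV_unique by metis
  moreover have "integral B (\<lambda>z. \<Phi>' z v) = integral bump_box (\<lambda>z. \<Phi>' z v)"
    by (rule int_big[OF sub supp(2) cont])
  ultimately show ?thesis by simp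
qed

definition bump' :: "'a::euclidean_space \<Rightarrow> 'a \<Rightarrow> real" where
  "bump' z v = (4 * max 0 ((z \<bullet> z - 4) * (9 - z \<bullet> z)) * (13 - 2 * (z \<bullet> z))) * (z \<bullet> v)"

lemma bump_has_derivative: "(bump has_derivative bump' z) (at z)"
proof -
  have "((\<lambda>z. (z \<bullet> z - 4) * (9 - z \<bullet> z)) has_derivative
      (\<lambda>v. (2 * (13 - 2 * (z \<bullet> z))) * (z \<bullet> v))) (at z)"
    by (auto intro!: derivative_eq_intros simp: inner_commute algebra_simps)
  from has_derivative_compose[OF this positive_part_square_derivative[unfolded has_field_derivative_def]]
  have "((\<lambda>z. (max 0 ((z \<bullet> z - 4) * (9 - z \<bullet> z)))\<^sup>2) has_derivative
      (\<lambda>v. 2 * max 0 ((z \<bullet> z - 4) * (9 - z \<bullet> z)) * ((2 * (13 - 2 * (z \<bullet> z))) * (z \<bullet> v)))) (at z)" .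
  moreover have "(\<lambda>v. 2 * max 0 ((z \<bullet> z - 4) * (9 - z \<bullet> z)) * ((2 * (13 - 2 * (z \<bullet> z))) * (z \<bullet> v))) = bump' z"
    by (auto simp: bump'_def algebra_simps)
  ultimately show ?thesis by (simp add: bump_def[abs_def])
qed

lemma bump'_eq_0: "norm z \<le> 2 \<or> norm z \<ge> 3 \<Longrightarrow> bump' z v = 0"
  using bump_eq_0[of z] by (simp add: bump_def bump'_def)

text \<open>
The invariance of the average under infinitesimal rotations in the plane of \<open>b\<close> and \<open>j\<close>. The field
\<open>z \<mapsto> (z \<bullet> b) j - (z \<bullet> j) b\<close> is divergence free and tangential to all spheres around the origin, so it does
not see the radial weight and the integral over the shell reduces to the average.
\<close>
lemma mean_rotation:
  fixes \<phi> :: "'a::euclidean_space \<Rightarrow> real"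
  assumes der: "\<And>x. x \<in> ball 0 1 \<Longrightarrow> (\<phi> has_derivative \<phi>' x) (at x)"
    and cont: "\<And>v. continuous_on (ball 0 1) (\<lambda>x. \<phi>' x v)"
    and r: "0 < r" "r < 1"
  shows "mean (\<lambda>w. (w \<bullet> b) * \<phi>' (r *\<^sub>R w) j - (w \<bullet> j) * \<phi>' (r *\<^sub>R w) b) = 0"
proof -
  have inb: "r *\<^sub>R retr z \<in> ball 0 1" for z :: 'a
  proof -
    have "r * norm (retr z) \<le> r * 1" using retr_in_cball[of z] r by (intro mult_left_mono) auto
    also have "\<dots> < 1" using r by simp
    finally have "norm (r *\<^sub>R retr z) < 1" using r(1) by simp
    then show ?thesis by (simp only: mem_ball_0)
  qed
  define m where "m = (\<lambda>z::'a. max 1 (norm z))"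
  have m: "m z > 0" for z by (simp add: m_def)
  define u where "u = (\<lambda>(z::'a) v. r *\<^sub>R ((1 / m z) *\<^sub>R v - ((z \<bullet> v) / m z ^ 3) *\<^sub>R z))"
  define \<Psi> where "\<Psi> = (\<lambda>z. bump z * \<phi> (r *\<^sub>R retr z))"
  define \<Psi>' where "\<Psi>' = (\<lambda>z v. bump' z v * \<phi> (r *\<^sub>R retr z) + bump z * \<phi>' (r *\<^sub>R retr z) (u z v))"
  have lin: "linear (\<phi>' (r *\<^sub>R retr z))" for z
    using der[OF inb] has_derivative_linear by blast
  have der\<Psi>: "(\<Psi> has_derivative \<Psi>' z) (at z)" for z
  proof (cases "norm z > 1")
    case True
    have z0: "z \<noteq> 0" using True by auto
    have "((\<lambda>z. r *\<^sub>R ((1 / norm z) *\<^sub>R z)) has_derivative u z) (at z)"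
      using True z0 unfolding u_def m_def
      by (auto intro!: derivative_eq_intros has_derivative_norm simp: algebra_simps sgn_div_norm power3_eq_cube divide_inverse inner_commute)
    then have "((\<lambda>z. r *\<^sub>R retr z) has_derivative u z) (at z)"
      by (rule has_derivative_transform_within_open[where s="- cball 0 1"])
        (use True in \<open>auto simp: retr_def divide_inverse\<close>)
    from has_derivative_compose[OF this der[OF inb]]
    have "((\<lambda>z. \<phi> (r *\<^sub>R retr z)) has_derivative (\<lambda>v. \<phi>' (r *\<^sub>R retr z) (u z v))) (at z)" .
    from has_derivative_mult[OF bump_has_derivative this]
    show ?thesis by (simp add: \<Psi>_def \<Psi>'_def[abs_def] add.commute)
  next
    case False
    have "((\<lambda>z::'a. 0::real) has_derivative (\<lambda>v. 0)) (at z)" by simp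
    then have "(\<Psi> has_derivative (\<lambda>v. 0)) (at z)"
      by (rule has_derivative_transform_within_open[where s="ball 0 2"])
        (use False in \<open>auto simp: \<Psi>_def intro!: bump_eq_0\<close>)
    then show ?thesis using False bump_eq_0[of z] bump'_eq_0[of z] by (simp add: \<Psi>'_def[abs_def])
  qed
  have c\<phi>: "continuous_on (ball 0 1) \<phi>"
    using der has_derivative_continuous continuous_at_imp_continuous_on by blast
  have cr: "continuous_on UNIV (\<lambda>z::'a. r *\<^sub>R retr z)"
    by (intro continuous_intros)
  have c1: "continuous_on UNIV (\<lambda>z. \<phi> (r *\<^sub>R retr z))"
    by (rule continuous_on_compose2[OF c\<phi> cr]) (use inb in auto)
  have c2: "continuous_on UNIV (\<lambda>z. \<phi>' (r *\<^sub>R retr z) v)" for v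
    by (rule continuous_on_compose2[OF cont cr]) (use inb in auto)
  have cm: "continuous_on UNIV m" unfolding m_def by (intro continuous_intros)
  have cu: "continuous_on UNIV (\<lambda>z. u z v)" for v
    unfolding u_def using m by (intro continuous_intros cm) (auto simp: less_imp_neq[symmetric])
  have c\<Psi>': "continuous_on UNIV (\<lambda>z. \<Psi>' z v)" for v
  proof -
    have "\<phi>' (r *\<^sub>R retr z) (u z v) = (\<Sum>d\<in>Basis. (u z v \<bullet> d) * \<phi>' (r *\<^sub>R retr z) d)" for z
    proof -
      have "\<phi>' (r *\<^sub>R retr z) (u z v) = \<phi>' (r *\<^sub>R retr z) (\<Sum>d\<in>Basis. (u z v \<bullet> d) *\<^sub>R d)"
        by (simp add: euclidean_representation)
      then show ?thesis by (simp add: linear_sum[OF lin] linear_scale[OF lin])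
    qed
    moreover have "continuous_on UNIV (\<lambda>z. bump' z v)" unfolding bump'_def by (intro continuous_intros)
    ultimately show ?thesis unfolding \<Psi>'_def by (auto intro!: continuous_intros c1 c2 cu)
  qed
  have c\<Psi>: "continuous_on UNIV \<Psi>" unfolding \<Psi>_def by (intro continuous_intros c1)
  have int0: "integral bump_box (\<lambda>z. (c \<bullet> a) * \<Psi> z + (z \<bullet> a) * \<Psi>' z c) = 0" for a c
  proof (rule integral_directional_derivative_eq_0[where \<Phi>="\<lambda>z. (z \<bullet> a) * \<Psi> z" and \<Phi>'="\<lambda>z c. (c \<bullet> a) * \<Psi> z + (z \<bullet> a) * \<Psi>' z c"])
    fix z
    show "((\<lambda>z. (z \<bullet> a) * \<Psi> z) has_derivative (\<lambda>c. (c \<bullet> a) * \<Psi> z + (z \<bullet> a) * \<Psi>' z c)) (at z)"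
      using has_derivative_mult[OF has_derivative_inner_left[OF has_derivative_ident] der\<Psi>] by (simp add: add.commute)
  next
    show "continuous_on UNIV (\<lambda>z. c \<bullet> a * \<Psi> z + z \<bullet> a * \<Psi>' z c)" by (intro continuous_intros c\<Psi> c\<Psi>')
  qed (auto simp: \<Psi>_def \<Psi>'_def bump_eq_0 bump'_eq_0)
  have integrable: "(\<lambda>z. (c \<bullet> a) * \<Psi> z + (z \<bullet> a) * \<Psi>' z c) integrable_on bump_box" for a c
    unfolding bump_box_def
    by (intro integrable_continuous continuous_intros continuous_on_subset[OF c\<Psi>] continuous_on_subset[OF c\<Psi>']) auto
  have "integral bump_box (\<lambda>z. ((j \<bullet> b) * \<Psi> z + (z \<bullet> b) * \<Psi>' z j) - ((b \<bullet> j) * \<Psi> z + (z \<bullet> j) * \<Psi>' z b)) = 0"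
    using integral_diff[OF integrable[of j b] integrable[of b j]] int0 by simp
  moreover have "((j \<bullet> b) * \<Psi> z + (z \<bullet> b) * \<Psi>' z j) - ((b \<bullet> j) * \<Psi> z + (z \<bullet> j) * \<Psi>' z b)
      = r * (bump z * ((retr z \<bullet> b) * \<phi>' (r *\<^sub>R retr z) j - (retr z \<bullet> j) * \<phi>' (r *\<^sub>R retr z) b))" for z
  proof -
    have "(z \<bullet> b) * \<Psi>' z j - (z \<bullet> j) * \<Psi>' z b
        = bump z * ((z \<bullet> b) * \<phi>' (r *\<^sub>R retr z) (u z j) - (z \<bullet> j) * \<phi>' (r *\<^sub>R retr z) (u z b))"
      by (simp add: \<Psi>'_def bump'_def algebra_simps)
    also have "(z \<bullet> b) * \<phi>' (r *\<^sub>R retr z) (u z j) - (z \<bullet> j) * \<phi>' (r *\<^sub>R retr z) (u z b)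
       = \<phi>' (r *\<^sub>R retr z) ((z \<bullet> b) *\<^sub>R u z j - (z \<bullet> j) *\<^sub>R u z b)"
      by (simp add: linear_diff[OF lin] linear_scale[OF lin])
    also have "(z \<bullet> b) *\<^sub>R u z j - (z \<bullet> j) *\<^sub>R u z b = r *\<^sub>R ((retr z \<bullet> b) *\<^sub>R j - (retr z \<bullet> j) *\<^sub>R b)"
      by (simp add: u_def retr_def m_def algebra_simps divide_inverse)
    also have "\<phi>' (r *\<^sub>R retr z) \<dots> = r * ((retr z \<bullet> b) * \<phi>' (r *\<^sub>R retr z) j - (retr z \<bullet> j) * \<phi>' (r *\<^sub>R retr z) b)"
      by (simp add: linear_diff[OF lin] linear_scale[OF lin])
    finally show ?thesis by (simp add: inner_commute)
  qed
  ultimately have "r * integral bump_box (\<lambda>z. bump z * ((retr z \<bullet> b) * \<phi>' (r *\<^sub>R retr z) j - (retr z \<bullet> j) * \<phi>' (r *\<^sub>R retr z) b)) = 0"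
    by simp
  then show ?thesis using r by (simp add: mean_def)
qed

lemma convex_body_cball: "convex_body (cball (0::'a::euclidean_space) 1)"
  by (simp add: convex_body_def)

lemma convex_body_unit_interval: "convex_body {0..1::real}"
  by (simp add: convex_body_def)

lemma scale_in_cball: "r \<in> {0..1} \<Longrightarrow> w \<in> cball 0 1 \<Longrightarrow> r *\<^sub>R w \<in> cball (0::'a::euclidean_space) 1"
  by (auto intro!: mult_le_one)

definition smean :: "('a::euclidean_space \<Rightarrow> real) \<Rightarrow> real \<Rightarrow> real" where
  "smean \<phi> r = mean (\<lambda>w. \<phi> (r *\<^sub>R w))"

lemma smean_pullback: "pullback (cball (0::'a::euclidean_space) 1) {0..1::real} (\<lambda>w r. r *\<^sub>R w)"
proof (rule pullback.intro)
  show "bounded_linear (\<lambda>r. r *\<^sub>R w)" for w :: 'a by (rule bounded_linear_scaleR_left)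
qed (auto intro!: convex_body_cball continuous_intros mult_le_one)

lemma smean_eq_pmean: "smean \<phi> = pmean (\<lambda>w. 1) (\<lambda>w r. r *\<^sub>R w) \<phi>"
  by (simp add: smean_def[abs_def] pmean_def[abs_def])

lemma smean_smooth: "smooth_on (cball 0 1) \<phi> \<Longrightarrow> smooth_on {0..1} (smean \<phi>)"
  unfolding smean_eq_pmean by (intro pullback.pmean_smooth[OF smean_pullback] continuous_intros)

lemma cont_ray:
  fixes \<phi> :: "'a::euclidean_space \<Rightarrow> real"
  assumes "continuous_on (cball 0 1) \<phi>" "r \<in> {0..1}"
  shows "continuous_on (cball 0 1) (\<lambda>w. \<phi> (r *\<^sub>R w))"
proof (rule continuous_on_compose2[OF assms(1)])
  show "continuous_on (cball 0 1) (\<lambda>w::'a. r *\<^sub>R w)"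
    by (rule continuous_on_scaleR[OF continuous_on_const continuous_on_id])
qed (use scale_in_cball[OF assms(2)] in blast)

lemma dd_smean:
  assumes "smooth_on (cball 0 1) \<phi>" "r \<in> {0..1}"
  shows "dd {0..1} 1 (smean \<phi>) r = mean (\<lambda>w. dd (cball 0 1) w \<phi> (r *\<^sub>R w))"
  unfolding smean_eq_pmean
  by (subst pullback.dd_pmean[OF smean_pullback convex_body_unit_interval continuous_on_const assms]) simp

text \<open>
The Euler operator \<open>x \<bullet> \<nabla>\<close>. On spherical means it acts as \<open>r d/dr\<close>, see \<open>smean_euler\<close>, so it expresses
radial derivatives of averages as averages of functions that are smooth also at the origin.
\<close>
definition euler :: "('a::euclidean_space \<Rightarrow> real) \<Rightarrow> 'a \<Rightarrow> real" where
  "euler \<phi> x = (\<Sum>b\<in>Basis. (x \<bullet> b) * dd (cball 0 1) b \<phi> x)"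

lemma smooth_on_inner: "smooth_on X (\<lambda>x. x \<bullet> b)"
  by (intro smooth_on_linear bounded_linear_inner_left)

lemma smooth_on_inner_self: "smooth_on X (\<lambda>x. x \<bullet> (x::'a::euclidean_space))"
proof -
  have "smooth_on X (\<lambda>x::'a. \<Sum>b\<in>Basis. (x \<bullet> b) * (x \<bullet> b))"
    by (intro smooth_on_sum smooth_on_mult smooth_on_inner)
  then show ?thesis by (simp add: euclidean_inner[symmetric])
qed

lemma euler_smooth: "smooth_on (cball 0 1) \<phi> \<Longrightarrow> smooth_on (cball 0 1) (euler \<phi>)"
  unfolding euler_def by (intro smooth_on_sum smooth_on_mult smooth_on_inner smooth_on_dd convex_body_cball)

lemma euler_eq: "smooth_on (cball 0 1) \<phi> \<Longrightarrow> x \<in> cball 0 1 \<Longrightarrow> euler \<phi> x = dd (cball 0 1) x \<phi> x"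
  unfolding euler_def using dd_direction_sum[OF convex_body_cball, of \<phi> x x] by simp

lemma euler_ray:
  assumes "smooth_on (cball 0 1) \<phi>" "r \<in> {0..1}" "w \<in> cball 0 1"
  shows "euler \<phi> (r *\<^sub>R w) = r * dd (cball 0 1) w \<phi> (r *\<^sub>R w)"
  using euler_eq[OF assms(1) scale_in_cball[OF assms(2,3)]]
    linear_scale[OF bounded_linear.linear[OF dd_bounded_linear[OF convex_body_cball assms(1) scale_in_cball[OF assms(2,3)]]]]
  by simp

lemma smean_euler:
  assumes "smooth_on (cball 0 1) \<phi>" "r \<in> {0..1}"
  shows "smean (euler \<phi>) r = r * dd {0..1} 1 (smean \<phi>) r"
  unfolding dd_smean[OF assms] mean_cmult[symmetric] smean_def
  by (rule mean_cong_sphere) (use euler_ray[OF assms] in auto)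

lemma dd_inner: "convex_body X \<Longrightarrow> x \<in> X \<Longrightarrow> dd X v (\<lambda>x. x \<bullet> b) x = v \<bullet> b"
  by (rule dd_linear) (auto intro: bounded_linear_inner_left)

lemma dd_inner_mult:
  assumes "convex_body X" "x \<in> X" "smooth_on X \<phi>"
  shows "dd X v (\<lambda>x. (x \<bullet> b) * \<phi> x) x = (v \<bullet> b) * \<phi> x + (x \<bullet> b) * dd X v \<phi> x"
  using dd_mult[OF assms(1,2) smooth_on_inner assms(3)] dd_inner[OF assms(1,2)] by simp

text \<open>
The divergence theorem on the sphere of radius \<open>r\<close>, where \<open>n - 1\<close> is the mean curvature term. It is
\<open>mean_rotation\<close> applied to the functions \<open>x \<mapsto> (x \<bullet> j) \<phi> x\<close>, summed over \<open>j\<close>.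
\<close>
lemma mean_divergence:
  fixes \<phi> :: "'a::euclidean_space \<Rightarrow> real"
  assumes s: "smooth_on (cball 0 1) \<phi>" and r: "0 < r" "r < 1"
  shows "r * mean (\<lambda>w. dd (cball 0 1) b \<phi> (r *\<^sub>R w)) =
    r * mean (\<lambda>w. (w \<bullet> b) * dd (cball 0 1) w \<phi> (r *\<^sub>R w))
     + (real DIM('a) - 1) * mean (\<lambda>w. (w \<bullet> b) * \<phi> (r *\<^sub>R w))"
proof -
  let ?K = "cball (0::'a) 1"
  note fK = convex_body_cball[where 'a='a]
  have rr: "r \<in> {0..1}" using r by simp
  define f where "f = (\<lambda>j x. (x \<bullet> j) * \<phi> x)"
  have sf: "smooth_on ?K (f j)" for j unfolding f_def by (intro smooth_on_mult smooth_on_inner s)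
  have cray: "continuous_on ?K (\<lambda>w. g (r *\<^sub>R w))" if "smooth_on ?K g" for g
    by (rule cont_ray[OF smooth_on_continuous[OF that] rr])
  \<comment> \<open>Summing these identities over \<open>j\<close> turns the first products into the radial derivative and the second ones into the derivative along \<open>b\<close>; the terms without derivatives give the factor \<open>n - 1\<close>.\<close>
  have rot: "mean (\<lambda>w. (w \<bullet> b) * dd ?K j (f j) (r *\<^sub>R w) - (w \<bullet> j) * dd ?K b (f j) (r *\<^sub>R w)) = 0" for j
  proof (rule mean_rotation[where \<phi>'="\<lambda>x v. dd ?K v (f j) x", OF _ _ r])
    fix x :: 'a assume "x \<in> ball 0 1"
    then have "x \<in> interior ?K" "x \<in> ?K" by auto
    then show "(f j has_derivative (\<lambda>v. dd ?K v (f j) x)) (at x)"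
      using smooth_on_has_derivative[OF fK sf, of x] at_within_interior by metis
  next
    fix v show "continuous_on (ball 0 1) (dd ?K v (f j))"
      using smooth_on_continuous[OF smooth_on_dd[OF fK sf]] by (rule continuous_on_subset) auto
  qed
  have cdd: "continuous_on ?K (\<lambda>w. dd ?K v g (r *\<^sub>R w))" if "smooth_on ?K g" for v g
    by (rule cray[OF smooth_on_dd[OF fK that]])
  have cw: "continuous_on ?K (\<lambda>w. dd ?K w \<phi> (r *\<^sub>R w))"
  proof -
    have 1: "continuous_on ?K (\<lambda>w. \<Sum>d\<in>Basis. (w \<bullet> d) * dd ?K d \<phi> (r *\<^sub>R w))"
      by (intro continuous_intros cdd s)
    have 2: "dd ?K w \<phi> (r *\<^sub>R w) = (\<Sum>d\<in>Basis. (w \<bullet> d) * dd ?K d \<phi> (r *\<^sub>R w))" if "w \<in> ?K" for w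
      using dd_direction_sum[OF fK s scale_in_cball[OF rr that]] .
    show ?thesis by (rule continuous_on_eq[OF 1 2[symmetric]])
  qed
  have "0 = (\<Sum>j\<in>Basis. mean (\<lambda>w. (w \<bullet> b) * dd ?K j (f j) (r *\<^sub>R w) - (w \<bullet> j) * dd ?K b (f j) (r *\<^sub>R w)))"
    using rot by simp
  also have "\<dots> = mean (\<lambda>w. \<Sum>j\<in>Basis. (w \<bullet> b) * dd ?K j (f j) (r *\<^sub>R w) - (w \<bullet> j) * dd ?K b (f j) (r *\<^sub>R w))"
    by (rule mean_sum[symmetric]) (intro continuous_intros cdd sf)
  also have "\<dots> = mean (\<lambda>w. ((real DIM('a) - 1) * ((w \<bullet> b) * \<phi> (r *\<^sub>R w)) + r * ((w \<bullet> b) * dd ?K w \<phi> (r *\<^sub>R w)))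
      - r * dd ?K b \<phi> (r *\<^sub>R w))"
  proof (rule mean_cong_sphere)
    fix w :: 'a assume "w \<in> sphere 0 1"
    then have w: "w \<in> ?K" "w \<bullet> w = 1" by (auto simp: norm_eq_1[symmetric])
    have x: "r *\<^sub>R w \<in> ?K" using scale_in_cball[OF rr w(1)] .
    have 1: "dd ?K j (f j) (r *\<^sub>R w) = \<phi> (r *\<^sub>R w) + r * ((w \<bullet> j) * dd ?K j \<phi> (r *\<^sub>R w))" if "j \<in> Basis" for j
      unfolding f_def dd_inner_mult[OF fK x s] using that by simp
    have 2: "dd ?K b (f j) (r *\<^sub>R w) = (b \<bullet> j) * \<phi> (r *\<^sub>R w) + r * ((w \<bullet> j) * dd ?K b \<phi> (r *\<^sub>R w))" for j
      unfolding f_def dd_inner_mult[OF fK x s] by simp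
    have "(\<Sum>j\<in>Basis. (w \<bullet> b) * dd ?K j (f j) (r *\<^sub>R w) - (w \<bullet> j) * dd ?K b (f j) (r *\<^sub>R w))
      = (\<Sum>j\<in>Basis. ((w \<bullet> b) * \<phi> (r *\<^sub>R w) + r * (w \<bullet> b) * ((w \<bullet> j) * dd ?K j \<phi> (r *\<^sub>R w)))
          - (\<phi> (r *\<^sub>R w) * ((w \<bullet> j) * (b \<bullet> j)) + r * dd ?K b \<phi> (r *\<^sub>R w) * ((w \<bullet> j) * (w \<bullet> j))))"
      by (rule sum.cong) (auto simp: 1 2 algebra_simps)
    also have "\<dots> = (real DIM('a) * ((w \<bullet> b) * \<phi> (r *\<^sub>R w)) + r * (w \<bullet> b) * dd ?K w \<phi> (r *\<^sub>R w))
         - (\<phi> (r *\<^sub>R w) * (w \<bullet> b) + r * dd ?K b \<phi> (r *\<^sub>R w))"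
      unfolding sum_subtractf sum.distrib sum_distrib_left[symmetric] dd_direction_sum[OF fK s x, of w, symmetric]
      using w(2) by (simp add: euclidean_inner[symmetric])
    finally show "(\<Sum>j\<in>Basis. (w \<bullet> b) * dd ?K j (f j) (r *\<^sub>R w) - (w \<bullet> j) * dd ?K b (f j) (r *\<^sub>R w)) =
      ((real DIM('a) - 1) * ((w \<bullet> b) * \<phi> (r *\<^sub>R w)) + r * ((w \<bullet> b) * dd ?K w \<phi> (r *\<^sub>R w))) - r * dd ?K b \<phi> (r *\<^sub>R w)"
      by (simp add: algebra_simps)
  qed
  also have "\<dots> = ((real DIM('a) - 1) * mean (\<lambda>w. (w \<bullet> b) * \<phi> (r *\<^sub>R w)) + r * mean (\<lambda>w. (w \<bullet> b) * dd ?K w \<phi> (r *\<^sub>R w)))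
      - r * mean (\<lambda>w. dd ?K b \<phi> (r *\<^sub>R w))"
  proof -
    have c1: "continuous_on ?K (\<lambda>w. (real DIM('a) - 1) * ((w \<bullet> b) * \<phi> (r *\<^sub>R w)))"
      by (intro continuous_on_mult_left continuous_on_mult[OF _ cray[OF s]] continuous_intros)
    have c2: "continuous_on ?K (\<lambda>w. r * ((w \<bullet> b) * dd ?K w \<phi> (r *\<^sub>R w)))"
      by (intro continuous_on_mult_left continuous_on_mult[OF _ cw] continuous_intros)
    have c3: "continuous_on ?K (\<lambda>w. r * dd ?K b \<phi> (r *\<^sub>R w))"
      by (intro continuous_on_mult_left cdd s)
    show ?thesis
      unfolding mean_diff[OF continuous_on_add[OF c1 c2] c3] mean_add[OF c1 c2] mean_cmult ..
  qed
  finally show ?thesis by simp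
qed

text \<open>
The divergence theorem cleared of denominators and written with the Euler operator. In this
form it holds for all radii in \<open>[0,1]\<close>, by continuity.
\<close>
lemma smean_divergence:
  fixes \<phi> :: "'a::euclidean_space \<Rightarrow> real"
  assumes s: "smooth_on (cball 0 1) \<phi>" and r: "r \<in> {0..1}"
  shows "smean (\<lambda>x. (x \<bullet> x) * dd (cball 0 1) b \<phi> x) r =
    smean (\<lambda>x. euler (\<lambda>x. (x \<bullet> b) * \<phi> x) x + (real DIM('a) - 2) * ((x \<bullet> b) * \<phi> x)) r"
proof (rule eq_of_eq_on_interior[OF convex_body_unit_interval _ _ _ r])
  let ?K = "cball (0::'a) 1"
  note fK = convex_body_cball[where 'a='a]
  have sb: "smooth_on ?K (\<lambda>x. (x \<bullet> b) * \<phi> x)" by (intro smooth_on_mult smooth_on_inner s)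
  show "continuous_on {0..1} (smean (\<lambda>x. (x \<bullet> x) * dd ?K b \<phi> x))"
    by (intro smooth_on_continuous smean_smooth smooth_on_mult smooth_on_inner_self smooth_on_dd fK s)
  show "continuous_on {0..1} (smean (\<lambda>x. euler (\<lambda>x. (x \<bullet> b) * \<phi> x) x + (real DIM('a) - 2) * ((x \<bullet> b) * \<phi> x)))"
    by (intro smooth_on_continuous smean_smooth smooth_on_add smooth_on_cmult euler_smooth sb)
  fix r :: real assume "r \<in> interior {0..1}"
  then have r: "0 < r" "r < 1" and rr: "r \<in> {0..1}" by auto
  have cdd: "continuous_on ?K (\<lambda>w. dd ?K v \<phi> (r *\<^sub>R w))" for v
    by (rule cont_ray[OF smooth_on_continuous[OF smooth_on_dd[OF fK s]] rr])
  have c: "continuous_on ?K (\<lambda>w. \<phi> (r *\<^sub>R w))"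
    by (rule cont_ray[OF smooth_on_continuous[OF s] rr])
  have cw: "continuous_on ?K (\<lambda>w. (w \<bullet> b) * (\<Sum>d\<in>Basis. (w \<bullet> d) * dd ?K d \<phi> (r *\<^sub>R w)))"
    by (intro continuous_intros cdd)
  have "smean (\<lambda>x. (x \<bullet> x) * dd ?K b \<phi> x) r = mean (\<lambda>w. r\<^sup>2 * dd ?K b \<phi> (r *\<^sub>R w))"
    unfolding smean_def by (rule mean_cong_sphere) (auto simp: norm_eq_1 power2_eq_square)
  also have "\<dots> = r * (r * mean (\<lambda>w. dd ?K b \<phi> (r *\<^sub>R w)))"
    unfolding mean_cmult by (simp add: power2_eq_square)
  also have "\<dots> = r * (r * mean (\<lambda>w. (w \<bullet> b) * dd ?K w \<phi> (r *\<^sub>R w))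
     + (real DIM('a) - 1) * mean (\<lambda>w. (w \<bullet> b) * \<phi> (r *\<^sub>R w)))"
    by (subst mean_divergence[OF s r]) simp
  also have "mean (\<lambda>w. (w \<bullet> b) * dd ?K w \<phi> (r *\<^sub>R w)) = mean (\<lambda>w. (w \<bullet> b) * (\<Sum>d\<in>Basis. (w \<bullet> d) * dd ?K d \<phi> (r *\<^sub>R w)))"
    by (rule mean_cong_sphere) (use dd_direction_sum[OF fK s scale_in_cball[OF rr]] in auto)
  also have "r * (r * mean (\<lambda>w. (w \<bullet> b) * (\<Sum>d\<in>Basis. (w \<bullet> d) * dd ?K d \<phi> (r *\<^sub>R w)))
     + (real DIM('a) - 1) * mean (\<lambda>w. (w \<bullet> b) * \<phi> (r *\<^sub>R w)))
    = r\<^sup>2 * mean (\<lambda>w. (w \<bullet> b) * (\<Sum>d\<in>Basis. (w \<bullet> d) * dd ?K d \<phi> (r *\<^sub>R w)))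
     + (r * (real DIM('a) - 1)) * mean (\<lambda>w. (w \<bullet> b) * \<phi> (r *\<^sub>R w))"
    by (simp add: power2_eq_square algebra_simps)
  also have "\<dots> = mean (\<lambda>w. r\<^sup>2 * ((w \<bullet> b) * (\<Sum>d\<in>Basis. (w \<bullet> d) * dd ?K d \<phi> (r *\<^sub>R w)))
     + (r * (real DIM('a) - 1)) * ((w \<bullet> b) * \<phi> (r *\<^sub>R w)))"
    unfolding mean_cmult[symmetric]
    by (rule mean_add[symmetric]; intro continuous_on_mult_left cw continuous_intros c)
  also have "\<dots> = smean (\<lambda>x. euler (\<lambda>x. (x \<bullet> b) * \<phi> x) x + (real DIM('a) - 2) * ((x \<bullet> b) * \<phi> x)) r"
    unfolding smean_def
  proof (rule mean_cong_sphere)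
    fix w :: 'a assume "w \<in> sphere 0 1"
    then have w: "w \<in> ?K" by auto
    have x: "r *\<^sub>R w \<in> ?K" using scale_in_cball[OF rr w] .
    have "euler (\<lambda>x. (x \<bullet> b) * \<phi> x) (r *\<^sub>R w) = r * ((w \<bullet> b) * \<phi> (r *\<^sub>R w)) + r\<^sup>2 * ((w \<bullet> b) * dd ?K w \<phi> (r *\<^sub>R w))"
      unfolding euler_ray[OF sb rr w] dd_inner_mult[OF fK x s] by (simp add: power2_eq_square algebra_simps)
    then show "r\<^sup>2 * ((w \<bullet> b) * (\<Sum>d\<in>Basis. (w \<bullet> d) * dd ?K d \<phi> (r *\<^sub>R w))) + (r * (real DIM('a) - 1)) * ((w \<bullet> b) * \<phi> (r *\<^sub>R w))
      = euler (\<lambda>x. (x \<bullet> b) * \<phi> x) (r *\<^sub>R w) + (real DIM('a) - 2) * (((r *\<^sub>R w) \<bullet> b) * \<phi> (r *\<^sub>R w))"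
      unfolding dd_direction_sum[OF fK s x, of w] by (simp add: algebra_simps)
  qed
  finally show "smean (\<lambda>x. (x \<bullet> x) * dd ?K b \<phi> x) r =
     smean (\<lambda>x. euler (\<lambda>x. (x \<bullet> b) * \<phi> x) x + (real DIM('a) - 2) * ((x \<bullet> b) * \<phi> x)) r" .
qed

section \<open>The Darboux equation in two radial variables\<close>

lemma rect_chain:
  fixes f :: "real \<times> real \<Rightarrow> real"
  assumes Z: "convex_body Z" and f: "smooth_on Z f"
    and g: "(g has_real_derivative g') (at s within S)" and h: "(h has_real_derivative h') (at s within S)"
    and maps: "\<And>s. s \<in> S \<Longrightarrow> (g s, h s) \<in> Z" and s: "s \<in> S"
  shows "((\<lambda>s. f (g s, h s)) has_real_derivative
     g' * dd Z (1, 0) f (g s, h s) + h' * dd Z (0, 1) f (g s, h s)) (at s within S)"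
proof -
  have z: "(g s, h s) \<in> Z" using maps s by blast
  have "((\<lambda>s. f (g s, h s)) has_derivative (\<lambda>v. dd Z (g' * v, h' * v) f (g s, h s))) (at s within S)"
  proof (rule has_derivative_in_compose2[where t=Z and f="\<lambda>s. (g s, h s)" and g=f and g'="\<lambda>x v. dd Z v f x"])
    show "\<And>x. x \<in> Z \<Longrightarrow> (f has_derivative (\<lambda>v. dd Z v f x)) (at x within Z)"
      using smooth_on_has_derivative[OF Z f] by blast
    show "((\<lambda>s. (g s, h s)) has_derivative (\<lambda>v. (g' * v, h' * v))) (at s within S)"
      using g h unfolding has_field_derivative_def by (rule has_derivative_Pair)
  qed (use maps s in auto)
  moreover have "dd Z (g' * v, h' * v) f (g s, h s) = (g' * dd Z (1, 0) f (g s, h s) + h' * dd Z (0, 1) f (g s, h s)) * v" for v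
  proof -
    interpret bounded_linear "\<lambda>v. dd Z v f (g s, h s)" using dd_bounded_linear[OF Z f z] .
    have "(g' * v, h' * v) = (g' * v) *\<^sub>R (1, 0) + (h' * v) *\<^sub>R (0, 1 :: real)" by simp
    then have "dd Z (g' * v, h' * v) f (g s, h s) = (g' * v) * dd Z (1, 0) f (g s, h s) + (h' * v) * dd Z (0, 1) f (g s, h s)"
      by (simp only: add scaleR real_scaleR_def)
    then show ?thesis by (simp add: algebra_simps)
  qed
  ultimately show ?thesis by (simp add: has_field_derivative_def)
qed

text \<open>
The common frame of the three energy estimates: \<open>q\<close> is an energy density with evolution variable \<open>s\<close>,
and its rate of change is bounded by the derivative of a flux \<open>F\<close> whose boundary terms have the right
sign. So the total energy is nonincreasing, and it vanishes initially.
\<close>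
lemma energy_zero:
  fixes q qs :: "real \<Rightarrow> real \<Rightarrow> real"
  assumes cq: "continuous_on ({a..b} \<times> {0..T}) (\<lambda>p. q (fst p) (snd p))"
    and cqs: "continuous_on ({a..b} \<times> {0..T}) (\<lambda>p. qs (fst p) (snd p))"
    and der: "\<And>s x. s \<in> {a..b} \<Longrightarrow> x \<in> {0..T} \<Longrightarrow> ((\<lambda>s. q s x) has_real_derivative qs s x) (at s within {a..b})"
    and flux: "\<And>s. a < s \<Longrightarrow> s < b \<Longrightarrow> \<exists>F. continuous_on {0..T} F \<and> F T \<le> F 0 \<and>
        (\<forall>x\<in>{0<..<T}. \<exists>d. (F has_real_derivative d) (at x) \<and> qs s x \<le> d)"
    and nonneg: "\<And>s x. s \<in> {a..b} \<Longrightarrow> x \<in> {0..T} \<Longrightarrow> q s x \<ge> 0"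
    and start: "\<And>x. x \<in> {0..T} \<Longrightarrow> q a x = 0" and T: "T > 0" and s: "s \<in> {a..b}" and x: "x \<in> {0..T}"
  shows "q s x = 0"
proof -
  define E where "E = (\<lambda>s. integral (cbox 0 T) (q s))"
  have cqx: "continuous_on {0..T} (q s)" if "s \<in> {a..b}" for s
  proof -
    have "continuous_on {0..T} (\<lambda>x. (s, x))" by (intro continuous_intros)
    then show ?thesis using continuous_on_compose2[OF cq, of "{0..T}" "\<lambda>x. (s, x)"] that
      by (auto simp: image_subset_iff)
  qed
  have cqsx: "continuous_on {0..T} (qs s)" if "s \<in> {a..b}" for s
  proof -
    have "continuous_on {0..T} (\<lambda>x. (s, x))" by (intro continuous_intros)
    then show ?thesis using continuous_on_compose2[OF cqs, of "{0..T}" "\<lambda>x. (s, x)"] that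
      by (auto simp: image_subset_iff)
  qed
  have E': "(E has_real_derivative integral (cbox 0 T) (qs s)) (at s within {a..b})" if "s \<in> {a..b}" for s
    unfolding E_def
  proof (rule leibniz_rule_field_derivative)
    show "continuous_on ({a..b} \<times> cbox 0 T) (\<lambda>(x, t). qs x t)" using cqs by (simp add: split_beta)
    show "q s integrable_on cbox 0 T" if "s \<in> {a..b}" for s
      using cqx[OF that] by (simp add: integrable_continuous_real)
  qed (use der that in auto)
  have le: "integral (cbox 0 T) (qs s) \<le> 0" if su: "a < s" "s < b" for s
  proof -
    obtain F where F: "continuous_on {0..T} F" "F T \<le> F 0"
      "\<forall>x\<in>{0<..<T}. \<exists>d. (F has_real_derivative d) (at x) \<and> qs s x \<le> d"
      using flux[OF su] by blast
    obtain d where d: "\<And>x. x \<in> {0<..<T} \<Longrightarrow> (F has_real_derivative d x) (at x) \<and> qs s x \<le> d x"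
      using bchoice[OF F(3)] by blast
    have "(d has_integral F T - F 0) {0..T}"
    proof (rule fundamental_theorem_of_calculus_interior)
      show "(F has_vector_derivative d x) (at x)" if "x \<in> {0<..<T}" for x
        using d[OF that] by (simp add: has_real_derivative_iff_has_vector_derivative)
    qed (use T F(1) in auto)
    then have 1: "(d has_integral F T - F 0) {0<..<T}" by (simp only: has_integral_Icc_iff_Ioo)
    have "(qs s has_integral integral {0..T} (qs s)) {0..T}"
      using cqsx[of s] su by (intro integrable_integral integrable_continuous_real) auto
    then have 2: "(qs s has_integral integral {0..T} (qs s)) {0<..<T}" by (simp only: has_integral_Icc_iff_Ioo)
    have "integral {0..T} (qs s) \<le> F T - F 0"
      by (rule has_integral_le[OF 2 1]) (use d in blast)
    then show ?thesis using F(2) by simp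
  qed
  have "E s \<le> E a"
  proof (rule DERIV_nonpos_imp_decreasing_open[of a s E])
    show "a \<le> s" using s by simp
    show "continuous_on {a..s} E"
      using continuous_on_subset[OF DERIV_continuous_on[OF E'], of "{a..s}"] s by auto
    fix u assume u: "a < u" "u < s"
    have "at u within {a..b} = at u" using u s by (intro at_within_interior) auto
    then have "(E has_real_derivative integral (cbox 0 T) (qs u)) (at u)"
      using E'[of u] u s by simp
    then show "\<exists>y. (E has_real_derivative y) (at u) \<and> y \<le> 0"
      using le[of u] u s by auto
  qed
  also have "E a = 0"
  proof -
    have "integral {0..T} (q a) = integral {0..T} (\<lambda>x. 0)" by (rule integral_cong) (rule start)
    then show ?thesis by (simp add: E_def)
  qed
  finally have "E s \<le> 0" .
  moreover have "E s \<ge> 0" unfolding E_def using nonneg[OF s] cqx[OF s]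
    by (intro integral_nonneg) (auto intro: integrable_continuous_real)
  ultimately have "integral {0..T} (q s) = 0" by (simp add: E_def)
  then show ?thesis using integral_eq_0_iff[OF cqx[OF s] T nonneg[OF s]] x by blast
qed

text \<open>
The equation for spherical means about the origin, multiplied by \<open>r t\<close>. Here \<open>m\<close> is \<open>n - 1\<close>.
Without denominators, the equation makes sense also for \<open>r = 0\<close> and \<open>t = 0\<close>.
\<close>
definition radial_darboux :: "nat \<Rightarrow> (real \<times> real) set \<Rightarrow> (real \<times> real \<Rightarrow> real) \<Rightarrow> bool" where
  "radial_darboux m Z U \<longleftrightarrow> smooth_on Z U \<and> (\<forall>(r, t)\<in>Z.
     r * t * (dd Z (1,0) (dd Z (1,0) U) (r,t) - dd Z (0,1) (dd Z (0,1) U) (r,t))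
     + real m * (t * dd Z (1,0) U (r,t) - r * dd Z (0,1) U (r,t)) = 0)"

definition strip :: "(real \<times> real) set" where "strip = {0..1} \<times> {0..}"

lemma convex_body_Times: "convex_body A \<Longrightarrow> convex_body B \<Longrightarrow> convex_body (A \<times> B)"
  by (auto simp: convex_body_def convex_Times interior_Times)

lemma convex_body_nonneg: "convex_body {0::real..}"
  by (simp add: convex_body_def)

lemma convex_body_strip: "convex_body strip"
  unfolding strip_def by (intro convex_body_Times convex_body_unit_interval convex_body_nonneg)

lemma convex_body_square: "convex_body ({0..1::real} \<times> {0..1::real})"
  by (intro convex_body_Times convex_body_unit_interval)

lemma radial_darboux_solved:
  assumes "radial_darboux m Z U" "(r, t) \<in> Z" "r > 0" "t > 0"
  shows "dd Z (0,1) (dd Z (0,1) U) (r,t) = dd Z (1,0) (dd Z (1,0) U) (r,t)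
    + real m / r * dd Z (1,0) U (r,t) - real m / t * dd Z (0,1) U (r,t)"
proof -
  let ?rr = "dd Z (1,0) (dd Z (1,0) U) (r,t)" and ?tt = "dd Z (0,1) (dd Z (0,1) U) (r,t)"
  let ?r = "dd Z (1,0) U (r,t)" and ?t = "dd Z (0,1) U (r,t)"
  have "r * t * (?rr - ?tt) + real m * (t * ?r - r * ?t) = 0"
    using assms(1,2) unfolding radial_darboux_def by blast
  then have "r * t * (?rr + real m / r * ?r - real m / t * ?t - ?tt) = 0"
    using assms(3,4) by (simp add: field_simps)
  then show ?thesis using assms(3,4) by simp
qed

lemma const_of_deriv_0:
  assumes "a \<le> b" "continuous_on {a..b} f" "\<And>x. a < x \<Longrightarrow> x < b \<Longrightarrow> (f has_real_derivative 0) (at x)"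
  shows "f a = (f b :: real)"
  using DERIV_isconst2[of a b f b] assms by (cases "a = b") auto

text \<open>
Uniqueness for data on the axis \<open>r = 0\<close>, by an energy estimate with \<open>r\<close> as the evolution variable; this
is possible since the equation is symmetric in \<open>r\<close> and \<open>t\<close>. The first-order term in \<open>r\<close> acts as damping.
\<close>
lemma radial_darboux_lateral_uniqueness:
  assumes U: "radial_darboux (Suc m) strip U"
    and axis: "\<And>t. t \<ge> 0 \<Longrightarrow> U (0, t) = 0"
    and late: "\<And>r t. r \<in> {0..1} \<Longrightarrow> t \<ge> 2 \<Longrightarrow> U (r, t) = 0"
    and rt: "r \<in> {0..1}" "t \<ge> 0"
  shows "U (r, t) = 0"
proof -
  have sU: "smooth_on strip U" using U by (simp add: radial_darboux_def)
  define Ur where "Ur = dd strip (1,0) U"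
  define Ut where "Ut = dd strip (0,1) U"
  define Urr where "Urr = dd strip (1,0) Ur"
  define Utt where "Utt = dd strip (0,1) Ut"
  define Urt where "Urt = dd strip (0,1) Ur"
  note fs = convex_body_strip
  have s1: "smooth_on strip Ur" "smooth_on strip Ut" unfolding Ur_def Ut_def by (intro smooth_on_dd fs sU)+
  have s2: "smooth_on strip Urr" "smooth_on strip Urt" unfolding Urr_def Urt_def by (intro smooth_on_dd fs s1)+
  note cont = sU[THEN smooth_on_continuous] s1[THEN smooth_on_continuous] s2[THEN smooth_on_continuous]
  have Utr: "dd strip (1,0) Ut p = Urt p" if "p \<in> strip" for p
    unfolding Ut_def Urt_def Ur_def by (rule dd_commute[OF fs sU that])
  have in_strip: "(r, t) \<in> strip \<longleftrightarrow> r \<in> {0..1} \<and> t \<ge> 0" for r t by (auto simp: strip_def)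
  have dr: "((\<lambda>r. f (r, t)) has_real_derivative dd strip (1,0) f (r,t)) (at r within {0..1})"
    if "smooth_on strip f" "r \<in> {0..1}" "t \<ge> 0" for f r t
    using rect_chain[OF fs that(1) DERIV_ident DERIV_const[where k=t], where s=r and S="{0..1}"] that by (simp add: in_strip)
  have dt: "((\<lambda>t. f (r, t)) has_real_derivative dd strip (0,1) f (r,t)) (at t within {0..})"
    if "smooth_on strip f" "r \<in> {0..1}" "t \<ge> 0" for f r t
    using rect_chain[OF fs that(1) DERIV_const[where k=r] DERIV_ident, where s=t and S="{0..}"] that by (simp add: in_strip)
  have dt': "((\<lambda>t. f (r, t)) has_real_derivative dd strip (0,1) f (r,t)) (at t)"
    if "smooth_on strip f" "r \<in> {0..1}" "t > 0" for f r t
    using dt[of f r t] that at_within_interior[of t "{0..}"] by simp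
  have cline: "continuous_on {0..c} (\<lambda>t. f (r, t))" if "continuous_on strip f" "r \<in> {0..1}" for f :: "real \<times> real \<Rightarrow> real" and r c
  proof (rule continuous_on_compose2[OF that(1)])
    show "continuous_on {0..c} (\<lambda>t. (r, t))" by (intro continuous_intros)
  qed (use that in_strip in auto)
  have cstrip: "continuous_on ({0..1} \<times> {0..2}) (\<lambda>p. f (fst p, snd p))" if "continuous_on strip f" for f :: "real \<times> real \<Rightarrow> real"
  proof -
    have "{0..1} \<times> {0..2} \<subseteq> strip" by (auto simp: strip_def)
    then show ?thesis using continuous_on_subset[OF that] by simp
  qed
  have axis0: "Ut (0, t) = 0" if "t \<ge> 0" for t
  proof -
    have "((\<lambda>t. U (0, t)) has_real_derivative Ut (0,t)) (at t within {0..})"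
      using dt[OF sU, of 0 t] that by (simp add: Ut_def)
    then have "((\<lambda>t. 0) has_real_derivative Ut (0,t)) (at t within {0..})"
      by (rule has_field_derivative_transform_within[where d=1]) (use axis that in auto)
    then have "((\<lambda>t. 0) has_derivative (\<lambda>x. Ut (0,t) * x)) (at t within {0..})" by (simp add: has_field_derivative_def)
    from convex_body_deriv_unique[OF convex_body_nonneg _ this has_derivative_const] show ?thesis using that by (metis atLeast_iff mult.right_neutral)
  qed
  have axis1: "Ur (0, t) = 0" if "t > 0" for t
  proof -
    have "(0, t) \<in> strip" using that in_strip by auto
    then have "real (Suc m) * (t * Ur (0,t)) = 0"
      using U unfolding radial_darboux_def Ur_def by fastforce
    then show ?thesis using that by simp
  qed
  have late0: "Ur (r, 2) = 0" if "0 < r" "r < 1" for r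
  proof -
    have "((\<lambda>r. U (r, 2)) has_real_derivative Ur (r,2)) (at r)"
      using dr[OF sU, of r 2] that at_within_interior[of r "{0..1}"] by (simp add: Ur_def)
    moreover have "((\<lambda>r. U (r, 2)) has_real_derivative 0) (at r)"
      by (rule has_field_derivative_transform_within_open[of "\<lambda>r. 0" _ _ "{0<..<1}"]) (use late that in auto)
    ultimately show ?thesis by (rule DERIV_unique)
  qed
  \<comment> \<open>The energy density in \<open>t\<close>; the flux is \<open>2 t^(m+1) U_r U_t\<close>, which vanishes at \<open>t = 0\<close> and at \<open>t = 2\<close>.\<close>
  define q where "q = (\<lambda>r t. ((Ur (r,t))\<^sup>2 + (Ut (r,t))\<^sup>2) * t ^ Suc m)"
  define qs where "qs = (\<lambda>r t. (2 * Ur (r,t) * Urr (r,t) + 2 * Ut (r,t) * Urt (r,t)) * t ^ Suc m)"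
  have q0: "q r t = 0" if "r \<in> {0..1}" "t \<in> {0..2}" for r t
  proof (rule energy_zero[of 0 1 2 q qs])
    show "continuous_on ({0..1} \<times> {0..2}) (\<lambda>p. q (fst p) (snd p))"
      unfolding q_def by (intro continuous_intros cstrip cont)
    show "continuous_on ({0..1} \<times> {0..2}) (\<lambda>p. qs (fst p) (snd p))"
      unfolding qs_def by (intro continuous_intros cstrip cont)
    fix r t :: real assume r: "r \<in> {0..1}" and t: "t \<in> {0..2}"
    have 1: "((\<lambda>r. Ur (r,t)) has_real_derivative Urr (r,t)) (at r within {0..1})"
      using dr[OF s1(1) r, of t] t by (simp add: Urr_def)
    have 2: "((\<lambda>r. Ut (r,t)) has_real_derivative Urt (r,t)) (at r within {0..1})"
      using dr[OF s1(2) r, of t] t Utr[of "(r,t)"] r by (simp add: in_strip)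
    show "((\<lambda>r. q r t) has_real_derivative qs r t) (at r within {0..1})"
      unfolding q_def qs_def by (rule derivative_eq_intros 1 2 refl | simp)+
    show "0 \<le> q r t" using t by (simp add: q_def)
  next
    fix t :: real assume "t \<in> {0..2}"
    then show "q 0 t = 0" using axis0[of t] axis1[of t] by (cases "t = 0") (auto simp: q_def)
  next
    fix r :: real assume r: "0 < r" "r < 1"
    define F where "F = (\<lambda>t. 2 * t ^ Suc m * Ur (r,t) * Ut (r,t))"
    show "\<exists>F. continuous_on {0..2} F \<and> F 2 \<le> F 0 \<and>
      (\<forall>t\<in>{0<..<2}. \<exists>d. (F has_real_derivative d) (at t) \<and> qs r t \<le> d)"
    proof (intro exI[of _ F] conjI ballI)
      show "continuous_on {0..2} F" unfolding F_def by (intro continuous_intros cline cont) (use r in auto)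
      show "F 2 \<le> F 0" using late0[OF r] by (simp add: F_def)
      fix t :: real assume t: "t \<in> {0<..<2}"
      have 1: "((\<lambda>t. Ur (r,t)) has_real_derivative Urt (r,t)) (at t)"
        using dt'[OF s1(1), of r t] r t by (simp add: Urt_def)
      have 2: "((\<lambda>t. Ut (r,t)) has_real_derivative Utt (r,t)) (at t)"
        using dt'[OF s1(2), of r t] r t by (simp add: Utt_def)
      define d where "d = 2 * (real (Suc m) * t ^ m) * Ur (r,t) * Ut (r,t)
         + 2 * t ^ Suc m * (Urt (r,t) * Ut (r,t) + Ur (r,t) * Utt (r,t))"
      have d: "(F has_real_derivative d) (at t)"
        unfolding F_def d_def by (rule derivative_eq_intros 1 2 refl | simp add: algebra_simps)+
      have Utt: "Utt (r,t) = Urr (r,t) + real (Suc m) / r * Ur (r,t) - real (Suc m) / t * Ut (r,t)"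
        using radial_darboux_solved[OF U, of r t] r t by (simp add: in_strip Utt_def Urr_def Ur_def Ut_def)
      have "d - qs r t = 2 * real (Suc m) * t ^ Suc m / r * (Ur (r,t))\<^sup>2"
        using r t unfolding d_def qs_def Utt by (simp add: field_simps power2_eq_square)
      moreover have "\<dots> \<ge> 0" using r t by (intro mult_nonneg_nonneg divide_nonneg_nonneg) auto
      ultimately show "\<exists>d. (F has_real_derivative d) (at t) \<and> qs r t \<le> d" using d by (intro exI[of _ d]) auto
    qed
  qed (use that in auto)
  show ?thesis
  proof (cases "t \<ge> 2")
    case False
    have "U (r,t) = U (r,2)"
    proof (rule const_of_deriv_0[where f="\<lambda>t. U (r,t)"])
      show "continuous_on {t..2} (\<lambda>t. U (r, t))"
        using continuous_on_subset[OF cline[OF cont(1) rt(1), of 2], of "{t..2}"] rt by auto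
      fix x assume x: "t < x" "x < 2"
      have "q r x = 0" using q0[of r x] rt x by auto
      then have "Ut (r,x) = 0" using x rt by (auto simp: q_def add_nonneg_eq_0_iff)
      then show "((\<lambda>t. U (r, t)) has_real_derivative 0) (at x)"
        using dt'[OF sU rt(1), of x] x rt by (simp add: Ut_def)
    qed (use False in auto)
    then show ?thesis using late[OF rt(1), of 2] by simp
  qed (use late rt in auto)
qed


text \<open>
Domain of dependence: followed backwards in time from \<open>t = 2\<close>, the influence of the unknown values at
\<open>r = 1\<close> moves inwards with unit speed and reaches the axis only at \<open>t = 1\<close>.
\<close>
lemma radial_darboux_vanishes_late:
  assumes U: "radial_darboux (Suc m) strip U"
    and late: "\<And>r t. r \<in> {0..1} \<Longrightarrow> t \<ge> 2 \<Longrightarrow> U (r, t) = 0"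
    and t1: "t \<ge> 1"
  shows "U (0, t) = 0"
proof -
  have sU: "smooth_on strip U" using U by (simp add: radial_darboux_def)
  define Ur where "Ur = dd strip (1,0) U"
  define Ut where "Ut = dd strip (0,1) U"
  define Urr where "Urr = dd strip (1,0) Ur"
  define Utt where "Utt = dd strip (0,1) Ut"
  define Urt where "Urt = dd strip (0,1) Ur"
  note fs = convex_body_strip
  have s1: "smooth_on strip Ur" "smooth_on strip Ut" unfolding Ur_def Ut_def by (intro smooth_on_dd fs sU)+
  have s2: "smooth_on strip Utt" "smooth_on strip Urt" unfolding Utt_def Urt_def by (intro smooth_on_dd fs s1)+
  note cont = sU[THEN smooth_on_continuous] s1[THEN smooth_on_continuous] s2[THEN smooth_on_continuous]
  have Utr: "dd strip (1,0) Ut p = Urt p" if "p \<in> strip" for p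
    unfolding Ut_def Urt_def Ur_def by (rule dd_commute[OF fs sU that])
  have in_strip: "(r, t) \<in> strip \<longleftrightarrow> r \<in> {0..1} \<and> t \<ge> 0" for r t by (auto simp: strip_def)
  have dr: "((\<lambda>r. f (r, t)) has_real_derivative dd strip (1,0) f (r,t)) (at r within {0..1})"
    if "smooth_on strip f" "r \<in> {0..1}" "t \<ge> 0" for f r t
    using rect_chain[OF fs that(1) DERIV_ident DERIV_const[where k=t], where s=r and S="{0..1}"] that by (simp add: in_strip)
  have dr': "((\<lambda>r. f (r, t)) has_real_derivative dd strip (1,0) f (r,t)) (at r)"
    if "smooth_on strip f" "r \<in> {0<..<1}" "t \<ge> 0" for f r t
    using dr[of f r t] that at_within_interior[of r "{0..1}"] by simp
  have dt: "((\<lambda>s. f (x, 2 - s)) has_real_derivative - dd strip (0,1) f (x, 2 - s)) (at s within {0..1})"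
    if "smooth_on strip f" "x \<in> {0..1}" "s \<in> {0..1}" for f x s
  proof -
    have "((\<lambda>s::real. 2 - s) has_real_derivative -1) (at s within {0..1})" by (auto intro!: derivative_eq_intros)
    from rect_chain[OF fs that(1) DERIV_const[where k=x] this _ that(3)] that show ?thesis by (simp add: in_strip)
  qed
  have dt2: "((\<lambda>t. f (r, t)) has_real_derivative dd strip (0,1) f (r,t)) (at t)"
    if "smooth_on strip f" "r \<in> {0..1}" "t > 0" for f r t
    using rect_chain[OF fs that(1) DERIV_const[where k=r] DERIV_ident, where s=t and S="{0..}"] that
      at_within_interior[of t "{0..}"] by (simp add: in_strip)
  have cline: "continuous_on {0..1} (\<lambda>r. f (r, t))" if "continuous_on strip f" "t \<ge> 0" for f :: "real \<times> real \<Rightarrow> real" and t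
  proof (rule continuous_on_compose2[OF that(1)])
    show "continuous_on {0..1} (\<lambda>r. (r, t))" by (intro continuous_intros)
  qed (use that in_strip in auto)
  have cflip: "continuous_on ({0..1} \<times> {0..1}) (\<lambda>p. f (snd p, 2 - fst p))" if "continuous_on strip f" for f :: "real \<times> real \<Rightarrow> real"
    by (rule continuous_on_compose2[OF that]) (auto intro!: continuous_intros simp: in_strip)
  have late0: "Ur (x, 2) = 0" "Ut (x, 2) = 0" if x: "x \<in> {0..1}" for x
  proof -
    have "((\<lambda>r. U (r, 2)) has_real_derivative Ur (x,2)) (at x within {0..1})"
      using dr[OF sU x, of 2] by (simp add: Ur_def)
    then have "((\<lambda>r. 0) has_real_derivative Ur (x,2)) (at x within {0..1})"
      by (rule has_field_derivative_transform_within[where d=1]) (use late x in auto)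
    then have "((\<lambda>r. 0) has_derivative (\<lambda>h. Ur (x,2) * h)) (at x within {0..1})" by (simp add: has_field_derivative_def)
    from convex_body_deriv_unique[OF convex_body_unit_interval x this has_derivative_const] show "Ur (x,2) = 0" by (metis mult.right_neutral)
    have "((\<lambda>t. U (x, t)) has_real_derivative Ut (x,2)) (at 2)"
      using dt2[OF sU x, of 2] by (simp add: Ut_def)
    then have "((\<lambda>t. U (x, t)) has_real_derivative Ut (x,2)) (at 2 within {2..})"
      by (rule has_field_derivative_at_within)
    then have "((\<lambda>t. 0) has_real_derivative Ut (x,2)) (at 2 within {2..})"
      by (rule has_field_derivative_transform_within[where d=1]) (use late x in auto)
    then have "((\<lambda>r. 0) has_derivative (\<lambda>h. Ut (x,2) * h)) (at 2 within {2..})" by (simp add: has_field_derivative_def)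
    from convex_body_deriv_unique[OF _ _ this has_derivative_const] show "Ut (x,2) = 0"
      by (simp add: convex_body_def fun_eq_iff) (metis mult.right_neutral)
  qed
  \<comment> \<open>A cutoff supported in \<open>r < t - 1\<close>: it avoids a moving domain of integration, and it vanishes at \<open>r = 1\<close> for \<open>t \<le> 2\<close>.\<close>
  define c where "c = (\<lambda>s::real. (max 0 (s - 1))\<^sup>2)"
  define c' where "c' = (\<lambda>s::real. 2 * max 0 (s - 1))"
  have c: "((\<lambda>s. c (g s)) has_real_derivative c' (g s) * g') (at s within S)"
    if "(g has_real_derivative g') (at s within S)" for g g' s S
  proof -
    have "((\<lambda>s. g s - 1) has_real_derivative g') (at s within S)" using DERIV_diff[OF that DERIV_const[where k=1]] by simp
    from DERIV_chain2[OF positive_part_square_derivative this] show ?thesis by (simp add: c_def c'_def)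
  qed
  have c_nonneg: "c s \<ge> 0" "c' s \<ge> 0" for s by (auto simp: c_def c'_def)
  have cc: "continuous_on A c" "continuous_on A c'" for A unfolding c_def c'_def by (intro continuous_intros)+
  have cc2: "continuous_on A (\<lambda>p. c (g p))" "continuous_on A (\<lambda>p. c' (g p))" if "continuous_on A g" for A and g :: "'z::topological_space \<Rightarrow> real"
    using continuous_on_compose2[OF cc(1)[of UNIV] that] continuous_on_compose2[OF cc(2)[of UNIV] that] by auto
  \<comment> \<open>Time is \<open>t = 2 - s\<close>. Backwards in time the term \<open>U_t / t\<close> has the wrong sign; the factor \<open>t^(2m+2)\<close> compensates it.\<close>
  define q where "q = (\<lambda>s x. (2 - s) ^ (2 * Suc m) * c (2 - s - x) * ((Ur (x, 2 - s))\<^sup>2 + (Ut (x, 2 - s))\<^sup>2) * x ^ Suc m)"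
  define qs where "qs = (\<lambda>s x. - (real (2 * Suc m) * (2 - s) ^ (2 * m + 1) * c (2 - s - x) * ((Ur (x, 2 - s))\<^sup>2 + (Ut (x, 2 - s))\<^sup>2)
      + (2 - s) ^ (2 * Suc m) * c' (2 - s - x) * ((Ur (x, 2 - s))\<^sup>2 + (Ut (x, 2 - s))\<^sup>2)
      + (2 - s) ^ (2 * Suc m) * c (2 - s - x) * (2 * Ur (x, 2 - s) * Urt (x, 2 - s) + 2 * Ut (x, 2 - s) * Utt (x, 2 - s))) * x ^ Suc m)"
  have q0: "q s x = 0" if "s \<in> {0..1}" "x \<in> {0..1}" for s x
  proof (rule energy_zero[of 0 1 1 q qs])
    show "continuous_on ({0..1} \<times> {0..1}) (\<lambda>p. q (fst p) (snd p))"
      unfolding q_def by (intro continuous_intros cflip cc2 cont)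
    show "continuous_on ({0..1} \<times> {0..1}) (\<lambda>p. qs (fst p) (snd p))"
      unfolding qs_def by (intro continuous_intros cflip cc2 cont)
    fix s x :: real assume s: "s \<in> {0..1}" and x: "x \<in> {0..1}"
    have 1: "((\<lambda>s. Ur (x, 2 - s)) has_real_derivative - Urt (x, 2 - s)) (at s within {0..1})"
      using dt[OF s1(1) x s] by (simp add: Urt_def)
    have 2: "((\<lambda>s. Ut (x, 2 - s)) has_real_derivative - Utt (x, 2 - s)) (at s within {0..1})"
      using dt[OF s1(2) x s] by (simp add: Utt_def)
    have "((\<lambda>s. 2 - s - x) has_real_derivative -1) (at s within {0..1})" by (auto intro!: derivative_eq_intros)
    from c[OF this] have 3: "((\<lambda>s. c (2 - s - x)) has_real_derivative - c' (2 - s - x)) (at s within {0..1})" by simp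
    have 4: "((\<lambda>s. (2 - s) ^ (2 * Suc m)) has_real_derivative - (real (2 * Suc m) * (2 - s) ^ (2 * m + 1))) (at s within {0..1})"
      by (rule derivative_eq_intros refl | simp)+
    show "((\<lambda>s. q s x) has_real_derivative qs s x) (at s within {0..1})"
      unfolding q_def qs_def
      by ((rule derivative_eq_intros 1 2 3 4 refl)+, simp add: algebra_simps)
    show "0 \<le> q s x" using s x c_nonneg by (simp add: q_def)
  next
    fix x :: real assume "x \<in> {0..1}"
    then show "q 0 x = 0" using late0[of x] by (simp add: q_def)
  next
    fix s :: real assume s: "0 < s" "s < 1"
    define t where "t = 2 - s"
    have t: "1 < t" "t < 2" using s by (auto simp: t_def)
    define F where "F = (\<lambda>x. - (2 * t ^ (2 * Suc m) * c (t - x) * Ut (x,t) * Ur (x,t) * x ^ Suc m))"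
    show "\<exists>F. continuous_on {0..1} F \<and> F 1 \<le> F 0 \<and>
      (\<forall>x\<in>{0<..<1}. \<exists>d. (F has_real_derivative d) (at x) \<and> qs s x \<le> d)"
    proof (intro exI[of _ F] conjI ballI)
      show "continuous_on {0..1} F" unfolding F_def by (intro continuous_intros cline cc2 cont) (use t in auto)
      show "F 1 \<le> F 0" using t by (simp add: F_def c_def)
      fix x :: real assume x: "x \<in> {0<..<1}"
      have 1: "((\<lambda>x. Ur (x,t)) has_real_derivative Urr (x,t)) (at x)"
        using dr'[OF s1(1) x, of t] t by (simp add: Urr_def)
      have 2: "((\<lambda>x. Ut (x,t)) has_real_derivative Urt (x,t)) (at x)"
        using dr'[OF s1(2) x, of t] Utr[of "(x,t)"] x t by (simp add: in_strip)
      have "((\<lambda>x. t - x) has_real_derivative -1) (at x)" by (auto intro!: derivative_eq_intros)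
      from c[OF this] have 3: "((\<lambda>x. c (t - x)) has_real_derivative - c' (t - x)) (at x)" by simp
      define d where "d = 2 * t ^ (2 * Suc m) * (c' (t - x) * Ut (x,t) * Ur (x,t) * x ^ Suc m
          - c (t - x) * (Urt (x,t) * Ur (x,t) + Ut (x,t) * Urr (x,t)) * x ^ Suc m
          - c (t - x) * Ut (x,t) * Ur (x,t) * (real (Suc m) * x ^ m))"
      have d: "(F has_real_derivative d) (at x)"
        unfolding F_def d_def by (rule derivative_eq_intros 1 2 3 refl | simp add: algebra_simps)+
      have Utt: "Utt (x,t) = Urr (x,t) + real (Suc m) / x * Ur (x,t) - real (Suc m) / t * Ut (x,t)"
        using radial_darboux_solved[OF U, of x t] x t by (simp add: in_strip Utt_def Urr_def Ur_def Ut_def)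
      have "d - qs s x = t ^ (2 * Suc m) * c' (t - x) * (Ut (x,t) + Ur (x,t))\<^sup>2 * x ^ Suc m
          + real (2 * Suc m) * t ^ (2 * m + 1) * c (t - x) * (Ur (x,t))\<^sup>2 * x ^ Suc m"
        using x t unfolding d_def qs_def t_def[symmetric] Utt by (simp add: field_simps power2_eq_square)
      moreover have "\<dots> \<ge> 0" using x t c_nonneg by (intro add_nonneg_nonneg mult_nonneg_nonneg) auto
      ultimately show "\<exists>d. (F has_real_derivative d) (at x) \<and> qs s x \<le> d" using d by (intro exI[of _ d]) auto
    qed
  qed (use that in auto)
  have Ut0: "Ut (0, t) = 0" if t: "1 < t" "t < 2" for t
  proof -
    show ?thesis
    proof (rule eq_of_eq_on_interior[where X="{0..t - 1}" and f="\<lambda>x. Ut (x, t)" and g="\<lambda>x. 0"])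
      show "convex_body {0..t - 1}" using t by (simp add: convex_body_def)
      show "continuous_on {0..t - 1} (\<lambda>x. Ut (x, t))"
        by (rule continuous_on_subset[OF cline[OF cont(3)]]) (use t in auto)
      fix x assume "x \<in> interior {0..t - 1}"
      then have x: "0 < x" "x < t - 1" by auto
      then have "q (2 - t) x = 0" using q0 t by auto
      moreover have "c (t - x) > 0" using x by (simp add: c_def)
      ultimately show "Ut (x, t) = 0" using x t by (auto simp: q_def add_nonneg_eq_0_iff)
    qed (use t in auto)
  qed
  show ?thesis
  proof (cases "t \<ge> 2")
    case False
    have "U (0,t) = U (0,2)"
    proof (rule const_of_deriv_0[where f="\<lambda>t. U (0,t)"])
      show "continuous_on {t..2} (\<lambda>t. U (0, t))"
        by (rule continuous_on_compose2[OF cont(1)]) (use t1 in \<open>auto intro!: continuous_intros simp: in_strip\<close>)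
      fix x assume x: "t < x" "x < 2"
      then show "((\<lambda>t. U (0, t)) has_real_derivative 0) (at x)"
        using dt2[OF sU, of 0 x] Ut0[of x] t1 by (simp add: Ut_def)
    qed (use False in auto)
    then show ?thesis using late[of 0 2] by simp
  qed (use late in auto)
qed

text \<open>
Zero data on the characteristic \<open>r = t\<close> determine the solution in the triangle \<open>t \<le> r\<close>. At \<open>t = 0\<close>
the weight in the energy kills the flux. The triangle is parametrised
as \<open>t = r x\<close> with \<open>0 \<le> x \<le> 1\<close>, so that the energy integral has a fixed domain.
\<close>
lemma radial_darboux_zero_on_diagonal:
  fixes Q :: "(real \<times> real) set"
  defines "Q \<equiv> {0..1} \<times> {0..1}"
  assumes V: "radial_darboux (Suc m) Q V" and diag: "\<And>r. r \<in> {0..1} \<Longrightarrow> V (r, r) = 0"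
    and r: "r \<in> {0..1}"
  shows "V (r, 0) = 0"
proof -
  have sV: "smooth_on Q V" using V by (simp add: radial_darboux_def)
  define Vr where "Vr = dd Q (1,0) V"
  define Vt where "Vt = dd Q (0,1) V"
  define Vrr where "Vrr = dd Q (1,0) Vr"
  define Vtt where "Vtt = dd Q (0,1) Vt"
  define Vrt where "Vrt = dd Q (0,1) Vr"
  have fs: "convex_body Q" unfolding Q_def by (rule convex_body_square)
  have s1: "smooth_on Q Vr" "smooth_on Q Vt" unfolding Vr_def Vt_def by (intro smooth_on_dd fs sV)+
  have s2: "smooth_on Q Vrr" "smooth_on Q Vrt" "smooth_on Q Vtt" unfolding Vrr_def Vrt_def Vtt_def by (intro smooth_on_dd fs s1)+
  note cont = sV[THEN smooth_on_continuous] s1[THEN smooth_on_continuous] s2[THEN smooth_on_continuous]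
  have Vtr: "dd Q (1,0) Vt p = Vrt p" if "p \<in> Q" for p
    unfolding Vt_def Vrt_def Vr_def by (rule dd_commute[OF fs sV that])
  have in_Q: "(r, t) \<in> Q \<longleftrightarrow> r \<in> {0..1} \<and> t \<in> {0..1}" for r t by (auto simp: Q_def)
  have ray_in: "(r, r * x) \<in> Q" if "r \<in> {0..1}" "x \<in> {0..1}" for r x
    using that by (auto simp: in_Q intro: mult_le_one)
  have dr: "((\<lambda>r. f (r, r * x)) has_real_derivative dd Q (1,0) f (r, r * x) + x * dd Q (0,1) f (r, r * x)) (at r within {0..1})"
    if "smooth_on Q f" "r \<in> {0..1}" "x \<in> {0..1}" for f r x
  proof -
    have "((\<lambda>r. r * x) has_real_derivative x) (at r within {0..1})" by (auto intro!: derivative_eq_intros)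
    from rect_chain[OF fs that(1) DERIV_ident this _ that(2)] that ray_in show ?thesis by simp
  qed
  have dx: "((\<lambda>x. f (r, r * x)) has_real_derivative r * dd Q (0,1) f (r, r * x)) (at x)"
    if "smooth_on Q f" "r \<in> {0..1}" "x \<in> {0<..<1}" for f r x
  proof -
    have 1: "((\<lambda>x. r * x) has_real_derivative r) (at x within {0..1})" by (auto intro!: derivative_eq_intros)
    have x: "x \<in> {0..1}" using that by auto
    from rect_chain[OF fs that(1) DERIV_const[where k=r] 1 _ x] ray_in[OF that(2)]
    show ?thesis using that(3) at_within_interior[of x "{0..1}"] by simp
  qed
  have cray: "continuous_on ({0..1} \<times> {0..1}) (\<lambda>p. f (fst p, fst p * snd p))" if "continuous_on Q f" for f :: "real \<times> real \<Rightarrow> real"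
    by (rule continuous_on_compose2[OF that]) (auto intro!: continuous_intros simp: ray_in)
  have cx: "continuous_on {0..1} (\<lambda>x. f (r, r * x))" if "continuous_on Q f" "r \<in> {0..1}" for f :: "real \<times> real \<Rightarrow> real" and r
    by (rule continuous_on_compose2[OF that(1)]) (use that(2) in \<open>auto intro!: continuous_intros simp: ray_in\<close>)
  have diag': "Vr (r, r) + Vt (r, r) = 0" if "r \<in> {0..1}" for r
  proof -
    have "((\<lambda>r. V (r, r)) has_real_derivative Vr (r, r) + Vt (r, r)) (at r within {0..1})"
      using dr[OF sV that, of 1] by (simp add: Vr_def Vt_def)
    then have "((\<lambda>r. 0) has_real_derivative Vr (r, r) + Vt (r, r)) (at r within {0..1})"
      by (rule has_field_derivative_transform_within[where d=1]) (use diag that in auto)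
    then have "((\<lambda>r. 0) has_derivative (\<lambda>h. (Vr (r, r) + Vt (r, r)) * h)) (at r within {0..1})" by (simp add: has_field_derivative_def)
    from convex_body_deriv_unique[OF convex_body_unit_interval that this has_derivative_const] show ?thesis by (metis mult.right_neutral)
  qed
  \<comment> \<open>The energy density in \<open>x = t / r\<close>. Its flux \<open>F\<close> contains a transport term from the scaling, which combines to \<open>(V_r + V_t)^2\<close> on the diagonal, a derivative along the diagonal.\<close>
  define q where "q = (\<lambda>r x. ((Vr (r, r * x))\<^sup>2 + (Vt (r, r * x))\<^sup>2) * r ^ (m + 2) * x ^ Suc m)"
  define qs where "qs = (\<lambda>r x. (2 * Vr (r, r * x) * (Vrr (r, r * x) + x * Vrt (r, r * x))
      + 2 * Vt (r, r * x) * (Vrt (r, r * x) + x * Vtt (r, r * x))) * r ^ (m + 2) * x ^ Suc m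
      + ((Vr (r, r * x))\<^sup>2 + (Vt (r, r * x))\<^sup>2) * (real (m + 2) * r ^ Suc m) * x ^ Suc m)"
  have q0: "q r x = 0" if "r \<in> {0..1}" "x \<in> {0..1}" for r x
  proof (rule energy_zero[of 0 1 1 q qs])
    show "continuous_on ({0..1} \<times> {0..1}) (\<lambda>p. q (fst p) (snd p))"
      unfolding q_def by (intro continuous_intros cray cont)
    show "continuous_on ({0..1} \<times> {0..1}) (\<lambda>p. qs (fst p) (snd p))"
      unfolding qs_def by (intro continuous_intros cray cont)
    fix r x :: real assume r: "r \<in> {0..1}" and x: "x \<in> {0..1}"
    have 1: "((\<lambda>r. Vr (r, r * x)) has_real_derivative Vrr (r, r * x) + x * Vrt (r, r * x)) (at r within {0..1})"
      using dr[OF s1(1) r x] by (simp add: Vrr_def Vrt_def)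
    have 2: "((\<lambda>r. Vt (r, r * x)) has_real_derivative Vrt (r, r * x) + x * Vtt (r, r * x)) (at r within {0..1})"
      using dr[OF s1(2) r x] Vtr[OF ray_in[OF r x]] by (simp add: Vtt_def)
    have 3: "((\<lambda>r. r ^ (m + 2)) has_real_derivative real (m + 2) * r ^ Suc m) (at r within {0..1})"
      by (rule derivative_eq_intros refl | simp)+
    show "((\<lambda>r. q r x) has_real_derivative qs r x) (at r within {0..1})"
      unfolding q_def qs_def
      by ((rule derivative_eq_intros 1 2 3 refl)+, simp add: algebra_simps)
    show "0 \<le> q r x" using r x by (simp add: q_def)
  next
    fix x :: real assume "x \<in> {0..1}"
    then show "q 0 x = 0" by (simp add: q_def)
  next
    fix r :: real assume r: "0 < r" "r < 1"
    then have rr: "r \<in> {0..1}" by simp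
    define F where "F = (\<lambda>x. ((Vr (r, r * x))\<^sup>2 + (Vt (r, r * x))\<^sup>2) * r ^ Suc m * x ^ (m + 2)
       + 2 * r ^ Suc m * x ^ Suc m * Vr (r, r * x) * Vt (r, r * x))"
    show "\<exists>F. continuous_on {0..1} F \<and> F 1 \<le> F 0 \<and>
      (\<forall>x\<in>{0<..<1}. \<exists>d. (F has_real_derivative d) (at x) \<and> qs r x \<le> d)"
    proof (intro exI[of _ F] conjI ballI)
      show "continuous_on {0..1} F" unfolding F_def by (intro continuous_intros cx cont) (use r in auto)
      have "F 1 = r ^ Suc m * (Vr (r, r) + Vt (r, r))\<^sup>2" by (simp add: F_def power2_eq_square algebra_simps)
      then show "F 1 \<le> F 0" using diag'[OF rr] by (simp add: F_def)
      fix x :: real assume x: "x \<in> {0<..<1}"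
      then have xx: "x \<in> {0..1}" by auto
      have 1: "((\<lambda>x. Vr (r, r * x)) has_real_derivative r * Vrt (r, r * x)) (at x)"
        using dx[OF s1(1) rr x] by (simp add: Vrt_def)
      have 2: "((\<lambda>x. Vt (r, r * x)) has_real_derivative r * Vtt (r, r * x)) (at x)"
        using dx[OF s1(2) rr x] by (simp add: Vtt_def)
      have 3: "((\<lambda>x. x ^ (m + 2)) has_real_derivative real (m + 2) * x ^ Suc m) (at x)"
        by (rule derivative_eq_intros refl | simp)+
      define d where "d = (2 * Vr (r, r * x) * (r * Vrt (r, r * x)) + 2 * Vt (r, r * x) * (r * Vtt (r, r * x))) * r ^ Suc m * x ^ (m + 2)
         + ((Vr (r, r * x))\<^sup>2 + (Vt (r, r * x))\<^sup>2) * r ^ Suc m * (real (m + 2) * x ^ Suc m)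
         + 2 * r ^ Suc m * (real (Suc m) * x ^ m) * Vr (r, r * x) * Vt (r, r * x)
         + 2 * r ^ Suc m * x ^ Suc m * (r * Vrt (r, r * x) * Vt (r, r * x) + Vr (r, r * x) * (r * Vtt (r, r * x)))"
      have d: "(F has_real_derivative d) (at x)"
        unfolding F_def d_def by ((rule derivative_eq_intros 1 2 3 refl)+, simp add: algebra_simps)
      have Vtt: "Vtt (r, r * x) = Vrr (r, r * x) + real (Suc m) / r * Vr (r, r * x) - real (Suc m) / (r * x) * Vt (r, r * x)"
        using radial_darboux_solved[OF V ray_in[OF rr xx]] r x by (simp add: Vtt_def Vrr_def Vr_def Vt_def)
      have "d - qs r x = 2 * real (Suc m) * r ^ Suc m * x ^ Suc m * (Vr (r, r * x))\<^sup>2"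
        using x r unfolding d_def qs_def Vtt by (simp add: field_simps power2_eq_square)
      moreover have "\<dots> \<ge> 0" using x r by (intro mult_nonneg_nonneg) auto
      ultimately show "\<exists>d. (F has_real_derivative d) (at x) \<and> qs r x \<le> d" using d by (intro exI[of _ d]) auto
    qed
  qed (use that in auto)
  show ?thesis
  proof (cases "r = 0")
    case False
    have "(\<lambda>x. V (r, r * x)) 0 = (\<lambda>x. V (r, r * x)) 1"
    proof (rule const_of_deriv_0[where f="\<lambda>x. V (r, r * x)"])
      show "continuous_on {0..1} (\<lambda>x. V (r, r * x))" by (rule cx[OF cont(1) r])
      fix x :: real assume x: "0 < x" "x < 1"
      have "q r x = 0" using q0[OF r, of x] x by auto
      then have "Vt (r, r * x) = 0" using False x r by (auto simp: q_def add_nonneg_eq_0_iff)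
      then show "((\<lambda>x. V (r, r * x)) has_real_derivative 0) (at x)"
        using dx[OF sV r, of x] x by (simp add: Vt_def)
    qed auto
    then show ?thesis using diag[OF r] by simp
  qed (use diag[of 0] in auto)
qed

text \<open>
Asgeirsson's mean value theorem in radial form: \<open>U(r,t) - U(t,r)\<close> solves the same equation and vanishes
on the diagonal.
\<close>
lemma radial_darboux_swap:
  assumes U: "radial_darboux (Suc m) strip U" and r: "r \<in> {0..1}"
  shows "U (r, 0) = U (0, r)"
proof -
  let ?Q = "{0..1::real} \<times> {0..1::real}"
  note fs = convex_body_strip note fQ = convex_body_square
  have sU: "smooth_on strip U" using U by (simp add: radial_darboux_def)
  have lin: "bounded_linear (\<lambda>p::real \<times> real. (snd p, fst p))"
    by (intro bounded_linear_Pair bounded_linear_fst bounded_linear_snd)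
  have sub: "?Q \<subseteq> strip" by (auto simp: strip_def)
  have m1: "0 + p \<in> strip" and m2: "0 + (snd p, fst p) \<in> strip" if "p \<in> ?Q" for p
    using that by (auto simp: strip_def)
  have sS: "smooth_on ?Q f" and sW: "smooth_on ?Q (\<lambda>p. f (snd p, fst p))"
    and dS: "\<And>v p. p \<in> ?Q \<Longrightarrow> dd ?Q v f p = dd strip v f p"
    and dW: "\<And>v p. p \<in> ?Q \<Longrightarrow> dd ?Q v (\<lambda>p. f (snd p, fst p)) p = dd strip (snd v, fst v) f (snd p, fst p)"
    if f: "smooth_on strip f" for f
  proof -
    show "smooth_on ?Q f" using smooth_on_subset[OF f sub] .
    show "smooth_on ?Q (\<lambda>p. f (snd p, fst p))" using smooth_on_affine[OF fs lin m2 f] by simp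
    show "dd ?Q v f p = dd strip v f p" if "p \<in> ?Q" for v p
      using dd_affine[OF fs bounded_linear_ident m1 f fQ that] by simp
    show "dd ?Q v (\<lambda>p. f (snd p, fst p)) p = dd strip (snd v, fst v) f (snd p, fst p)" if "p \<in> ?Q" for v p
      using dd_affine[OF fs lin m2 f fQ that] by simp
  qed
  define V where "V = (\<lambda>p. U p - U (snd p, fst p))"
  have sV: "smooth_on ?Q V" unfolding V_def by (intro smooth_on_diff sS sW sU)
  have d1: "dd ?Q v V p = dd strip v U p - dd strip (snd v, fst v) U (snd p, fst p)" if "p \<in> ?Q" for v p
    unfolding V_def dd_diff[OF fQ that sS[OF sU] sW[OF sU]] dS[OF sU that] dW[OF sU that] ..
  have d2: "dd ?Q v (dd ?Q v V) p = dd strip v (dd strip v U) p - dd strip (snd v, fst v) (dd strip (snd v, fst v) U) (snd p, fst p)"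
    if "p \<in> ?Q" for v p
  proof -
    have "dd ?Q v (dd ?Q v V) p = dd ?Q v (\<lambda>p. dd strip v U p - dd strip (snd v, fst v) U (snd p, fst p)) p"
      by (rule dd_cong[OF fQ that smooth_on_dd[OF fQ sV] d1])
    then show ?thesis
      by (simp add: dd_diff[OF fQ that] sS sW smooth_on_dd[OF fs] sU dS[OF _ that] dW[OF _ that])
  qed
  have "radial_darboux (Suc m) ?Q V"
    unfolding radial_darboux_def
  proof (intro conjI sV ballI, clarify)
    fix r t :: real assume rt: "r \<in> {0..1}" "t \<in> {0..1}"
    then have p: "(r, t) \<in> ?Q" "(r, t) \<in> strip" "(t, r) \<in> strip" by (auto simp: strip_def)
    have e1: "r * t * (dd strip (1,0) (dd strip (1,0) U) (r,t) - dd strip (0,1) (dd strip (0,1) U) (r,t))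
     + real (Suc m) * (t * dd strip (1,0) U (r,t) - r * dd strip (0,1) U (r,t)) = 0"
      and e2: "t * r * (dd strip (1,0) (dd strip (1,0) U) (t,r) - dd strip (0,1) (dd strip (0,1) U) (t,r))
     + real (Suc m) * (r * dd strip (1,0) U (t,r) - t * dd strip (0,1) U (t,r)) = 0"
      using U p(2,3) unfolding radial_darboux_def by blast+
    have "r * t * (dd ?Q (1,0) (dd ?Q (1,0) V) (r,t) - dd ?Q (0,1) (dd ?Q (0,1) V) (r,t))
       + real (Suc m) * (t * dd ?Q (1,0) V (r,t) - r * dd ?Q (0,1) V (r,t))
      = (r * t * (dd strip (1,0) (dd strip (1,0) U) (r,t) - dd strip (0,1) (dd strip (0,1) U) (r,t))
     + real (Suc m) * (t * dd strip (1,0) U (r,t) - r * dd strip (0,1) U (r,t)))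
     + (t * r * (dd strip (1,0) (dd strip (1,0) U) (t,r) - dd strip (0,1) (dd strip (0,1) U) (t,r))
     + real (Suc m) * (r * dd strip (1,0) U (t,r) - t * dd strip (0,1) U (t,r)))"
      unfolding d1[OF p(1)] d2[OF p(1)] fst_conv snd_conv by (simp only: algebra_simps)
    also have "\<dots> = 0" using e1 e2 by simp
    finally show "r * t * (dd ?Q (1,0) (dd ?Q (1,0) V) (r,t) - dd ?Q (0,1) (dd ?Q (0,1) V) (r,t))
       + real (Suc m) * (t * dd ?Q (1,0) V (r,t) - r * dd ?Q (0,1) V (r,t)) = 0" .
  qed
  from radial_darboux_zero_on_diagonal[OF this _ r] have "V (r, 0) = 0" by (simp add: V_def)
  then show ?thesis by (simp add: V_def)
qed

section \<open>Functions with flat spherical averages\<close>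

lemma mean_mono:
  assumes "continuous_on (cball 0 1) f" "continuous_on (cball 0 1) g" "\<And>w. w \<in> sphere 0 1 \<Longrightarrow> f w \<le> g w"
  shows "mean f \<le> mean g"
proof -
  have "bump z * f (retr z) \<le> bump z * g (retr z)" for z
    using assms(3)[OF retr_in_sphere, of z] bump_eq_0[of z] bump_nonneg[of z]
    by (cases "norm z \<ge> 1") (auto intro: mult_left_mono)
  then have "integral bump_box (\<lambda>z. bump z * f (retr z)) \<le> integral bump_box (\<lambda>z. bump z * g (retr z))"
    by (intro integral_le bump_mult_integrable assms) auto
  then show ?thesis unfolding mean_def by (rule divide_right_mono) (use bump_integral_pos less_imp_le in blast)
qed

abbreviation (input) K :: "'a::euclidean_space set" where "K \<equiv> cball 0 1"

lemma euler_cong: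
  "smooth_on K \<phi> \<Longrightarrow> (\<And>y. y \<in> K \<Longrightarrow> \<phi> y = \<psi> y) \<Longrightarrow> x \<in> K \<Longrightarrow> euler \<phi> x = euler \<psi> x"
  unfolding euler_def by (intro sum.cong refl arg_cong2[where f="(*)"] dd_cong convex_body_cball)

lemma euler_add:
  "smooth_on K \<phi> \<Longrightarrow> smooth_on K \<psi> \<Longrightarrow> x \<in> K \<Longrightarrow> euler (\<lambda>x. \<phi> x + \<psi> x) x = euler \<phi> x + euler \<psi> x"
  unfolding euler_def by (simp add: dd_add[OF convex_body_cball] distrib_left sum.distrib)

lemma euler_diff:
  "smooth_on K \<phi> \<Longrightarrow> smooth_on K \<psi> \<Longrightarrow> x \<in> K \<Longrightarrow> euler (\<lambda>x. \<phi> x - \<psi> x) x = euler \<phi> x - euler \<psi> x"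
  unfolding euler_def by (simp add: dd_diff[OF convex_body_cball] right_diff_distrib sum_subtractf)

lemma euler_mult:
  "smooth_on K \<phi> \<Longrightarrow> smooth_on K \<psi> \<Longrightarrow> x \<in> K \<Longrightarrow> euler (\<lambda>x. \<phi> x * \<psi> x) x = \<phi> x * euler \<psi> x + euler \<phi> x * \<psi> x"
  unfolding euler_def
  by (simp add: dd_mult[OF convex_body_cball] distrib_left sum.distrib sum_distrib_left sum_distrib_right mult_ac)

lemma euler_cmult:
  "smooth_on K \<phi> \<Longrightarrow> x \<in> K \<Longrightarrow> euler (\<lambda>x. c * \<phi> x) x = c * euler \<phi> x"
  unfolding euler_def by (simp add: dd_cmult[OF convex_body_cball] sum_distrib_left mult_ac)

lemma euler_sum:
  "(\<And>i. i \<in> I \<Longrightarrow> smooth_on K (\<phi> i)) \<Longrightarrow> x \<in> K \<Longrightarrow> euler (\<lambda>x. \<Sum>i\<in>I. \<phi> i x) x = (\<Sum>i\<in>I. euler (\<phi> i) x)"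
  unfolding euler_def by (simp add: dd_sum[OF convex_body_cball] sum_distrib_left) (rule sum.swap)

lemma dd_inner_self: "x \<in> K \<Longrightarrow> dd K v (\<lambda>x. x \<bullet> x) x = 2 * (x \<bullet> v)"
  by (rule dd_eqI[OF convex_body_cball]) (auto intro!: derivative_eq_intros simp: inner_commute)

lemma euler_inner_self: "x \<in> K \<Longrightarrow> euler (\<lambda>x. x \<bullet> x) x = 2 * (x \<bullet> x)"
  unfolding euler_def by (simp add: dd_inner_self euclidean_inner[of x x] sum_distrib_left mult_ac)

lemma euler_inner: "x \<in> K \<Longrightarrow> euler (\<lambda>x. x \<bullet> b) x = x \<bullet> b"
  unfolding euler_def by (simp add: dd_inner[OF convex_body_cball] euclidean_inner[of x b] inner_commute[of b])

text \<open>
On spherical means this is \<open>r d/dr + c\<close>, which annihilates the power \<open>r^(-c)\<close>.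
\<close>
definition euler_shift :: "real \<Rightarrow> ('a::euclidean_space \<Rightarrow> real) \<Rightarrow> 'a \<Rightarrow> real" where
  "euler_shift c \<phi> x = euler \<phi> x + c * \<phi> x"

lemma euler_shift_smooth: "smooth_on K \<phi> \<Longrightarrow> smooth_on K (euler_shift c \<phi>)"
  unfolding euler_shift_def by (intro smooth_on_add euler_smooth smooth_on_cmult)

lemmas smooth_ball =
  smooth_on_add smooth_on_diff smooth_on_mult smooth_on_const smooth_on_sum smooth_on_inner
  smooth_on_inner_self euler_smooth euler_shift_smooth smooth_on_dd[OF convex_body_cball]

lemma euler_shift_cong:
  "smooth_on K \<phi> \<Longrightarrow> (\<And>y. y \<in> K \<Longrightarrow> \<phi> y = \<psi> y) \<Longrightarrow> x \<in> K \<Longrightarrow> euler_shift c \<phi> x = euler_shift c \<psi> x"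
  using euler_cong[of \<phi> \<psi> x] by (simp add: euler_shift_def)

lemma euler_shift_diff:
  "smooth_on K \<phi> \<Longrightarrow> smooth_on K \<psi> \<Longrightarrow> x \<in> K \<Longrightarrow> euler_shift c (\<lambda>x. \<phi> x - \<psi> x) x = euler_shift c \<phi> x - euler_shift c \<psi> x"
  by (simp add: euler_shift_def euler_diff right_diff_distrib)

lemma euler_shift_commute:
  assumes s: "smooth_on K \<phi>" and x: "x \<in> K" shows "euler_shift c (euler_shift d \<phi>) x = euler_shift d (euler_shift c \<phi>) x"
proof -
  have "euler (euler_shift a \<phi>) x = euler (euler \<phi>) x + a * euler \<phi> x" for a
    unfolding euler_shift_def[abs_def]
    using euler_add[OF euler_smooth[OF s] smooth_on_cmult[OF s] x] euler_cmult[OF s x] by simp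
  then show ?thesis by (simp add: euler_shift_def[of _ "euler_shift _ \<phi>"]) (simp add: euler_shift_def algebra_simps)
qed

lemma euler_shift_inner_self:
  assumes s: "smooth_on K \<phi>" and x: "x \<in> K"
  shows "euler_shift c (\<lambda>x. (x \<bullet> x) * \<phi> x) x = (x \<bullet> x) * euler_shift (c + 2) \<phi> x"
  unfolding euler_shift_def euler_mult[OF smooth_on_inner_self s x] euler_inner_self[OF x] by (simp add: algebra_simps)

text \<open>
This says that all derivatives of \<open>r \<mapsto> smean \<phi> r\<close> vanish at \<open>r = 1\<close>, since the Euler operator acts on
spherical means as \<open>r d/dr\<close>. It is not a condition on the single values of \<open>\<phi>\<close> on the sphere.
\<close>
definition flat :: "('a::euclidean_space \<Rightarrow> real) \<Rightarrow> bool" where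
  "flat \<phi> \<longleftrightarrow> smooth_on K \<phi> \<and> (\<forall>j. mean ((euler ^^ j) \<phi>) = 0)"

lemma flat_smooth: "flat \<phi> \<Longrightarrow> smooth_on K \<phi>" by (simp add: flat_def)

lemma euler_pow_smooth: "smooth_on K \<phi> \<Longrightarrow> smooth_on K ((euler ^^ j) \<phi>)"
  by (induction j) (auto intro: euler_smooth)

lemma euler_pow_cong:
  "smooth_on K \<phi> \<Longrightarrow> (\<And>y. y \<in> K \<Longrightarrow> \<phi> y = \<psi> y) \<Longrightarrow> x \<in> K \<Longrightarrow> (euler ^^ j) \<phi> x = (euler ^^ j) \<psi> x"
  by (induction j arbitrary: x) (auto intro: euler_cong euler_pow_smooth)

lemma sphere_subset_K: "w \<in> sphere 0 1 \<Longrightarrow> w \<in> K" by auto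

lemma mean_cong_K: "(\<And>x. x \<in> K \<Longrightarrow> \<phi> x = \<psi> x) \<Longrightarrow> mean \<phi> = mean \<psi>"
  by (rule mean_cong_sphere) auto

lemma flat_cong: "flat \<phi> \<Longrightarrow> (\<And>y. y \<in> K \<Longrightarrow> \<phi> y = \<psi> y) \<Longrightarrow> flat \<psi>"
  unfolding flat_def using euler_pow_cong[of \<phi> \<psi>] smooth_on_cong mean_cong_K by metis

lemma euler_pow_add:
  "smooth_on K \<phi> \<Longrightarrow> smooth_on K \<psi> \<Longrightarrow> x \<in> K \<Longrightarrow> (euler ^^ j) (\<lambda>x. \<phi> x + \<psi> x) x = (euler ^^ j) \<phi> x + (euler ^^ j) \<psi> x"
proof (induction j arbitrary: x)
  case (Suc j)
  have "(euler ^^ Suc j) (\<lambda>x. \<phi> x + \<psi> x) x = euler (\<lambda>x. (euler ^^ j) \<phi> x + (euler ^^ j) \<psi> x) x"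
    unfolding funpow.simps o_apply by (rule euler_cong) (use Suc in \<open>auto intro!: euler_pow_smooth smooth_ball\<close>)
  then show ?case using Suc.prems by (simp add: euler_add euler_pow_smooth)
qed auto

lemma euler_pow_cmult:
  "smooth_on K \<phi> \<Longrightarrow> x \<in> K \<Longrightarrow> (euler ^^ j) (\<lambda>x. c * \<phi> x) x = c * (euler ^^ j) \<phi> x"
proof (induction j arbitrary: x)
  case (Suc j)
  have "(euler ^^ Suc j) (\<lambda>x. c * \<phi> x) x = euler (\<lambda>x. c * (euler ^^ j) \<phi> x) x"
    unfolding funpow.simps o_apply by (rule euler_cong) (use Suc in \<open>auto intro!: euler_pow_smooth smooth_ball\<close>)
  then show ?case using Suc.prems by (simp add: euler_cmult euler_pow_smooth)
qed auto

lemma flat_add: assumes "flat \<phi>" "flat \<psi>" shows "flat (\<lambda>x. \<phi> x + \<psi> x)"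
proof -
  note s = assms[THEN flat_smooth]
  have "mean ((euler ^^ j) (\<lambda>x. \<phi> x + \<psi> x)) = mean (\<lambda>x. (euler ^^ j) \<phi> x + (euler ^^ j) \<psi> x)" for j
    by (rule mean_cong_K) (rule euler_pow_add[OF s])
  also have "\<dots> j = mean ((euler ^^ j) \<phi>) + mean ((euler ^^ j) \<psi>)" for j
    by (intro mean_add smooth_on_continuous euler_pow_smooth s)
  finally show ?thesis using assms by (simp add: flat_def smooth_ball)
qed

lemma flat_cmult: assumes "flat \<phi>" shows "flat (\<lambda>x. c * \<phi> x)"
proof -
  note s = assms[THEN flat_smooth]
  have "mean ((euler ^^ j) (\<lambda>x. c * \<phi> x)) = mean (\<lambda>x. c * (euler ^^ j) \<phi> x)" for j
    by (rule mean_cong_K) (rule euler_pow_cmult[OF s])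
  then show ?thesis using assms by (simp add: flat_def smooth_ball mean_cmult)
qed

lemma flat_diff: "flat \<phi> \<Longrightarrow> flat \<psi> \<Longrightarrow> flat (\<lambda>x. \<phi> x - \<psi> x)"
  using flat_add[of \<phi> "\<lambda>x. -1 * \<psi> x"] flat_cmult[of \<psi> "-1"] by simp

lemma flat_0: "flat (\<lambda>x. 0)"
proof -
  have "(euler ^^ j) (\<lambda>x. 0) x = (0::real)" if "x \<in> K" for j and x :: 'a
    using euler_pow_cmult[OF smooth_on_const[of K 0] that, of j 0] by simp
  then have "mean ((euler ^^ j) (\<lambda>x::'a. 0)) = 0" for j
    using mean_cong_K[of "(euler ^^ j) (\<lambda>x::'a. 0)" "\<lambda>x. 0"] by (simp add: mean_const)
  then show ?thesis by (simp add: flat_def smooth_ball)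
qed

lemma flat_sum: "(\<And>i. i \<in> I \<Longrightarrow> flat (\<phi> i)) \<Longrightarrow> flat (\<lambda>x. \<Sum>i\<in>I. \<phi> i x)"
  by (induction I rule: infinite_finite_induct) (auto intro: flat_add flat_0)

lemma flat_euler: "flat \<phi> \<Longrightarrow> flat (euler \<phi>)"
  unfolding flat_def by (metis euler_smooth funpow_Suc_right o_apply)

lemma flat_euler_shift: "flat \<phi> \<Longrightarrow> flat (euler_shift c \<phi>)"
  unfolding euler_shift_def by (intro flat_add flat_euler flat_cmult)

lemma flat_mean: "flat \<phi> \<Longrightarrow> mean \<phi> = 0"
  unfolding flat_def by (metis funpow_0)

lemma flat_of_smean_0:
  assumes s: "smooth_on K \<phi>" and z: "\<And>r. r \<in> {0..1} \<Longrightarrow> smean \<phi> r = 0"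
  shows "flat \<phi>"
proof -
  have *: "smean ((euler ^^ j) \<phi>) r = 0" if "r \<in> {0..1}" for j r
    using that
  proof (induction j arbitrary: r)
    case (Suc j)
    have "dd {0..1} 1 (smean ((euler ^^ j) \<phi>)) r = dd {0..1} 1 (\<lambda>r. 0) r"
      by (rule dd_cong[OF convex_body_unit_interval Suc.prems smean_smooth[OF euler_pow_smooth[OF s]]]) (rule Suc.IH)
    then show ?case
      using smean_euler[OF euler_pow_smooth[OF s] Suc.prems] dd_const[OF convex_body_unit_interval Suc.prems] by simp
  qed (use z in auto)
  have "smean \<psi> 1 = mean \<psi>" for \<psi> :: "'a \<Rightarrow> real" by (simp add: smean_def)
  then show ?thesis unfolding flat_def using s *[of 1] by (metis atLeastAtMost_iff order_refl zero_le_one)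
qed

lemma flat_of_smean_eq:
  assumes "smooth_on K \<phi>" "smooth_on K \<psi>" "\<And>r. r \<in> {0..1} \<Longrightarrow> smean \<phi> r = smean \<psi> r"
  shows "flat (\<lambda>x. \<phi> x - \<psi> x)"
proof (rule flat_of_smean_0)
  fix r :: real assume r: "r \<in> {0..1}"
  have "smean (\<lambda>x. \<phi> x - \<psi> x) r = smean \<phi> r - smean \<psi> r"
    unfolding smean_def by (intro mean_diff cont_ray smooth_on_continuous assms r)
  then show "smean (\<lambda>x. \<phi> x - \<psi> x) r = 0" using assms(3)[OF r] by simp
qed (intro smooth_ball assms)

text \<open>
Integration by parts on all spheres near the unit sphere at once. It lets a derivative of \<open>\<phi>\<close> be traded
for a factor \<open>x \<bullet> b\<close> and a radial derivative, modulo flat functions.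
\<close>
lemma flat_divergence:
  fixes \<phi> :: "'a::euclidean_space \<Rightarrow> real"
  assumes s: "smooth_on K \<phi>"
  shows "flat (\<lambda>x. euler_shift (real DIM('a) - 2) (\<lambda>x. (x \<bullet> b) * \<phi> x) x - (x \<bullet> x) * dd K b \<phi> x)"
proof (rule flat_of_smean_eq)
  show "smean (euler_shift (real DIM('a) - 2) (\<lambda>x. x \<bullet> b * \<phi> x)) r = smean (\<lambda>x. x \<bullet> x * dd K b \<phi> x) r"
    if "r \<in> {0..1}" for r
    using smean_divergence[OF s that, of b] by (simp add: euler_shift_def[abs_def])
qed (intro smooth_ball s)+

lemma euler_shift_pow_inner_self:
  assumes s: "smooth_on K \<phi>"
  shows "smooth_on K ((euler_shift (c + 2) ^^ j) \<phi>) \<and>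
    (\<forall>x\<in>K. (euler_shift c ^^ j) (\<lambda>x. (x \<bullet> x) * \<phi> x) x = (x \<bullet> x) * (euler_shift (c + 2) ^^ j) \<phi> x)"
proof (induction j)
  case (Suc j)
  then have sj: "smooth_on K ((euler_shift (c + 2) ^^ j) \<phi>)" by simp
  have "(euler_shift c ^^ Suc j) (\<lambda>x. (x \<bullet> x) * \<phi> x) x = (x \<bullet> x) * (euler_shift (c + 2) ^^ Suc j) \<phi> x" if x: "x \<in> K" for x
  proof -
    have smooth_ball': "smooth_on K (\<lambda>x. (x \<bullet> x) * (euler_shift (c + 2) ^^ j) \<phi> x)" by (intro smooth_ball sj)
    have "(euler_shift c ^^ Suc j) (\<lambda>x. (x \<bullet> x) * \<phi> x) x = euler_shift c (\<lambda>x. (x \<bullet> x) * (euler_shift (c + 2) ^^ j) \<phi> x) x"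
      unfolding funpow.simps o_apply
      by (rule euler_shift_cong[symmetric, OF smooth_ball' _ x]) (use Suc in auto)
    then show ?thesis using euler_shift_inner_self[OF sj x] by simp
  qed
  then show ?case using sj by (auto intro: smooth_ball)
qed (use s in auto)

lemma mean_inner_self: "mean (\<lambda>x. (x \<bullet> x) * \<phi> x) = mean \<phi>"
  by (rule mean_cong_sphere) (auto simp: norm_eq_1)

lemma flat_euler_shift_pow: "flat \<phi> \<Longrightarrow> flat ((euler_shift c ^^ j) \<phi>)"
  by (induction j) (auto intro: flat_euler_shift)

lemma euler_shift_0: "euler_shift 0 = euler"
  by (auto simp: euler_shift_def fun_eq_iff)

text \<open>
On averages, the factor \<open>x \<bullet> x\<close> is \<open>r^2\<close>, and \<open>r d/dr (r^2 u) = r^2 (r d/dr + 2) u\<close>. So this factor shifts the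
constants in the operators and it has the value \<open>1\<close> on the unit sphere.
\<close>
lemma flat_inner_self_iff:
  assumes s: "smooth_on K \<phi>" shows "flat (\<lambda>x. (x \<bullet> x) * \<phi> x) \<longleftrightarrow> flat \<phi>"
proof
  assume f: "flat \<phi>"
  have "mean ((euler ^^ j) (\<lambda>x. (x \<bullet> x) * \<phi> x)) = 0" for j
  proof -
    have "mean ((euler ^^ j) (\<lambda>x. (x \<bullet> x) * \<phi> x)) = mean (\<lambda>x. (x \<bullet> x) * (euler_shift 2 ^^ j) \<phi> x)"
    proof (rule mean_cong_K)
      fix x :: 'a assume "x \<in> K"
      with euler_shift_pow_inner_self[OF s, of j 0] have "(euler_shift 0 ^^ j) (\<lambda>x. (x \<bullet> x) * \<phi> x) x = (x \<bullet> x) * (euler_shift (0 + 2) ^^ j) \<phi> x" by blast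
      then show "(euler ^^ j) (\<lambda>x. (x \<bullet> x) * \<phi> x) x = (x \<bullet> x) * (euler_shift 2 ^^ j) \<phi> x" by (simp only: euler_shift_0 add_0)
    qed
    also have "\<dots> = 0" unfolding mean_inner_self by (rule flat_mean[OF flat_euler_shift_pow[OF f]])
    finally show ?thesis .
  qed
  then show "flat (\<lambda>x. (x \<bullet> x) * \<phi> x)" unfolding flat_def by (intro conjI allI smooth_ball s)
next
  assume f: "flat (\<lambda>x. (x \<bullet> x) * \<phi> x)"
  have "mean ((euler ^^ j) \<phi>) = 0" for j
  proof -
    have "mean ((euler ^^ j) \<phi>) = mean (\<lambda>x. (x \<bullet> x) * (euler_shift 0 ^^ j) \<phi> x)" by (simp add: mean_inner_self euler_shift_0)
    also have "\<dots> = mean ((euler_shift (-2) ^^ j) (\<lambda>x. (x \<bullet> x) * \<phi> x))"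
      by (rule mean_cong_K) (use euler_shift_pow_inner_self[OF s, of j "-2"] in simp)
    also have "\<dots> = 0" by (rule flat_mean[OF flat_euler_shift_pow[OF f]])
    finally show ?thesis .
  qed
  then show "flat \<phi>" unfolding flat_def using s by simp
qed

text \<open>
The product of the operators \<open>r d/dr + c - 2i\<close> for \<open>i < m\<close>. Its kernel consists of the combinations of the
powers \<open>r^(2i-c)\<close>; with \<open>c = n - 2\<close> these are the powers that integration by parts leaves
undetermined.
\<close>
fun euler_shifts :: "nat \<Rightarrow> real \<Rightarrow> ('a::euclidean_space \<Rightarrow> real) \<Rightarrow> 'a \<Rightarrow> real" where
  "euler_shifts 0 c \<phi> = \<phi>"
| "euler_shifts (Suc m) c \<phi> = euler_shifts m (c - 2) (euler_shift c \<phi>)"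

lemma euler_shifts_Suc: "euler_shifts (Suc m) c \<phi> = euler_shift (c - 2 * real m) (euler_shifts m c \<phi>)"
proof (induction m arbitrary: c \<phi>)
  case (Suc m)
  have "euler_shifts (Suc (Suc m)) c \<phi> = euler_shifts (Suc m) (c - 2) (euler_shift c \<phi>)" by simp
  also have "\<dots> = euler_shift (c - 2 - 2 * real m) (euler_shifts m (c - 2) (euler_shift c \<phi>))" by (rule Suc)
  finally show ?case by (simp add: algebra_simps)
qed auto

lemma euler_shifts_smooth: "smooth_on K \<phi> \<Longrightarrow> smooth_on K (euler_shifts m c \<phi>)"
  by (induction m arbitrary: c \<phi>) (auto intro: smooth_ball)

lemma euler_shifts_flat: "flat \<phi> \<Longrightarrow> flat (euler_shifts m c \<phi>)"
  by (induction m arbitrary: c \<phi>) (auto intro: flat_euler_shift)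

lemma euler_shifts_cong:
  "smooth_on K \<phi> \<Longrightarrow> (\<And>y. y \<in> K \<Longrightarrow> \<phi> y = \<psi> y) \<Longrightarrow> x \<in> K \<Longrightarrow> euler_shifts m c \<phi> x = euler_shifts m c \<psi> x"
proof (induction m arbitrary: c \<phi> \<psi>)
  case (Suc m)
  show ?case unfolding euler_shifts.simps
    by (rule Suc.IH) (use Suc.prems in \<open>auto intro: euler_shift_smooth euler_shift_cong\<close>)
qed auto

lemma euler_shifts_diff:
  "smooth_on K \<phi> \<Longrightarrow> smooth_on K \<psi> \<Longrightarrow> x \<in> K \<Longrightarrow> euler_shifts m c (\<lambda>x. \<phi> x - \<psi> x) x = euler_shifts m c \<phi> x - euler_shifts m c \<psi> x"
proof (induction m arbitrary: c \<phi> \<psi>)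
  case (Suc m)
  have "euler_shifts (Suc m) c (\<lambda>x. \<phi> x - \<psi> x) x = euler_shifts m (c - 2) (\<lambda>x. euler_shift c \<phi> x - euler_shift c \<psi> x) x"
    unfolding euler_shifts.simps by (rule euler_shifts_cong) (use Suc.prems in \<open>auto intro!: smooth_ball euler_shift_diff\<close>)
  then show ?case using Suc by (simp add: smooth_ball)
qed auto

lemma euler_shifts_flat_mod:
  assumes "flat (\<lambda>x. \<phi> x - \<psi> x)" "smooth_on K \<phi>" "smooth_on K \<psi>" "flat (euler_shifts m c \<psi>)"
  shows "flat (euler_shifts m c \<phi>)"
proof -
  have "flat (\<lambda>x. euler_shifts m c \<phi> x - euler_shifts m c \<psi> x)"
    by (rule flat_cong[OF euler_shifts_flat[OF assms(1), of m c]]) (rule euler_shifts_diff[OF assms(2,3)])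
  from flat_add[OF this assms(4)] show ?thesis by simp
qed

lemma euler_shifts_euler_shift_commute:
  "smooth_on K \<phi> \<Longrightarrow> x \<in> K \<Longrightarrow> euler_shifts m c (euler_shift d \<phi>) x = euler_shift d (euler_shifts m c \<phi>) x"
proof (induction m arbitrary: c \<phi>)
  case (Suc m)
  have "euler_shifts (Suc m) c (euler_shift d \<phi>) x = euler_shifts m (c - 2) (euler_shift d (euler_shift c \<phi>)) x"
    unfolding euler_shifts.simps by (rule euler_shifts_cong) (use Suc.prems in \<open>auto intro!: smooth_ball euler_shift_commute\<close>)
  then show ?case using Suc by (simp add: smooth_ball)
qed auto

lemma euler_shifts_inner_self:
  "smooth_on K \<phi> \<Longrightarrow> x \<in> K \<Longrightarrow> euler_shifts m c (\<lambda>x. (x \<bullet> x) * \<phi> x) x = (x \<bullet> x) * euler_shifts m (c + 2) \<phi> x"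
proof (induction m arbitrary: c \<phi>)
  case (Suc m)
  have "euler_shifts (Suc m) c (\<lambda>x. (x \<bullet> x) * \<phi> x) x = euler_shifts m (c - 2) (\<lambda>x. (x \<bullet> x) * euler_shift (c + 2) \<phi> x) x"
    unfolding euler_shifts.simps by (rule euler_shifts_cong) (use Suc.prems in \<open>auto intro!: smooth_ball euler_shift_inner_self\<close>)
  then show ?case using Suc by (simp add: smooth_ball)
qed auto

lemma flat_euler_shifts_inner_self_iff:
  assumes "smooth_on K \<phi>"
  shows "flat (euler_shifts m c (\<lambda>x. (x \<bullet> x) * \<phi> x)) \<longleftrightarrow> flat (euler_shifts m (c + 2) \<phi>)"
proof -
  have "flat (euler_shifts m c (\<lambda>x. (x \<bullet> x) * \<phi> x)) \<longleftrightarrow> flat (\<lambda>x. (x \<bullet> x) * euler_shifts m (c + 2) \<phi> x)"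
    using euler_shifts_inner_self[OF assms, of _ m c] flat_cong by (metis (no_types, lifting))
  then show ?thesis using flat_inner_self_iff[OF euler_shifts_smooth[OF assms]] by blast
qed

text \<open>
Modulo flat functions, \<open>v\<close> is an eigenvector of the Euler operator with eigenvalue \<open>l\<close>, so every
factor of the product acts on it as a number.
\<close>
lemma euler_shifts_eigen:
  assumes v: "smooth_on K v" and e: "flat (euler_shift (- l) v)"
  shows "flat (\<lambda>x. euler_shifts m c v x - (\<Prod>i<m. l + c - 2 * real i) * v x)"
proof (induction m)
  case 0 then show ?case using flat_0 by simp
next
  case (Suc m)
  define C where "C = (\<Prod>i<m. l + c - 2 * real i)"
  have "flat (euler_shift (c - 2 * real m) (\<lambda>x. euler_shifts m c v x - C * v x))"
    using flat_euler_shift[OF Suc] by (simp add: C_def)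
  then have "flat (\<lambda>x. euler_shift (c - 2 * real m) (\<lambda>x. euler_shifts m c v x - C * v x) x + C * euler_shift (- l) v x)"
    by (intro flat_add flat_cmult e)
  then show ?case
  proof (rule flat_cong)
    fix x :: 'a assume x: "x \<in> K"
    show "euler_shift (c - 2 * real m) (\<lambda>x. euler_shifts m c v x - C * v x) x + C * euler_shift (- l) v x =
      euler_shifts (Suc m) c v x - (\<Prod>i<Suc m. l + c - 2 * real i) * v x"
      unfolding euler_shifts_Suc
      using euler_shift_diff[OF euler_shifts_smooth[OF v] smooth_on_cmult[OF v] x, of "c - 2 * real m" m c C] euler_cmult[OF v x, of C]
      by (simp add: euler_shift_def C_def algebra_simps)
  qed
qed

text \<open>
A first-order linear equation: the solution is determined by its value at \<open>r = 1\<close>.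
\<close>
lemma flat_of_euler_shift:
  assumes s: "smooth_on K u" and f: "flat (euler_shift c u)" and m: "mean u = 0"
  shows "flat u"
proof -
  have "mean ((euler ^^ j) u) = 0" for j
  proof (induction j)
    case 0 then show ?case using m by simp
  next
    case (Suc j)
    have "mean ((euler ^^ j) (euler_shift c u)) = mean (\<lambda>x. (euler ^^ j) (euler u) x + c * (euler ^^ j) u x)"
    proof (rule mean_cong_K)
      fix x :: 'a assume x: "x \<in> K"
      show "(euler ^^ j) (euler_shift c u) x = (euler ^^ j) (euler u) x + c * (euler ^^ j) u x"
        unfolding euler_shift_def[abs_def]
        using euler_pow_add[OF euler_smooth[OF s] smooth_on_cmult[OF s] x] euler_pow_cmult[OF s x] by simp
    qed
    also have "\<dots> = mean ((euler ^^ j) (euler u)) + c * mean ((euler ^^ j) u)"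
      unfolding mean_cmult[symmetric]
      by (intro mean_add smooth_on_continuous euler_pow_smooth euler_smooth s smooth_on_cmult)
    finally have "mean ((euler ^^ j) (euler u)) = 0" using f Suc by (simp add: flat_def)
    then show ?case by (metis funpow_Suc_right o_apply)
  qed
  then show ?thesis using s by (simp add: flat_def)
qed

text \<open>
The recursion fits inductions in which one factor \<open>x \<bullet> b\<close> is
removed by an integration by parts.
\<close>
fun hom_poly :: "nat \<Rightarrow> ('a::euclidean_space \<Rightarrow> real) \<Rightarrow> bool" where
  "hom_poly 0 p \<longleftrightarrow> (\<exists>c. p = (\<lambda>x. c))"
| "hom_poly (Suc k) p \<longleftrightarrow> (\<exists>q. (\<forall>b\<in>Basis. hom_poly k (q b)) \<and> p = (\<lambda>x. \<Sum>b\<in>Basis. (x \<bullet> b) * q b x))"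

lemma hom_poly_smooth: "hom_poly k p \<Longrightarrow> smooth_on X p"
  by (induction k arbitrary: p) (auto intro!: smooth_on_const smooth_on_sum smooth_on_mult smooth_on_inner)

lemma hom_poly_0: "hom_poly k (\<lambda>x. 0)"
  by (induction k) (auto intro!: exI[of _ "\<lambda>b x. 0"])

lemma hom_poly_add: "hom_poly k p \<Longrightarrow> hom_poly k q \<Longrightarrow> hom_poly k (\<lambda>x. p x + q x)"
proof (induction k arbitrary: p q)
  case 0 then show ?case by auto
next
  case (Suc k)
  obtain p' where p': "\<forall>b\<in>Basis. hom_poly k (p' b)" "p = (\<lambda>x. \<Sum>b\<in>Basis. (x \<bullet> b) * p' b x)" using Suc.prems by auto
  obtain q' where q': "\<forall>b\<in>Basis. hom_poly k (q' b)" "q = (\<lambda>x. \<Sum>b\<in>Basis. (x \<bullet> b) * q' b x)" using Suc.prems by auto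
  show ?case unfolding hom_poly.simps
    by (rule exI[of _ "\<lambda>b x. p' b x + q' b x"]) (use p' q' Suc.IH in \<open>auto simp: sum.distrib distrib_left\<close>)
qed

lemma hom_poly_cmult: "hom_poly k p \<Longrightarrow> hom_poly k (\<lambda>x. c * p x)"
proof (induction k arbitrary: p)
  case 0 then show ?case by auto
next
  case (Suc k)
  obtain p' where p': "\<forall>b\<in>Basis. hom_poly k (p' b)" "p = (\<lambda>x. \<Sum>b\<in>Basis. (x \<bullet> b) * p' b x)" using Suc.prems by auto
  show ?case unfolding hom_poly.simps
    by (rule exI[of _ "\<lambda>b x. c * p' b x"]) (use p' Suc.IH in \<open>auto simp: sum_distrib_left mult_ac\<close>)
qed

lemma hom_poly_sum: "(\<And>i. i \<in> I \<Longrightarrow> hom_poly k (p i)) \<Longrightarrow> hom_poly k (\<lambda>x. \<Sum>i\<in>I. p i x)"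
  by (induction I rule: infinite_finite_induct) (auto intro: hom_poly_0 hom_poly_add)

lemma hom_poly_inner_mult: "hom_poly k p \<Longrightarrow> hom_poly (Suc k) (\<lambda>x. (x \<bullet> b) * p x)"
proof -
  assume p: "hom_poly k p"
  have "(\<lambda>x. (x \<bullet> b) * p x) = (\<lambda>x. \<Sum>d\<in>Basis. (x \<bullet> d) * ((b \<bullet> d) * p x))"
    by (rule ext) (simp add: euclidean_inner[of _ b] sum_distrib_right mult.assoc)
  then show ?thesis unfolding hom_poly.simps
    by (intro exI[of _ "\<lambda>d x. (b \<bullet> d) * p x"]) (auto intro: hom_poly_cmult p)
qed

lemma hom_poly_scale: "hom_poly k p \<Longrightarrow> p (r *\<^sub>R x) = r ^ k * p x"
  by (induction k arbitrary: p) (auto simp: sum_distrib_left mult_ac intro!: sum.cong)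

text \<open>
For \<open>k = 0\<close> the truncated subtraction gives degree \<open>0\<close> again, so the second conjunct states separately that
the derivative of a constant is zero. This case ends the inductions on the degree.
\<close>
lemma hom_poly_dd:
  assumes "hom_poly k p"
  shows "\<exists>q. hom_poly (k - 1) q \<and> (k = 0 \<longrightarrow> q = (\<lambda>x. 0)) \<and> (\<forall>x\<in>K. dd K v p x = q x)"
  using assms
proof (induction k arbitrary: p)
  case 0
  then obtain c where "p = (\<lambda>x. c)" by auto
  then show ?case using dd_const[OF convex_body_cball] by (intro exI[of _ "\<lambda>x. 0"]) auto
next
  case (Suc k)
  obtain q where q: "\<forall>b\<in>Basis. hom_poly k (q b)" "p = (\<lambda>x. \<Sum>b\<in>Basis. (x \<bullet> b) * q b x)" using Suc.prems by auto
  have "\<forall>b\<in>Basis. \<exists>q'. hom_poly (k - 1) q' \<and> (k = 0 \<longrightarrow> q' = (\<lambda>x. 0)) \<and> (\<forall>x\<in>K. dd K v (q b) x = q' x)"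
    using Suc.IH q by blast
  from bchoice[OF this] obtain q' where q': "\<And>b. b \<in> Basis \<Longrightarrow> hom_poly (k - 1) (q' b)"
    "\<And>b. b \<in> Basis \<Longrightarrow> k = 0 \<Longrightarrow> q' b = (\<lambda>x. 0)" "\<And>b x. b \<in> Basis \<Longrightarrow> x \<in> K \<Longrightarrow> dd K v (q b) x = q' b x" by blast
  have sq: "smooth_on K (q b)" if "b \<in> Basis" for b using q(1) that hom_poly_smooth by blast
  have "hom_poly k (\<lambda>x. \<Sum>b\<in>Basis. (x \<bullet> b) * q' b x)"
  proof (cases k)
    case 0 then show ?thesis using q'(2) by auto
  next
    case (Suc l) then show ?thesis using q'(1) by auto
  qed
  moreover have "hom_poly k (\<lambda>x. \<Sum>b\<in>Basis. (v \<bullet> b) * q b x)"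
    using q(1) by (intro hom_poly_sum hom_poly_cmult) auto
  ultimately have "hom_poly k (\<lambda>x. (\<Sum>b\<in>Basis. (v \<bullet> b) * q b x) + (\<Sum>b\<in>Basis. (x \<bullet> b) * q' b x))"
    using hom_poly_add by blast
  moreover have "dd K v p x = (\<Sum>b\<in>Basis. (v \<bullet> b) * q b x) + (\<Sum>b\<in>Basis. (x \<bullet> b) * q' b x)" if x: "x \<in> K" for x
  proof -
    have "dd K v p x = (\<Sum>b\<in>Basis. dd K v (\<lambda>x. (x \<bullet> b) * q b x) x)"
      unfolding q(2) by (rule dd_sum[OF convex_body_cball x]) (intro smooth_ball sq)
    then show ?thesis by (simp add: dd_inner_mult[OF convex_body_cball x sq] q'(3)[OF _ x] sum.distrib)
  qed
  ultimately show ?case by (intro exI[of _ "\<lambda>x. (\<Sum>b\<in>Basis. (v \<bullet> b) * q b x) + (\<Sum>b\<in>Basis. (x \<bullet> b) * q' b x)"]) auto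
qed

lemma hom_poly_euler:
  assumes "hom_poly k p" "x \<in> K" shows "euler p x = real k * p x"
  using assms
proof (induction k arbitrary: p)
  case 0
  then obtain c where "p = (\<lambda>x. c)" by auto
  then show ?case using dd_const[OF convex_body_cball 0(2)] by (simp add: euler_def)
next
  case (Suc k)
  obtain q where q: "\<forall>b\<in>Basis. hom_poly k (q b)" "p = (\<lambda>x. \<Sum>b\<in>Basis. (x \<bullet> b) * q b x)" using Suc.prems by auto
  have sq: "smooth_on K (q b)" if "b \<in> Basis" for b using q(1) that hom_poly_smooth by blast
  have "euler p x = (\<Sum>b\<in>Basis. euler (\<lambda>x. (x \<bullet> b) * q b x) x)"
    unfolding q(2) by (rule euler_sum[OF _ Suc.prems(2)]) (intro smooth_ball sq)
  also have "\<dots> = (\<Sum>b\<in>Basis. real (Suc k) * ((x \<bullet> b) * q b x))"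
    by (rule sum.cong) (use Suc q in \<open>auto simp: euler_mult smooth_ball sq euler_inner algebra_simps\<close>)
  finally show ?case by (simp add: q(2) sum_distrib_left)
qed


definition lap :: "('a::euclidean_space \<Rightarrow> real) \<Rightarrow> 'a \<Rightarrow> real" where
  "lap h x = (\<Sum>b\<in>Basis. dd K b (dd K b h) x)"

lemma lap_smooth: "smooth_on K h \<Longrightarrow> smooth_on K (lap h)"
  unfolding lap_def by (intro smooth_ball)

text \<open>
If all derivatives of \<open>h\<close> have flat averages, then the averages of \<open>p h\<close> are, modulo flat functions,
combinations of the powers \<open>r^(2j-n+2)\<close> with \<open>j < k\<close>. By \<open>flat_divergence\<close>, applying \<open>r d/dr + n - 2\<close> to the
average of \<open>x\<^sub>b q h\<close> gives \<open>r^2\<close> times the average of the derivative of \<open>q h\<close>, which involves polynomials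
of lower degree.
\<close>
lemma flat_euler_shifts_hom_poly:
  fixes F :: "('a::euclidean_space \<Rightarrow> real) set"
  assumes fl: "\<And>h. h \<in> F \<Longrightarrow> flat h" and cl: "\<And>h b. h \<in> F \<Longrightarrow> b \<in> Basis \<Longrightarrow> dd K b h \<in> F"
    and "hom_poly k p" "h \<in> F"
  shows "flat (euler_shifts k (real DIM('a) - 2) (\<lambda>x. p x * h x))"
  using assms(3,4)
proof (induction k arbitrary: p h rule: less_induct)
  case (less k)
  define n where "n = real DIM('a)"
  have sh: "smooth_on K h" using fl[OF less.prems(2)] flat_smooth by blast
  show ?case
  proof (cases k)
    case 0
    then obtain c where "p = (\<lambda>x. c)" using less.prems by auto
    then show ?thesis using 0 fl[OF less.prems(2)] by (simp add: flat_cmult)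
  next
    case (Suc l)
    obtain q where q: "\<forall>b\<in>Basis. hom_poly l (q b)" "p = (\<lambda>x. \<Sum>b\<in>Basis. (x \<bullet> b) * q b x)"
      using less.prems Suc by auto
    have one: "flat (euler_shifts l (n - 4) (euler_shift (n - 2) (\<lambda>x. (x \<bullet> b) * (q b x * h x))))" if b: "b \<in> Basis" for b
    proof -
      have sq: "smooth_on K (q b)" using q(1) b hom_poly_smooth by blast
      define v where "v = dd K b (\<lambda>x. q b x * h x)"
      have sqh: "smooth_on K (\<lambda>x. q b x * h x)" by (intro smooth_ball sq sh)
      have sv: "smooth_on K v" unfolding v_def by (intro smooth_ball sqh)
      obtain q' where q': "hom_poly (l - 1) q'" "l = 0 \<longrightarrow> q' = (\<lambda>x. 0)" "\<forall>x\<in>K. dd K b (q b) x = q' x"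
        using hom_poly_dd[of l "q b" b] q(1) b by blast
      have f1: "flat (euler_shifts l (n - 2) (\<lambda>x. q b x * dd K b h x))"
        using less.IH[of l "q b" "dd K b h"] q(1) b cl[OF less.prems(2) b] Suc by (simp add: n_def)
      have f2: "flat (euler_shifts l (n - 2) (\<lambda>x. q' x * h x))"
      proof (cases l)
        case 0
        then show ?thesis using q'(2) flat_0 by simp
      next
        case (Suc l')
        have "flat (euler_shifts l' (n - 2) (\<lambda>x. q' x * h x))"
          using less.IH[of l' q' h] q'(1) less.prems(2) \<open>k = Suc l\<close> Suc by (simp add: n_def)
        then show ?thesis unfolding Suc euler_shifts_Suc by (rule flat_euler_shift)
      qed
      have sq': "smooth_on K q'" using q'(1) hom_poly_smooth by blast
      have v: "v x = q b x * dd K b h x + q' x * h x" if "x \<in> K" for x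
        unfolding v_def dd_mult[OF convex_body_cball that sq sh] using q'(3) that by simp
      have "flat (\<lambda>x. v x - q b x * dd K b h x - q' x * h x)"
        by (rule flat_cong[OF flat_0]) (simp add: v)
      then have "flat (\<lambda>x. (v x - q b x * dd K b h x) - q' x * h x)" .
      from euler_shifts_flat_mod[OF this _ _ f2] have "flat (euler_shifts l (n - 2) (\<lambda>x. v x - q b x * dd K b h x))"
        by (simp add: smooth_ball sv sq sh sq')
      then have "flat (\<lambda>x. euler_shifts l (n - 2) v x - euler_shifts l (n - 2) (\<lambda>x. q b x * dd K b h x) x)"
        by (rule flat_cong) (intro euler_shifts_diff smooth_ball sv sq sh)
      from flat_add[OF this f1] have "flat (euler_shifts l (n - 2) v)" by simp
      then have "flat (euler_shifts l (n - 4) (\<lambda>x. (x \<bullet> x) * v x))"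
        using flat_euler_shifts_inner_self_iff[OF sv, of l "n - 4"] by simp
      moreover have "flat (\<lambda>x. euler_shift (n - 2) (\<lambda>x. (x \<bullet> b) * (q b x * h x)) x - (x \<bullet> x) * v x)"
        using flat_divergence[OF sqh, of b] by (simp add: n_def v_def)
      ultimately show ?thesis
        using euler_shifts_flat_mod[of "euler_shift (n - 2) (\<lambda>x. (x \<bullet> b) * (q b x * h x))" "\<lambda>x. (x \<bullet> x) * v x"]
        by (simp add: smooth_ball sq sh sv)
    qed
    have sT: "smooth_on K (euler_shift (n - 2) (\<lambda>x. (x \<bullet> b) * (q b x * h x)))" if "b \<in> Basis" for b
      using q(1) that hom_poly_smooth by (intro smooth_ball sh) blast
    have lin: "flat (euler_shifts l c (\<lambda>x. \<Sum>b\<in>B. f b x))"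
      if "finite B" "\<And>b. b \<in> B \<Longrightarrow> smooth_on K (f b)" "\<And>b. b \<in> B \<Longrightarrow> flat (euler_shifts l c (f b))"
      for B :: "'a set" and f :: "'a \<Rightarrow> 'a \<Rightarrow> real" and l c
      using that
    proof (induction B rule: finite_induct)
      case empty then show ?case by (auto intro: euler_shifts_flat flat_0)
    next
      case (insert b B)
      have s1: "smooth_on K (f b)" and s2: "smooth_on K (\<lambda>x. \<Sum>b\<in>B. f b x)" using insert by (auto intro: smooth_ball)
      have "flat (\<lambda>x. euler_shifts l c (\<lambda>x. f b x + (\<Sum>b\<in>B. f b x)) x - euler_shifts l c (f b) x)"
      proof (rule flat_cong)
        show "flat (euler_shifts l c (\<lambda>x. \<Sum>b\<in>B. f b x))" using insert by auto
        fix y :: 'a assume y: "y \<in> K"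
        show "euler_shifts l c (\<lambda>x. \<Sum>b\<in>B. f b x) y = euler_shifts l c (\<lambda>x. f b x + (\<Sum>b\<in>B. f b x)) y - euler_shifts l c (f b) y"
          using euler_shifts_diff[OF smooth_on_add[OF s1 s2] s1 y, of l c] by simp
      qed
      from flat_add[OF this, of "euler_shifts l c (f b)"] insert show ?case by simp
    qed
    have sqb: "smooth_on K (\<lambda>x. (x \<bullet> b) * (q b x * h x))" if "b \<in> Basis" for b
      using q(1) that hom_poly_smooth by (intro smooth_ball sh) blast
    have "flat (euler_shifts k (n - 2) (\<lambda>x. \<Sum>b\<in>Basis. (x \<bullet> b) * (q b x * h x)))"
      by (rule lin[OF finite_Basis sqb]) (use one Suc in auto)
    moreover have "(\<lambda>x. p x * h x) = (\<lambda>x. \<Sum>b\<in>Basis. (x \<bullet> b) * (q b x * h x))"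
      unfolding q(2) by (simp add: sum_distrib_right mult.assoc)
    ultimately show ?thesis by (simp add: n_def)
  qed
qed

text \<open>
The second-order operator that the Laplacian induces on averages against \<open>p\<close>. For harmonic \<open>p\<close> this is
the radial Laplacian on the component of \<open>h\<close> of degree \<open>k\<close>, whose indicial roots are \<open>k\<close> and
\<open>2 - n - k\<close>; the averages carry an additional factor \<open>r^k\<close>, which moves them to \<open>2 k\<close> and \<open>2 - n\<close>.
\<close>
lemma flat_lap_hom_poly:
  fixes h :: "'a::euclidean_space \<Rightarrow> real"
  assumes p: "hom_poly k p" and h: "smooth_on K h"
  shows "flat (\<lambda>x. euler_shift (- 2 * real k) (euler_shift (real DIM('a) - 2) (\<lambda>x. p x * h x)) x
    - (x \<bullet> x) * (p x * lap h x - lap p x * h x))"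
proof -
  define n where "n = real DIM('a)"
  have sp: "smooth_on K p" using p hom_poly_smooth by blast
  have sb: "smooth_on K (dd K b p)" "smooth_on K (dd K b h)" for b by (intro smooth_ball sp h)+
  have sph: "smooth_on K (\<lambda>x. p x * h x)" by (intro smooth_ball sp h)
  have d1: "flat (\<lambda>x. euler_shift (n - 2) (\<lambda>x. (x \<bullet> b) * (p x * dd K b h x)) x - (x \<bullet> x) * dd K b (\<lambda>x. p x * dd K b h x) x)" for b
    unfolding n_def by (rule flat_divergence) (intro smooth_ball sp h)
  have d2: "flat (\<lambda>x. euler_shift (n - 2) (\<lambda>x. (x \<bullet> b) * (dd K b p x * h x)) x - (x \<bullet> x) * dd K b (\<lambda>x. dd K b p x * h x) x)" for b
    unfolding n_def by (rule flat_divergence) (intro smooth_ball sp h)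
  have "flat (\<lambda>x. \<Sum>b\<in>Basis. (euler_shift (n - 2) (\<lambda>x. (x \<bullet> b) * (p x * dd K b h x)) x - (x \<bullet> x) * dd K b (\<lambda>x. p x * dd K b h x) x)
      - (euler_shift (n - 2) (\<lambda>x. (x \<bullet> b) * (dd K b p x * h x)) x - (x \<bullet> x) * dd K b (\<lambda>x. dd K b p x * h x) x))"
    by (intro flat_sum flat_diff d1 d2)
  then show ?thesis
  proof (rule flat_cong)
    fix x :: 'a assume x: "x \<in> K"
    have Ts: "(\<Sum>b\<in>Basis. euler_shift (n - 2) (f b) x) = euler_shift (n - 2) (\<lambda>x. \<Sum>b\<in>Basis. f b x) x"
      if "\<And>b. smooth_on K (f b)" for f :: "'a \<Rightarrow> 'a \<Rightarrow> real"
      using that x by (simp add: euler_shift_def euler_sum sum.distrib sum_distrib_left)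
    have e1: "(\<Sum>b\<in>Basis. euler_shift (n - 2) (\<lambda>x. (x \<bullet> b) * (p x * dd K b h x)) x) = euler_shift (n - 2) (\<lambda>x. p x * euler h x) x"
      by (subst Ts, intro smooth_ball sp h) (simp add: euler_def[abs_def] sum_distrib_left mult_ac)
    have e2: "(\<Sum>b\<in>Basis. euler_shift (n - 2) (\<lambda>x. (x \<bullet> b) * (dd K b p x * h x)) x) = euler_shift (n - 2) (\<lambda>x. euler p x * h x) x"
      by (subst Ts, intro smooth_ball sp h) (simp add: euler_def[abs_def] sum_distrib_right mult.assoc mult.left_commute)
    have e3: "euler_shift (n - 2) (\<lambda>x. p x * euler h x) x - euler_shift (n - 2) (\<lambda>x. euler p x * h x) x
        = euler_shift (n - 2) (\<lambda>x. p x * euler h x - euler p x * h x) x"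
      by (rule euler_shift_diff[symmetric]) (intro smooth_ball sp h x)+
    also have "\<dots> = euler_shift (n - 2) (euler_shift (- 2 * real k) (\<lambda>x. p x * h x)) x"
    proof (rule euler_shift_cong[OF _ _ x])
      show "smooth_on K (\<lambda>x. p x * euler h x - euler p x * h x)" by (intro smooth_ball sp h)
      fix y :: 'a assume y: "y \<in> K"
      show "p y * euler h y - euler p y * h y = euler_shift (- 2 * real k) (\<lambda>x. p x * h x) y"
        unfolding euler_shift_def euler_mult[OF sp h y] hom_poly_euler[OF p y] by (simp add: algebra_simps)
    qed
    also have "\<dots> = euler_shift (- 2 * real k) (euler_shift (n - 2) (\<lambda>x. p x * h x)) x"
      by (rule euler_shift_commute[OF sph x])
    finally have e4: "(\<Sum>b\<in>Basis. euler_shift (n - 2) (\<lambda>x. (x \<bullet> b) * (p x * dd K b h x)) x)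
       - (\<Sum>b\<in>Basis. euler_shift (n - 2) (\<lambda>x. (x \<bullet> b) * (dd K b p x * h x)) x)
       = euler_shift (- 2 * real k) (euler_shift (n - 2) (\<lambda>x. p x * h x)) x" unfolding e1 e2 .
    have "(\<Sum>b\<in>Basis. dd K b (\<lambda>x. p x * dd K b h x) x) - (\<Sum>b\<in>Basis. dd K b (\<lambda>x. dd K b p x * h x) x)
       = p x * lap h x - lap p x * h x"
      unfolding dd_mult[OF convex_body_cball x sp sb(2)] dd_mult[OF convex_body_cball x sb(1) h]
      by (simp add: lap_def sum.distrib sum_distrib_left sum_distrib_right)
    then have e5: "(x \<bullet> x) * (\<Sum>b\<in>Basis. dd K b (\<lambda>x. p x * dd K b h x) x) - (x \<bullet> x) * (\<Sum>b\<in>Basis. dd K b (\<lambda>x. dd K b p x * h x) x)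
       = (x \<bullet> x) * (p x * lap h x - lap p x * h x)"
      by (simp add: right_diff_distrib[symmetric])
    show "(\<Sum>b\<in>Basis. (euler_shift (n - 2) (\<lambda>x. (x \<bullet> b) * (p x * dd K b h x)) x - (x \<bullet> x) * dd K b (\<lambda>x. p x * dd K b h x) x)
      - (euler_shift (n - 2) (\<lambda>x. (x \<bullet> b) * (dd K b p x * h x)) x - (x \<bullet> x) * dd K b (\<lambda>x. dd K b p x * h x) x))
      = euler_shift (- 2 * real k) (euler_shift (real DIM('a) - 2) (\<lambda>x. p x * h x)) x - (x \<bullet> x) * (p x * lap h x - lap p x * h x)"
      unfolding sum_subtractf sum_distrib_left[symmetric] n_def[symmetric] using e4 e5 by linarith
  qed
qed

lemma hom_poly_lap:
  assumes "hom_poly k p"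
  shows "\<exists>q. hom_poly (k - 2) q \<and> (k < 2 \<longrightarrow> q = (\<lambda>x. 0)) \<and> (\<forall>x\<in>K. lap p x = q x)"
proof -
  have "\<exists>q. hom_poly (k - 2) q \<and> (k < 2 \<longrightarrow> q = (\<lambda>x. 0)) \<and> (\<forall>x\<in>K. dd K b (dd K b p) x = q x)" for b
  proof -
    have sp: "smooth_on K p" using assms hom_poly_smooth by blast
    obtain q1 where q1: "hom_poly (k - 1) q1" "k = 0 \<longrightarrow> q1 = (\<lambda>x. 0)" "\<forall>x\<in>K. dd K b p x = q1 x"
      using hom_poly_dd[OF assms, of b] by blast
    obtain q2 where q2: "hom_poly (k - 1 - 1) q2" "k - 1 = 0 \<longrightarrow> q2 = (\<lambda>x. 0)" "\<forall>x\<in>K. dd K b q1 x = q2 x"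
      using hom_poly_dd[OF q1(1), of b] by auto
    have "dd K b (dd K b p) x = q2 x" if "x \<in> K" for x
      using dd_cong[OF convex_body_cball that smooth_on_dd[OF convex_body_cball sp], of b q1 b] q1(3) q2(3) that by simp
    then show ?thesis using q2 by (intro exI[of _ q2]) (auto simp: numeral_2_eq_2)
  qed
  then obtain q where q: "\<And>b. hom_poly (k - 2) (q b)" "\<And>b. k < 2 \<Longrightarrow> q b = (\<lambda>x. 0)" "\<And>b x. x \<in> K \<Longrightarrow> dd K b (dd K b p) x = q b x"
    by metis
  show ?thesis
    by (intro exI[of _ "\<lambda>x. \<Sum>b\<in>Basis. q b x"]) (use q in \<open>auto simp: lap_def intro: hom_poly_sum\<close>)
qed

text \<open>
The averages of \<open>p h\<close> are combinations of finitely many powers \<open>r^(2j-n+2)\<close>, by the assumption \<open>fl\<close>. The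
operator of \<open>flat_lap_hom_poly\<close> lowers the highest exponent by two (up to the factor
\<open>r^2\<close>), with a nonzero coefficient if \<open>j > 0\<close>, and maps \<open>p \<Delta>^m h\<close> to \<open>p \<Delta>^(m+1) h\<close>, modulo terms with polynomials
of lower degree. So the highest coefficient shows up as the value at \<open>r = 1\<close> of the average of some
\<open>p \<Delta>^m h\<close>, and this value is zero by the boundary condition.
\<close>
lemma flat_hom_poly_iterated_lap:
  fixes h :: "nat \<Rightarrow> 'a::euclidean_space \<Rightarrow> real"
  assumes n2: "DIM('a) \<ge> 2" and s: "\<And>m. smooth_on K (h m)"
    and step: "\<And>m x. x \<in> K \<Longrightarrow> lap (h m) x = h (Suc m) x"
    and bdry: "\<And>m w. w \<in> sphere 0 1 \<Longrightarrow> h m w = 0"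
    and fl: "\<And>k p m. hom_poly k p \<Longrightarrow> flat (euler_shifts k (real DIM('a) - 2) (\<lambda>x. p x * h m x))"
    and "hom_poly k p"
  shows "flat (\<lambda>x. p x * h m x)"
  using assms(6)
proof (induction k arbitrary: p m rule: less_induct)
  case (less k)
  define n where "n = real DIM('a)"
  have n2': "n \<ge> 2" using n2 by (simp add: n_def)
  have sp: "smooth_on K p" using less.prems hom_poly_smooth by blast
  define u where "u = (\<lambda>m x. p x * h m x)"
  have su: "smooth_on K (u m)" for m unfolding u_def by (intro smooth_ball sp s)
  have low: "flat (\<lambda>x. lap p x * h m x)" for m
  proof -
    obtain q where q: "hom_poly (k - 2) q" "k < 2 \<longrightarrow> q = (\<lambda>x. 0)" "\<forall>x\<in>K. lap p x = q x"
      using hom_poly_lap[OF less.prems] by blast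
    have "flat (\<lambda>x. q x * h m x)"
    proof (cases "k < 2")
      case True then show ?thesis using q(2) flat_0 by simp
    next
      case False then show ?thesis using less.IH[of "k - 2" q m] q(1) by simp
    qed
    then show ?thesis by (rule flat_cong) (use q(3) in simp)
  qed
  have rel: "flat (\<lambda>x. euler_shift (- 2 * real k) (euler_shift (n - 2) (u m)) x - (x \<bullet> x) * u (Suc m) x)" for m
  proof -
    have "flat (\<lambda>x. (x \<bullet> x) * (lap p x * h m x))"
      using flat_inner_self_iff[of "\<lambda>x. lap p x * h m x"] low[of m] flat_smooth by blast
    from flat_diff[OF flat_lap_hom_poly[OF less.prems s[of m]] this]
    show ?thesis
      by (rule flat_cong) (simp add: u_def[abs_def] n_def step algebra_simps)
  qed
  have "flat (u m)" if "j \<le> k" "flat (euler_shifts j (n - 2) (u m))" for j m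
    using that
  proof (induction j arbitrary: m)
    case 0 then show ?case by simp
  next
    case (Suc j)
    define v where "v = euler_shift (n - 2) (u m)"
    have sv: "smooth_on K v" unfolding v_def by (intro smooth_ball su)
    have fv: "flat (euler_shifts j (n - 4) v)" using Suc.prems(2) by (simp add: v_def)
    have "flat (euler_shifts j (n - 4) (euler_shift (- 2 * real k) v))"
      by (rule flat_cong[OF flat_euler_shift[OF fv, of "- 2 * real k"]]) (rule euler_shifts_euler_shift_commute[OF sv, symmetric])
    moreover have "flat (\<lambda>x. (x \<bullet> x) * u (Suc m) x - euler_shift (- 2 * real k) v x)"
      using flat_cmult[OF rel[of m], of "-1"] by (simp add: v_def)
    ultimately have "flat (euler_shifts j (n - 4) (\<lambda>x. (x \<bullet> x) * u (Suc m) x))"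
      using euler_shifts_flat_mod[of "\<lambda>x. (x \<bullet> x) * u (Suc m) x" "euler_shift (- 2 * real k) v"] by (simp add: smooth_ball su sv)
    then have "flat (euler_shifts j (n - 2) (u (Suc m)))"
      using flat_euler_shifts_inner_self_iff[OF su, of j "n - 4"] by simp
    then have "flat (u (Suc m))" using Suc by simp
    then have "flat (\<lambda>x. (x \<bullet> x) * u (Suc m) x)" using flat_inner_self_iff[OF su] by blast
    from flat_add[OF rel[of m] this] have ev: "flat (euler_shift (- (2 * real k)) v)" by (simp add: v_def)
    define C where "C = (\<Prod>i<j. 2 * real k + (n - 4) - 2 * real i)"
    \<comment> \<open>The eigenvalue \<open>2 k\<close> is not one of the roots of the product, since \<open>j < k\<close> and \<open>n \<ge> 2\<close>.\<close>
    have "C \<noteq> 0"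
    proof -
      have "2 * real k + (n - 4) - 2 * real i > 0" if "i < j" for i
      proof -
        have "real i + 2 \<le> real k" using that Suc.prems(1) by linarith
        then show ?thesis using n2' by linarith
      qed
      then show ?thesis unfolding C_def by (metis (no_types, lifting) finite_lessThan less_irrefl lessThan_iff prod_zero_iff)
    qed
    have "flat (\<lambda>x. euler_shifts j (n - 4) v x - C * v x)" unfolding C_def by (rule euler_shifts_eigen[OF sv ev])
    from flat_diff[OF fv this] have "flat (\<lambda>x. C * v x)" by simp
    from flat_cmult[OF this, of "1 / C"] have "flat v" using \<open>C \<noteq> 0\<close> by simp
    moreover have "mean (u m) = 0"
    proof -
      have "mean (u m) = mean (\<lambda>x::'a. 0)" by (rule mean_cong_sphere) (simp add: u_def bdry)
      then show ?thesis by (simp add: mean_const)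
    qed
    ultimately show ?case unfolding v_def by (rule flat_of_euler_shift[OF su])
  qed
  from this[of k m] fl[OF less.prems, of m] show ?case by (simp add: u_def n_def)
qed

text \<open>
Integration by parts moves the derivative to the polynomial.
\<close>
lemma flat_hom_poly_dd:
  fixes h :: "'a::euclidean_space \<Rightarrow> real"
  assumes s: "smooth_on K h" and G: "\<And>k p. hom_poly k p \<Longrightarrow> flat (\<lambda>x. p x * h x)" and p: "hom_poly k p"
  shows "flat (\<lambda>x. p x * dd K b h x)"
proof -
  have sp: "smooth_on K p" using p hom_poly_smooth by blast
  have sph: "smooth_on K (\<lambda>x. p x * h x)" by (intro smooth_ball sp s)
  obtain q where q: "hom_poly (k - 1) q" "\<forall>x\<in>K. dd K b p x = q x" using hom_poly_dd[OF p, of b] by blast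
  have 1: "flat (\<lambda>x. (x \<bullet> x) * (q x * h x))"
    using flat_inner_self_iff[OF flat_smooth] G[OF q(1)] by blast
  have "flat (\<lambda>x. (x \<bullet> b) * p x * h x)" using G[OF hom_poly_inner_mult[OF p]] .
  then have "flat (\<lambda>x. (x \<bullet> b) * (p x * h x))" by (simp add: mult.assoc)
  from flat_diff[OF flat_euler_shift[OF this, where c="real DIM('a) - 2"] flat_divergence[OF sph, of b]]
  have "flat (\<lambda>x. (x \<bullet> x) * dd K b (\<lambda>x. p x * h x) x)" by simp
  from flat_diff[OF this 1] have "flat (\<lambda>x. (x \<bullet> x) * (p x * dd K b h x))"
  proof (rule flat_cong)
    fix y :: 'a assume y: "y \<in> K"
    show "(y \<bullet> y) * dd K b (\<lambda>x. p x * h x) y - (y \<bullet> y) * (q y * h y) = (y \<bullet> y) * (p y * dd K b h y)"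
      unfolding dd_mult[OF convex_body_cball y sp s] using q(2) y by (simp add: algebra_simps)
  qed
  then show ?thesis using flat_inner_self_iff[of "\<lambda>x. p x * dd K b h x"] sp s by (simp add: smooth_ball)
qed

text \<open>
Polynomials are dense in the continuous functions, so \<open>\<phi>\<close> is orthogonal to itself.
\<close>
lemma mean_hom_poly_zero:
  fixes \<phi> :: "'a::euclidean_space \<Rightarrow> real"
  assumes c: "continuous_on K \<phi>" and z: "\<And>k p. hom_poly k p \<Longrightarrow> mean (\<lambda>x. p x * \<phi> x) = 0"
    and w: "w \<in> sphere 0 1"
  shows "\<phi> w = 0"
proof -
  define N where "N = (\<lambda>\<phi>::'a \<Rightarrow> real. continuous_on K \<phi> \<and> (\<forall>k p. hom_poly k p \<longrightarrow> mean (\<lambda>x. p x * \<phi> x) = 0))"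
  have ch: "continuous_on K p" if "hom_poly k p" for k and p :: "'a \<Rightarrow> real"
    using hom_poly_smooth[OF that] smooth_on_continuous by blast
  have N: "N (\<lambda>x. q x * \<psi> x)" if "real_polynomial_function q" "N \<psi>" for q \<psi>
    using that
  proof (induction q arbitrary: \<psi> rule: real_polynomial_function.induct)
    case (linear f)
    have c\<psi>: "continuous_on K \<psi>" using linear by (simp add: N_def)
    interpret f: bounded_linear f by fact
    have f: "f x = (\<Sum>b\<in>Basis. f b * (x \<bullet> b))" for x
    proof -
      have "f x = f (\<Sum>b\<in>Basis. (x \<bullet> b) *\<^sub>R b)" by (simp only: euclidean_representation)
      then show ?thesis by (simp only: f.sum f.scaleR real_scaleR_def mult.commute)
    qed
    have cf: "continuous_on K (\<lambda>x. f x * \<psi> x)"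
      by (intro continuous_on_mult linear_continuous_on c\<psi>) fact
    have "mean (\<lambda>x. p x * (f x * \<psi> x)) = 0" if p: "hom_poly k p" for k p
    proof -
      have "(\<lambda>x. p x * (f x * \<psi> x)) = (\<lambda>x. \<Sum>b\<in>Basis. f b * ((x \<bullet> b) * p x * \<psi> x))"
      proof
        fix x show "p x * (f x * \<psi> x) = (\<Sum>b\<in>Basis. f b * ((x \<bullet> b) * p x * \<psi> x))"
          by (subst f) (simp add: sum_distrib_left sum_distrib_right mult_ac)
      qed
      then have "mean (\<lambda>x. p x * (f x * \<psi> x)) = (\<Sum>b\<in>Basis. mean (\<lambda>x. f b * ((x \<bullet> b) * p x * \<psi> x)))"
        by (simp only:) (intro mean_sum continuous_intros ch[OF p] c\<psi>)
      also have "\<dots> = 0"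
      proof (intro sum.neutral ballI)
        fix b :: 'a
        have "mean (\<lambda>x. (x \<bullet> b) * p x * \<psi> x) = 0"
          using linear(2) hom_poly_inner_mult[OF p, of b] unfolding N_def by blast
        then show "mean (\<lambda>x. f b * ((x \<bullet> b) * p x * \<psi> x)) = 0" by (simp add: mean_cmult)
      qed
      finally show ?thesis .
    qed
    then show ?case using cf by (auto simp: N_def)
  next
    case (const c)
    then show ?case
      unfolding N_def by (auto simp: mult.left_commute[of _ c] mean_cmult intro!: continuous_intros)
  next
    case (add f g)
    then have *: "N (\<lambda>x. f x * \<psi> x)" "N (\<lambda>x. g x * \<psi> x)" by auto
    have "mean (\<lambda>x. p x * ((f x + g x) * \<psi> x)) = mean (\<lambda>x. p x * (f x * \<psi> x)) + mean (\<lambda>x. p x * (g x * \<psi> x))"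
      if "hom_poly k p" for k p
    proof -
      have "continuous_on K (\<lambda>x. p x * (f x * \<psi> x))" "continuous_on K (\<lambda>x. p x * (g x * \<psi> x))"
        using * unfolding N_def by (intro continuous_on_mult[OF ch[OF that]]; blast)+
      from mean_add[OF this] show ?thesis by (simp add: algebra_simps)
    qed
    moreover have "continuous_on K (\<lambda>x. (f x + g x) * \<psi> x)"
      unfolding distrib_right using * by (intro continuous_on_add) (auto simp: N_def)
    ultimately show ?case using * by (auto simp: N_def)
  next
    case (mult f g)
    then have "N (\<lambda>x. f x * (g x * \<psi> x))" by blast
    then show ?case by (simp add: mult.assoc)
  qed
  have N\<phi>: "N \<phi>" using c z by (simp add: N_def)
  have poly0: "mean (\<lambda>x. q x * \<phi> x) = 0" if "real_polynomial_function q" for q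
  proof -
    have "N (\<lambda>x. q x * \<phi> x)" using N[OF that N\<phi>] .
    then have "mean (\<lambda>x. (\<lambda>x. 1) x * (q x * \<phi> x)) = 0" unfolding N_def using hom_poly.simps(1) by blast
    then show ?thesis by simp
  qed
  have c2: "continuous_on K (\<lambda>x. \<phi> x * \<phi> x)" "continuous_on K (\<lambda>x. \<bar>\<phi> x\<bar>)" by (intro continuous_intros c)+
  have "mean (\<lambda>x. \<phi> x * \<phi> x) \<le> e * mean (\<lambda>x. \<bar>\<phi> x\<bar>)" if "e > 0" for e
  proof -
    obtain q where q: "real_polynomial_function q" "\<And>x. x \<in> K \<Longrightarrow> \<bar>\<phi> x - q x\<bar> < e"
      using Stone_Weierstrass_real_polynomial_function[OF compact_cball c \<open>e > 0\<close>] by blast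
    have cq: "continuous_on K q"
      using q(1) continuous_on_polymonial_function real_polynomial_function_eq by blast
    have "mean (\<lambda>x. \<phi> x * \<phi> x) = mean (\<lambda>x. \<phi> x * \<phi> x - q x * \<phi> x)"
      using mean_diff[OF c2(1) continuous_on_mult[OF cq c]] poly0[OF q(1)] by simp
    also have "\<dots> \<le> mean (\<lambda>x. e * \<bar>\<phi> x\<bar>)"
    proof (rule mean_mono)
      fix w :: 'a assume "w \<in> sphere 0 1"
      then have "\<bar>\<phi> w - q w\<bar> \<le> e" using q(2)[of w] by auto
      then have "\<bar>(\<phi> w - q w) * \<phi> w\<bar> \<le> e * \<bar>\<phi> w\<bar>" unfolding abs_mult by (rule mult_right_mono) simp
      then show "\<phi> w * \<phi> w - q w * \<phi> w \<le> e * \<bar>\<phi> w\<bar>" by (simp add: left_diff_distrib)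
    qed (intro continuous_intros c cq)+
    finally show ?thesis by (simp add: mean_cmult)
  qed
  note bound = this
  have "mean (\<lambda>x. \<phi> x * \<phi> x) \<le> 0"
  proof (rule ccontr)
    assume "\<not> ?thesis"
    then have pos: "mean (\<lambda>x. \<phi> x * \<phi> x) > 0" by simp
    have A: "mean (\<lambda>x. \<bar>\<phi> x\<bar>) \<ge> 0"
      using mean_mono[OF continuous_on_const c2(2), of 0] by (simp add: mean_const)
    \<comment> \<open>The added \<open>1\<close> keeps the denominator positive if the mean of \<open>\<bar>\<phi>\<bar>\<close> vanishes.\<close>
    define e where "e = mean (\<lambda>x. \<phi> x * \<phi> x) / (2 * (mean (\<lambda>x. \<bar>\<phi> x\<bar>) + 1))"
    have "e > 0" using pos A by (simp add: e_def)
    have "e * (mean (\<lambda>x. \<bar>\<phi> x\<bar>) + 1) = mean (\<lambda>x. \<phi> x * \<phi> x) / 2" using A by (simp add: e_def field_simps)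
    then show False using bound[OF \<open>e > 0\<close>] \<open>e > 0\<close> pos by (simp add: distrib_left)
  qed
  moreover have "mean (\<lambda>x. \<phi> x * \<phi> x) \<ge> 0"
    using mean_mono[OF continuous_on_const c2(1), of 0] by (simp add: mean_const)
  ultimately have "\<phi> w * \<phi> w = 0" using mean_eq_0_imp[OF c2(1) _ _ w] by force
  then show ?thesis by simp
qed

section \<open>Solutions in the closed cylinder\<close>

lemma smean_inner_self: "smean (\<lambda>x. (x \<bullet> x) * \<phi> x) r = r\<^sup>2 * smean \<phi> r"
  unfolding smean_def mean_cmult[symmetric]
  by (rule mean_cong_sphere) (auto simp: norm_eq_1 power2_eq_square)

text \<open>
The spherical mean intertwines the Laplacian with its radial part: sum \<open>smean_divergence\<close> over the
partial derivatives of \<open>\<phi>\<close>.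
\<close>
lemma smean_lap:
  fixes \<phi> :: "'a::euclidean_space \<Rightarrow> real"
  assumes s: "smooth_on K \<phi>" and r: "r \<in> {0..1}"
  shows "r * dd {0..1} 1 (dd {0..1} 1 (smean \<phi>)) r + (real DIM('a) - 1) * dd {0..1} 1 (smean \<phi>) r = r * smean (lap \<phi>) r"
proof (rule eq_of_eq_on_interior[OF convex_body_unit_interval _ _ _ r])
  let ?I = "{0..1::real}"
  note fI = convex_body_unit_interval
  have sM: "smooth_on ?I (smean \<phi>)" by (rule smean_smooth[OF s])
  have sM': "smooth_on ?I (dd ?I 1 (smean \<phi>))" "smooth_on ?I (dd ?I 1 (dd ?I 1 (smean \<phi>)))"
    by (intro smooth_on_dd fI sM)+
  show "continuous_on ?I (\<lambda>r. r * dd ?I 1 (dd ?I 1 (smean \<phi>)) r + (real DIM('a) - 1) * dd ?I 1 (smean \<phi>) r)"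
    by (intro continuous_intros smooth_on_continuous sM')
  show "continuous_on ?I (\<lambda>r. r * smean (lap \<phi>) r)"
    by (intro continuous_intros smooth_on_continuous smean_smooth lap_smooth s)
  fix r :: real assume "r \<in> interior ?I"
  then have r: "r \<in> ?I" and r0: "r > 0" by auto
  have cray: "continuous_on K (\<lambda>w. g (r *\<^sub>R w))" if "smooth_on K g" for g :: "'a \<Rightarrow> real"
    by (rule cont_ray[OF smooth_on_continuous[OF that] r])
  have ss: "smooth_on K (\<lambda>x. (x \<bullet> b) * dd K b \<phi> x)" for b by (intro smooth_ball s)
  have "r\<^sup>2 * smean (lap \<phi>) r = smean (\<lambda>x. \<Sum>b\<in>Basis. (x \<bullet> x) * dd K b (dd K b \<phi>) x) r"
    unfolding smean_inner_self[symmetric] by (simp add: lap_def sum_distrib_left)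
  also have "\<dots> = (\<Sum>b\<in>Basis. smean (\<lambda>x. (x \<bullet> x) * dd K b (dd K b \<phi>) x) r)"
    unfolding smean_def by (rule mean_sum) (intro cray smooth_ball s)
  also have "\<dots> = (\<Sum>b\<in>Basis. smean (\<lambda>x. euler (\<lambda>x. (x \<bullet> b) * dd K b \<phi> x) x + (real DIM('a) - 2) * ((x \<bullet> b) * dd K b \<phi> x)) r)"
    by (intro sum.cong refl smean_divergence smooth_ball s r)
  also have "\<dots> = smean (\<lambda>x. \<Sum>b\<in>Basis. euler (\<lambda>x. (x \<bullet> b) * dd K b \<phi> x) x + (real DIM('a) - 2) * ((x \<bullet> b) * dd K b \<phi> x)) r"
    unfolding smean_def by (rule mean_sum[symmetric]) (intro cray smooth_ball s)
  also have "\<dots> = smean (\<lambda>x. euler (euler \<phi>) x + (real DIM('a) - 2) * euler \<phi> x) r"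
    unfolding smean_def
  proof (rule mean_cong_K)
    fix w :: 'a assume "w \<in> K"
    then have x: "r *\<^sub>R w \<in> K" by (rule scale_in_cball[OF r])
    have "(\<Sum>b\<in>Basis. euler (\<lambda>x. (x \<bullet> b) * dd K b \<phi> x) (r *\<^sub>R w)) = euler (euler \<phi>) (r *\<^sub>R w)"
      using euler_sum[of Basis "\<lambda>b x. (x \<bullet> b) * dd K b \<phi> x", OF ss x] by (simp add: euler_def[of \<phi>, abs_def])
    then show "(\<Sum>b\<in>Basis. euler (\<lambda>x. (x \<bullet> b) * dd K b \<phi> x) (r *\<^sub>R w) + (real DIM('a) - 2) * (((r *\<^sub>R w) \<bullet> b) * dd K b \<phi> (r *\<^sub>R w)))
       = euler (euler \<phi>) (r *\<^sub>R w) + (real DIM('a) - 2) * euler \<phi> (r *\<^sub>R w)"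
      by (simp only: sum.distrib sum_distrib_left[symmetric] euler_def[of \<phi>])
  qed
  also have "\<dots> = smean (euler (euler \<phi>)) r + (real DIM('a) - 2) * smean (euler \<phi>) r"
    unfolding smean_def mean_cmult[symmetric]
    by (intro mean_add cray euler_smooth s smooth_on_cmult)
  also have "smean (euler \<phi>) r = r * dd ?I 1 (smean \<phi>) r" by (rule smean_euler[OF s r])
  also have "smean (euler (euler \<phi>)) r = r * dd ?I 1 (\<lambda>r. r * dd ?I 1 (smean \<phi>) r) r"
  proof -
    have "dd ?I 1 (smean (euler \<phi>)) r = dd ?I 1 (\<lambda>r. r * dd ?I 1 (smean \<phi>) r) r"
      by (rule dd_cong[OF fI r smean_smooth[OF euler_smooth[OF s]]]) (rule smean_euler[OF s])
    then show ?thesis using smean_euler[OF euler_smooth[OF s] r] by simp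
  qed
  also have "dd ?I 1 (\<lambda>r. r * dd ?I 1 (smean \<phi>) r) r = r * dd ?I 1 (dd ?I 1 (smean \<phi>)) r + dd ?I 1 (smean \<phi>) r"
  proof -
    have "smooth_on ?I (\<lambda>r::real. r)" by (intro smooth_on_linear bounded_linear_ident)
    moreover have "dd ?I 1 (\<lambda>r::real. r) r = 1" by (rule dd_linear[OF fI r bounded_linear_ident])
    ultimately show ?thesis using dd_mult[OF fI r _ sM'(1), of "\<lambda>r. r"] by simp
  qed
  finally have "r * (r * smean (lap \<phi>) r) = r * (r * dd ?I 1 (dd ?I 1 (smean \<phi>)) r + (real DIM('a) - 1) * dd ?I 1 (smean \<phi>) r)"
    by (simp add: power2_eq_square algebra_simps)
  then show "r * dd ?I 1 (dd ?I 1 (smean \<phi>)) r + (real DIM('a) - 1) * dd ?I 1 (smean \<phi>) r = r * smean (lap \<phi>) r"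
    using r0 by simp
qed

definition cyl :: "('a::euclidean_space \<times> real) set" where "cyl = K \<times> {0..}"

lemma mem_cyl: "(x, t) \<in> cyl \<longleftrightarrow> x \<in> K \<and> t \<ge> 0" by (simp add: cyl_def)

lemma convex_body_cyl: "convex_body cyl"
  unfolding cyl_def by (intro convex_body_Times convex_body_cball convex_body_nonneg)

abbreviation Dx :: "'a::euclidean_space \<Rightarrow> ('a \<times> real \<Rightarrow> real) \<Rightarrow> 'a \<times> real \<Rightarrow> real" where
  "Dx b \<equiv> dd cyl (b, 0)"

abbreviation Dt :: "('a::euclidean_space \<times> real \<Rightarrow> real) \<Rightarrow> 'a \<times> real \<Rightarrow> real" where
  "Dt \<equiv> dd cyl (0, 1)"

definition xlap :: "('a::euclidean_space \<times> real \<Rightarrow> real) \<Rightarrow> 'a \<times> real \<Rightarrow> real" where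
  "xlap H p = (\<Sum>b\<in>Basis. Dx b (Dx b H) p)"

lemma smooth_on_snd: "smooth_on A snd"
  by (rule smooth_on_linear[OF bounded_linear_snd])

lemmas smooth_cyl =
  smooth_on_add smooth_on_diff smooth_on_mult smooth_on_const smooth_on_sum smooth_on_dd[OF convex_body_cyl] smooth_on_snd

lemma xlap_smooth: "smooth_on cyl H \<Longrightarrow> smooth_on cyl (xlap H)"
  unfolding xlap_def by (intro smooth_cyl)

text \<open>
The Darboux equation multiplied by \<open>t\<close>, on the closed cylinder. At \<open>t = 0\<close> and \<open>n \<ge> 2\<close> it contains the
condition that the initial velocity vanishes.
\<close>
definition cyl_darboux :: "('a::euclidean_space \<times> real \<Rightarrow> real) \<Rightarrow> bool" where
  "cyl_darboux H \<longleftrightarrow> smooth_on cyl H \<and>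
    (\<forall>p\<in>cyl. snd p * Dt (Dt H) p + (real DIM('a) - 1) * Dt H p = snd p * xlap H p)"

lemma cyl_darboux_smooth: "cyl_darboux H \<Longrightarrow> smooth_on cyl H" by (simp add: cyl_darboux_def)

lemma dd_commute2:
  assumes X: "convex_body X" "smooth_on X f" "x \<in> X"
  shows "dd X u (dd X v (dd X v f)) x = dd X v (dd X v (dd X u f)) x"
proof -
  have "dd X u (dd X v (dd X v f)) x = dd X v (dd X u (dd X v f)) x"
    by (rule dd_commute[OF X(1) smooth_on_dd[OF X(1,2)] X(3)])
  also have "\<dots> = dd X v (dd X v (dd X u f)) x"
    by (rule dd_cong[OF X(1,3)]) (intro smooth_on_dd X dd_commute, simp add: dd_commute[OF X(1,2)])
  finally show ?thesis .
qed

lemma dd_snd: "p \<in> cyl \<Longrightarrow> dd cyl v snd p = snd v"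
  by (rule dd_linear[OF convex_body_cyl _ bounded_linear_snd])

lemma dd_snd_mult:
  "p \<in> cyl \<Longrightarrow> smooth_on cyl F \<Longrightarrow> dd cyl v (\<lambda>p. snd p * F p) p = snd p * dd cyl v F p + snd v * F p"
  using dd_mult[OF convex_body_cyl _ smooth_on_snd, of p F v] dd_snd[of p v] by simp

text \<open>
The coefficients do not depend on the space variable.
\<close>
lemma cyl_darboux_Dx:
  assumes H: "cyl_darboux (H :: 'a::euclidean_space \<times> real \<Rightarrow> real)" shows "cyl_darboux (Dx b H)"
  unfolding cyl_darboux_def
proof (intro conjI ballI)
  note s = cyl_darboux_smooth[OF H]
  show "smooth_on cyl (Dx b H)" by (intro smooth_cyl s)
  fix p :: "'a \<times> real" assume p: "p \<in> cyl"
  have s1: "smooth_on cyl (\<lambda>p. snd p * Dt (Dt H) p)" "smooth_on cyl (\<lambda>p. (real DIM('a) - 1) * Dt H p)"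
    by (intro smooth_cyl s)+
  have "dd cyl (b,0) (\<lambda>p. snd p * Dt (Dt H) p + (real DIM('a) - 1) * Dt H p) p = dd cyl (b,0) (\<lambda>p. snd p * xlap H p) p"
    by (rule dd_cong[OF convex_body_cyl p smooth_on_add[OF s1]]) (use H in \<open>simp add: cyl_darboux_def\<close>)
  then have "snd p * dd cyl (b,0) (Dt (Dt H)) p + (real DIM('a) - 1) * dd cyl (b,0) (Dt H) p = snd p * dd cyl (b,0) (xlap H) p"
    unfolding dd_add[OF convex_body_cyl p s1] dd_snd_mult[OF p xlap_smooth[OF s]]
      dd_snd_mult[OF p smooth_on_dd[OF convex_body_cyl smooth_on_dd[OF convex_body_cyl s]]] dd_cmult[OF convex_body_cyl p smooth_on_dd[OF convex_body_cyl s]]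
    by simp
  moreover have "dd cyl (b,0) (Dt (Dt H)) p = Dt (Dt (Dx b H)) p" by (rule dd_commute2[OF convex_body_cyl s p])
  moreover have "dd cyl (b,0) (Dt H) p = Dt (Dx b H) p" by (rule dd_commute[OF convex_body_cyl s p])
  moreover have "dd cyl (b,0) (xlap H) p = xlap (Dx b H) p"
  proof -
    have "dd cyl (b,0) (\<lambda>p. \<Sum>d\<in>Basis. Dx d (Dx d H) p) p = (\<Sum>d\<in>Basis. dd cyl (b,0) (Dx d (Dx d H)) p)"
      by (rule dd_sum[OF convex_body_cyl p]) (intro smooth_cyl s)
    then show ?thesis by (simp add: xlap_def[abs_def] dd_commute2[OF convex_body_cyl s p])
  qed
  ultimately show "snd p * Dt (Dt (Dx b H)) p + (real DIM('a) - 1) * Dt (Dx b H) p = snd p * xlap (Dx b H) p"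
    by simp
qed

lemma slice:
  assumes s: "smooth_on cyl H" and t: "t \<ge> 0"
  shows slice_smooth: "smooth_on K (\<lambda>x. H (x, t))"
    and slice_dd: "x \<in> K \<Longrightarrow> dd K b (\<lambda>x. H (x, t)) x = Dx b H (x, t)"
proof -
  have L: "bounded_linear (\<lambda>x::'a. (x, 0::real))"
    by (intro bounded_linear_Pair bounded_linear_ident bounded_linear_zero)
  have m: "(0, t) + (x, 0) \<in> cyl" if "x \<in> K" for x :: 'a using that t by (simp add: mem_cyl)
  show "smooth_on K (\<lambda>x. H (x, t))" using smooth_on_affine[where Y=K, OF convex_body_cyl L m s] by simp
  show "dd K b (\<lambda>x. H (x, t)) x = Dx b H (x, t)" if "x \<in> K"
    using dd_affine[OF convex_body_cyl L m s convex_body_cball that] by simp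
qed

lemma slice_lap:
  assumes s: "smooth_on cyl H" and t: "t \<ge> 0" and x: "x \<in> K"
  shows "lap (\<lambda>x. H (x, t)) x = xlap H (x, t)"
proof -
  have "dd K b (dd K b (\<lambda>x. H (x, t))) x = Dx b (Dx b H) (x, t)" for b
  proof -
    have "dd K b (dd K b (\<lambda>x. H (x, t))) x = dd K b (\<lambda>x. Dx b H (x, t)) x"
      by (rule dd_cong[OF convex_body_cball x]) (intro smooth_on_dd convex_body_cball slice_smooth s t, rule slice_dd[OF s t])
    also have "\<dots> = Dx b (Dx b H) (x, t)" by (rule slice_dd[OF smooth_on_dd[OF convex_body_cyl s] t x])
    finally show ?thesis .
  qed
  then show ?thesis by (simp add: lap_def xlap_def)
qed

lemma vertical:
  assumes s: "smooth_on cyl H" and x: "x \<in> K" and Y: "convex_body Y" "Y \<subseteq> {0..}"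
  shows vertical_smooth: "smooth_on Y (\<lambda>t. H (x, t))"
    and vertical_dd: "t \<in> Y \<Longrightarrow> dd Y 1 (\<lambda>t. H (x, t)) t = Dt H (x, t)"
proof -
  have L: "bounded_linear (\<lambda>t::real. (0::'a, t))"
    by (intro bounded_linear_Pair bounded_linear_ident bounded_linear_zero)
  have m: "(x, 0) + (0, t) \<in> cyl" if "t \<in> Y" for t using that Y x by (auto simp: mem_cyl)
  show "smooth_on Y (\<lambda>t. H (x, t))" using smooth_on_affine[OF convex_body_cyl L m s] by simp
  show "dd Y 1 (\<lambda>t. H (x, t)) t = Dt H (x, t)" if "t \<in> Y"
    using dd_affine[OF convex_body_cyl L m s Y(1) that] by simp
qed

definition axial_mean :: "('a::euclidean_space \<times> real \<Rightarrow> real) \<Rightarrow> real \<times> real \<Rightarrow> real" where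
  "axial_mean H p = smean (\<lambda>x. H (x, snd p)) (fst p)"

definition axial_map :: "'a::euclidean_space \<Rightarrow> real \<times> real \<Rightarrow> 'a \<times> real" where
  "axial_map w p = (fst p *\<^sub>R w, snd p)"

lemma axial_pullback: "pullback cyl strip (axial_map :: 'a::euclidean_space \<Rightarrow> _)"
proof (rule pullback.intro)
  show "convex_body cyl" by (rule convex_body_cyl)
  show "convex strip" using convex_body_strip by (simp add: convex_body_def)
  show "bounded_linear (axial_map w)" for w :: 'a
    unfolding axial_map_def
    by (intro bounded_linear_Pair bounded_linear_compose[OF bounded_linear_scaleR_left bounded_linear_fst] bounded_linear_snd)
  show "continuous_on UNIV (\<lambda>p. axial_map (fst p) (snd p))"
    unfolding axial_map_def by (intro continuous_intros)
  show "axial_map w y \<in> cyl" if "w \<in> cball 0 1" "y \<in> strip" for w :: 'a and y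
    using that scale_in_cball[of "fst y" w] by (auto simp: axial_map_def mem_cyl strip_def)
qed

lemma axial_mean_eq: "axial_mean H = pmean (\<lambda>w. 1) axial_map H"
  by (auto simp: axial_mean_def pmean_def smean_def axial_map_def fun_eq_iff)

lemma axial_mean_smooth: "smooth_on cyl H \<Longrightarrow> smooth_on strip (axial_mean H)"
  unfolding axial_mean_eq by (intro pullback.pmean_smooth[OF axial_pullback] continuous_intros)

lemma axial_mean_dt:
  assumes "smooth_on cyl H" "p \<in> strip"
  shows "dd strip (0,1) (axial_mean H) p = axial_mean (Dt H) p"
  unfolding axial_mean_eq
  by (subst pullback.dd_pmean[OF axial_pullback convex_body_strip continuous_on_const assms]) (simp add: axial_map_def pmean_def)

lemma horizontal:
  assumes s: "smooth_on strip U" and t: "t \<ge> 0"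
  shows horizontal_smooth: "smooth_on {0..1} (\<lambda>r. U (r, t))"
    and horizontal_dd: "r \<in> {0..1} \<Longrightarrow> dd {0..1} 1 (\<lambda>r. U (r, t)) r = dd strip (1,0) U (r, t)"
proof -
  have L: "bounded_linear (\<lambda>r::real. (r, 0::real))"
    by (intro bounded_linear_Pair bounded_linear_ident bounded_linear_zero)
  have m: "(0, t) + (r, 0) \<in> strip" if "r \<in> {0..1}" for r using that t by (simp add: strip_def)
  show "smooth_on {0..1} (\<lambda>r. U (r, t))"
    using smooth_on_affine[where Y="{0..1}", OF convex_body_strip L m s] by simp
  show "dd {0..1} 1 (\<lambda>r. U (r, t)) r = dd strip (1,0) U (r, t)" if "r \<in> {0..1}"
    using dd_affine[OF convex_body_strip L m s convex_body_unit_interval that] by simp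
qed

text \<open>
The link between the cylinder and the two radial variables: by \<open>smean_lap\<close>, the space Laplacian
becomes its radial part, and the time operator commutes with averaging in space.
\<close>
lemma axial_mean_radial_darboux:
  fixes H :: "'a::euclidean_space \<times> real \<Rightarrow> real"
  assumes H: "cyl_darboux H"
  shows "radial_darboux (DIM('a) - 1) strip (axial_mean H)"
  unfolding radial_darboux_def
proof (intro conjI ballI, goal_cases)
  note s = cyl_darboux_smooth[OF H]
  case 1 show ?case by (rule axial_mean_smooth[OF s])
next
  note s = cyl_darboux_smooth[OF H]
  let ?U = "axial_mean H"
  let ?I = "{0..1::real}"
  have sU: "smooth_on strip ?U" by (rule axial_mean_smooth[OF s])
  case (2 p)
  obtain r t where p: "p = (r, t)" by (cases p)
  have r: "r \<in> ?I" and t: "t \<ge> 0" and ps: "(r, t) \<in> strip" using 2 p by (auto simp: strip_def)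
  define \<phi> where "\<phi> = (\<lambda>x. H (x, t))"
  have s\<phi>: "smooth_on K \<phi>" unfolding \<phi>_def by (rule slice_smooth[OF s t])
  have M: "smean \<phi> = (\<lambda>r. ?U (r, t))" by (simp add: axial_mean_def \<phi>_def)
  have d1: "dd ?I 1 (smean \<phi>) r = dd strip (1,0) ?U (r, t)" if "r \<in> ?I" for r
    unfolding M by (rule horizontal_dd[OF sU t that])
  have d2: "dd ?I 1 (dd ?I 1 (smean \<phi>)) r = dd strip (1,0) (dd strip (1,0) ?U) (r, t)"
  proof -
    have "dd ?I 1 (dd ?I 1 (smean \<phi>)) r = dd ?I 1 (\<lambda>r. dd strip (1,0) ?U (r, t)) r"
      by (rule dd_cong[OF convex_body_unit_interval r smooth_on_dd[OF convex_body_unit_interval smean_smooth[OF s\<phi>]]]) (rule d1)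
    then show ?thesis using horizontal_dd[OF smooth_on_dd[OF convex_body_strip sU] t r] by simp
  qed
  have t1: "dd strip (0,1) ?U (r, t) = smean (\<lambda>x. Dt H (x, t)) r"
    using axial_mean_dt[OF s ps] by (simp add: axial_mean_def)
  have t2: "dd strip (0,1) (dd strip (0,1) ?U) (r, t) = smean (\<lambda>x. Dt (Dt H) (x, t)) r"
  proof -
    have "dd strip (0,1) (dd strip (0,1) ?U) (r, t) = dd strip (0,1) (axial_mean (Dt H)) (r, t)"
      by (rule dd_cong[OF convex_body_strip ps smooth_on_dd[OF convex_body_strip sU]]) (rule axial_mean_dt[OF s])
    then show ?thesis using axial_mean_dt[OF smooth_on_dd[OF convex_body_cyl s] ps] by (simp add: axial_mean_def)
  qed
  have cs: "continuous_on K (\<lambda>w. F (r *\<^sub>R w, t))" if "smooth_on cyl F" for F :: "'a \<times> real \<Rightarrow> real"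
    using cont_ray[OF smooth_on_continuous[OF slice_smooth[OF that t]] r] .
  have "t * smean (lap \<phi>) r = smean (\<lambda>x. t * Dt (Dt H) (x, t) + (real DIM('a) - 1) * Dt H (x, t)) r"
    unfolding smean_def mean_cmult[symmetric]
  proof (rule mean_cong_K)
    fix w :: 'a assume "w \<in> K"
    then have x: "r *\<^sub>R w \<in> K" by (rule scale_in_cball[OF r])
    then have "(r *\<^sub>R w, t) \<in> cyl" using t by (simp only: mem_cyl)
    then show "t * lap \<phi> (r *\<^sub>R w) = t * Dt (Dt H) (r *\<^sub>R w, t) + (real DIM('a) - 1) * Dt H (r *\<^sub>R w, t)"
      using H slice_lap[OF s t x] unfolding cyl_darboux_def \<phi>_def by force
  qed
  also have "\<dots> = t * smean (\<lambda>x. Dt (Dt H) (x, t)) r + (real DIM('a) - 1) * smean (\<lambda>x. Dt H (x, t)) r"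
    unfolding smean_def mean_cmult[symmetric]
    by (intro mean_add continuous_on_mult_left cs smooth_on_dd convex_body_cyl s)
  finally have e: "t * smean (lap \<phi>) r = t * smean (\<lambda>x. Dt (Dt H) (x, t)) r + (real DIM('a) - 1) * smean (\<lambda>x. Dt H (x, t)) r" .
  have n: "real (DIM('a) - 1) = real DIM('a) - 1" using DIM_positive[where 'a='a] by (simp add: of_nat_diff)
  have l: "r * dd strip (1,0) (dd strip (1,0) ?U) (r, t) + (real DIM('a) - 1) * dd strip (1,0) ?U (r, t) = r * smean (lap \<phi>) r"
    using smean_lap[OF s\<phi> r] by (simp only: d1[OF r] d2)
  have "r * t * (dd strip (1,0) (dd strip (1,0) ?U) (r, t) - smean (\<lambda>x. Dt (Dt H) (x, t)) r) +
     (real DIM('a) - 1) * (t * dd strip (1,0) ?U (r, t) - r * smean (\<lambda>x. Dt H (x, t)) r)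
    = t * (r * dd strip (1,0) (dd strip (1,0) ?U) (r, t) + (real DIM('a) - 1) * dd strip (1,0) ?U (r, t))
      - r * (t * smean (\<lambda>x. Dt (Dt H) (x, t)) r + (real DIM('a) - 1) * smean (\<lambda>x. Dt H (x, t)) r)"
    by (simp only: algebra_simps)
  also have "\<dots> = 0" unfolding l e[symmetric] by simp
  finally show ?case by (simp add: p t1 t2 n)
qed

lemma DIM_Suc: "DIM('a::euclidean_space) \<ge> 2 \<Longrightarrow> \<exists>m. DIM('a) - 1 = Suc m"
  by (intro exI[of _ "DIM('a) - 2"]) simp

lemma axial_mean_axis: "axial_mean H (0, t) = H (0, t)"
  by (simp add: axial_mean_def smean_def mean_const)

definition vanishes_late :: "('a::euclidean_space \<times> real \<Rightarrow> real) \<Rightarrow> bool" where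
  "vanishes_late H \<longleftrightarrow> (\<forall>x\<in>K. \<forall>t\<ge>2. H (x, t) = 0)"

lemma smean_0:
  fixes \<phi> :: "'a::euclidean_space \<Rightarrow> real"
  shows "(\<And>x. x \<in> K \<Longrightarrow> \<phi> x = 0) \<Longrightarrow> r \<in> {0..1} \<Longrightarrow> smean \<phi> r = 0"
proof -
  assume z: "\<And>x. x \<in> K \<Longrightarrow> \<phi> x = 0" and r: "r \<in> {0..1}"
  have "mean (\<lambda>w. \<phi> (r *\<^sub>R w)) = mean (\<lambda>w::'a. 0)"
    by (rule mean_cong_K, rule z, rule scale_in_cball[OF r])
  then show ?thesis by (simp add: smean_def mean_const)
qed

lemma cyl_darboux_axis_vanishes:
  fixes H :: "'a::euclidean_space \<times> real \<Rightarrow> real"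
  assumes n: "DIM('a) \<ge> 2" and H: "cyl_darboux H" "vanishes_late H" and t: "t \<ge> 1"
  shows "H (0, t) = 0"
proof -
  obtain m where m: "DIM('a) - 1 = Suc m" using DIM_Suc[OF n] by blast
  have "axial_mean H (0, t) = 0"
  proof (rule radial_darboux_vanishes_late[OF axial_mean_radial_darboux[OF H(1), unfolded m] _ t])
    fix r t :: real assume "r \<in> {0..1}" "t \<ge> 2"
    then show "axial_mean H (r, t) = 0"
      using H(2) smean_0[of "\<lambda>x. H (x, t)" r] by (simp add: axial_mean_def vanishes_late_def)
  qed
  then show ?thesis by (simp add: axial_mean_axis)
qed

lemma cyl_darboux_asgeirsson:
  fixes H :: "'a::euclidean_space \<times> real \<Rightarrow> real"
  assumes n: "DIM('a) \<ge> 2" and H: "cyl_darboux H" and r: "r \<in> {0..1}"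
  shows "smean (\<lambda>x. H (x, 0)) r = H (0, r)"
proof -
  obtain m where m: "DIM('a) - 1 = Suc m" using DIM_Suc[OF n] by blast
  have "axial_mean H (r, 0) = axial_mean H (0, r)"
    by (rule radial_darboux_swap[OF axial_mean_radial_darboux[OF H, unfolded m] r])
  then show ?thesis by (simp add: axial_mean_axis) (simp add: axial_mean_def)
qed

lemma cyl_darboux_smean_zero:
  fixes H :: "'a::euclidean_space \<times> real \<Rightarrow> real"
  assumes n: "DIM('a) \<ge> 2" and H: "cyl_darboux H" "vanishes_late H"
    and init: "\<And>x. x \<in> K \<Longrightarrow> H (x, 0) = 0" and r: "r \<in> {0..1}" and t: "t \<ge> 0"
  shows "smean (\<lambda>x. H (x, t)) r = 0"
proof -
  obtain m where m: "DIM('a) - 1 = Suc m" using DIM_Suc[OF n] by blast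
  have axis: "H (0, t) = 0" if "t \<ge> 0" for t
  proof (cases "t \<ge> 1")
    case True then show ?thesis using cyl_darboux_axis_vanishes[OF n H] by simp
  next
    case False
    then have t: "t \<in> {0..1}" using that by auto
    show ?thesis using cyl_darboux_asgeirsson[OF n H(1) t] smean_0[of "\<lambda>x. H (x, 0)" t] init t by simp
  qed
  have "axial_mean H (r, t) = 0"
  proof (rule radial_darboux_lateral_uniqueness[OF axial_mean_radial_darboux[OF H(1), unfolded m] _ _ r t])
    show "axial_mean H (0, t) = 0" if "t \<ge> 0" for t using axis[OF that] by (simp add: axial_mean_axis)
    fix r t :: real assume "r \<in> {0..1}" "t \<ge> 2"
    then show "axial_mean H (r, t) = 0"
      using H(2) smean_0[of "\<lambda>x. H (x, t)" r] by (simp add: axial_mean_def vanishes_late_def)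
  qed
  then show ?thesis by (simp add: axial_mean_def)
qed

lemma slice_zero_Dx:
  assumes s: "smooth_on cyl H" and t: "t \<ge> 0" and z: "\<And>x. x \<in> K \<Longrightarrow> H (x, t) = 0" and x: "x \<in> K"
  shows "Dx b H (x, t) = 0"
proof -
  have "dd K b (\<lambda>x. H (x, t)) x = dd K b (\<lambda>x. 0) x"
    by (rule dd_cong[OF convex_body_cball x slice_smooth[OF s t]]) (rule z)
  then show ?thesis using slice_dd[OF s t x, of b] dd_const[OF convex_body_cball x] by simp
qed

lemma vanishes_late_Dx: "smooth_on cyl H \<Longrightarrow> vanishes_late H \<Longrightarrow> vanishes_late (Dx b H)"
  unfolding vanishes_late_def using slice_zero_Dx by fastforce

text \<open>
By Asgeirsson's theorem the averages of the initial value are the values of \<open>H\<close> on the axis, and these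
vanish from \<open>t = 1\<close> on. A smooth function of one variable that vanishes for \<open>t \<ge> 1\<close> is flat at
\<open>1\<close>.
\<close>
lemma initial_value_flat:
  fixes H :: "'a::euclidean_space \<times> real \<Rightarrow> real"
  assumes n: "DIM('a) \<ge> 2" and H: "cyl_darboux H" "vanishes_late H"
  shows "flat (\<lambda>x. H (x, 0))"
proof -
  note s = cyl_darboux_smooth[OF H(1)]
  \<comment> \<open>On the axis, \<open>T\<close> is \<open>t d/dt\<close>; it corresponds to the Euler operator under Asgeirsson's theorem.\<close>
  define T where "T = (\<lambda>F::'a \<times> real \<Rightarrow> real. \<lambda>p. snd p * Dt F p)"
  define f where "f = (\<lambda>x. H (x, 0))"
  have sf: "smooth_on K f" unfolding f_def by (rule slice_smooth[OF s]) simp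
  have sT: "smooth_on cyl ((T ^^ j) H)" for j
    by (induction j) (auto simp: T_def intro!: smooth_cyl s)
  have late: "(T ^^ j) H (0, t) = 0" if "t \<ge> 1" for j t
    using that
  proof (induction j arbitrary: t)
    case 0 then show ?case using cyl_darboux_axis_vanishes[OF n H] by simp
  next
    case (Suc j)
    have f1: "convex_body {1::real..}" by (simp add: convex_body_def)
    have "dd {1..} 1 (\<lambda>t. (T ^^ j) H (0, t)) t = dd {1..} 1 (\<lambda>t. 0) t"
      by (rule dd_cong[OF f1 _ vertical_smooth[OF sT _ f1]]) (use Suc in auto)
    moreover have "dd {1..} 1 (\<lambda>t. (T ^^ j) H (0, t)) t = Dt ((T ^^ j) H) (0, t)"
      by (rule vertical_dd[OF sT _ f1]) (use Suc.prems in auto)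
    ultimately show ?case using dd_const[OF f1] Suc.prems by (simp add: T_def)
  qed
  have *: "smean ((euler ^^ j) f) r = (T ^^ j) H (0, r)" if "r \<in> {0..1}" for j r
    using that
  proof (induction j arbitrary: r)
    case 0 then show ?case using cyl_darboux_asgeirsson[OF n H(1)] by (simp add: f_def)
  next
    case (Suc j)
    have "dd {0..1} 1 (smean ((euler ^^ j) f)) r = dd {0..1} 1 (\<lambda>r. (T ^^ j) H (0, r)) r"
      by (rule dd_cong[OF convex_body_unit_interval Suc.prems smean_smooth[OF euler_pow_smooth[OF sf]]]) (rule Suc.IH)
    also have "\<dots> = Dt ((T ^^ j) H) (0, r)"
      by (rule vertical_dd[OF sT _ convex_body_unit_interval]) (use Suc.prems in auto)
    finally show ?case
      using smean_euler[OF euler_pow_smooth[OF sf] Suc.prems, of j] by (simp add: T_def)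
  qed
  have "mean ((euler ^^ j) f) = 0" for j
  proof -
    have "mean ((euler ^^ j) f) = smean ((euler ^^ j) f) 1" by (simp add: smean_def)
    also have "\<dots> = 0" using *[of 1 j] late[of 1 j] by simp
    finally show ?thesis .
  qed
  then show ?thesis unfolding flat_def f_def[symmetric] using sf by blast
qed

text \<open>
The class of such \<open>H\<close> is closed under space derivatives, and all its members have vanishing
averages about the origin. By induction on the degree, the averages against homogeneous polynomials
vanish as well: \<open>r^(n-2)\<close> times the average of \<open>x\<^sub>b \<phi>\<close> does not depend on \<open>r\<close>, by the divergence theorem,
and it is zero at \<open>r = 0\<close>.
\<close>
lemma cyl_darboux_unique:
  fixes H :: "'a::euclidean_space \<times> real \<Rightarrow> real"
  assumes n: "DIM('a) \<ge> 2" and H: "cyl_darboux H" "vanishes_late H"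
    and init: "\<And>x. x \<in> K \<Longrightarrow> H (x, 0) = 0" and p: "(x, t) \<in> cyl"
  shows "H (x, t) = 0"
proof -
  have t: "t \<ge> 0" and x: "x \<in> K" using p by (auto simp: mem_cyl)
  define C where "C = (\<lambda>H::'a \<times> real \<Rightarrow> real. cyl_darboux H \<and> vanishes_late H \<and> (\<forall>x\<in>K. H (x, 0) = 0))"
  have CD: "C (Dx b H)" if "C H" for b H
  proof -
    have H: "cyl_darboux H" "vanishes_late H" "\<And>x. x \<in> K \<Longrightarrow> H (x, 0) = 0" using that by (auto simp: C_def)
    note s = cyl_darboux_smooth[OF H(1)]
    show ?thesis
      unfolding C_def using cyl_darboux_Dx[OF H(1)] vanishes_late_Dx[OF s H(2)] slice_zero_Dx[OF s order_refl H(3)] by blast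
  qed
  have zero: "smean (\<lambda>x. p x * H (x, t)) r = 0" if "hom_poly k p" "C H" "r \<in> {0..1}" for k p H r
    using that
  proof (induction k arbitrary: p H r rule: less_induct)
    case (less k)
    have s: "smooth_on cyl H" using less.prems cyl_darboux_smooth by (auto simp: C_def)
    have sH: "smooth_on K (\<lambda>x. H (x, t))" by (rule slice_smooth[OF s t])
    have base: "smean (\<lambda>x. H (x, t)) r = 0" if "C H" "r \<in> {0..1}" for H r
      using cyl_darboux_smean_zero[OF n, of H r t] that t by (auto simp: C_def)
    show ?case
    proof (cases k)
      case 0
      then obtain c where "p = (\<lambda>x. c)" using less.prems by auto
      then show ?thesis using base[OF less.prems(2,3)] by (simp add: smean_def mean_cmult)
    next
      case (Suc l)
      obtain q where q: "\<forall>b\<in>Basis. hom_poly l (q b)" "p = (\<lambda>x. \<Sum>b\<in>Basis. (x \<bullet> b) * q b x)"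
        using less.prems Suc by auto
      have one: "smean (\<lambda>x. (x \<bullet> b) * (q b x * H (x, t))) r = 0" if b: "b \<in> Basis" and r: "r \<in> {0..1}" for b r
      proof -
        have sq: "smooth_on K (q b)" using q(1) b hom_poly_smooth by blast
        define \<phi> where "\<phi> = (\<lambda>x. q b x * H (x, t))"
        have s\<phi>: "smooth_on K \<phi>" unfolding \<phi>_def by (intro smooth_ball sq sH)
        have sb: "smooth_on K (\<lambda>x. (x \<bullet> b) * \<phi> x)" by (intro smooth_ball s\<phi>)
        obtain q' where q': "hom_poly (l - 1) q'" "l = 0 \<longrightarrow> q' = (\<lambda>x. 0)" "\<forall>x\<in>K. dd K b (q b) x = q' x"
          using hom_poly_dd[of l "q b" b] q(1) b by blast
        have sq': "smooth_on K q'" using q'(1) hom_poly_smooth by blast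
        have sDH: "smooth_on K (\<lambda>x. Dx b H (x, t))" by (intro slice_smooth smooth_cyl s t)
        have z: "smean (dd K b \<phi>) r = 0" if r: "r \<in> {0..1}" for r
        proof -
          have "smean (dd K b \<phi>) r = smean (\<lambda>x. q b x * Dx b H (x, t) + q' x * H (x, t)) r"
            unfolding smean_def
          proof (rule mean_cong_K)
            fix w :: 'a assume "w \<in> K"
            then have x: "r *\<^sub>R w \<in> K" by (rule scale_in_cball[OF r])
            show "dd K b \<phi> (r *\<^sub>R w) = q b (r *\<^sub>R w) * Dx b H (r *\<^sub>R w, t) + q' (r *\<^sub>R w) * H (r *\<^sub>R w, t)"
              unfolding \<phi>_def dd_mult[OF convex_body_cball x sq sH] slice_dd[OF s t x] using q'(3) x by simp
          qed
          also have "\<dots> = smean (\<lambda>x. q b x * Dx b H (x, t)) r + smean (\<lambda>x. q' x * H (x, t)) r"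
            unfolding smean_def
            by (rule mean_add) (rule cont_ray[OF _ r], intro smooth_on_continuous smooth_ball sq sDH sq' sH)+
          also have "smean (\<lambda>x. q b x * Dx b H (x, t)) r = 0"
            using less.IH[of l "q b" "Dx b H" r] q(1) b CD[OF less.prems(2)] r Suc by simp
          also have "smean (\<lambda>x. q' x * H (x, t)) r = 0"
          proof (cases "l = 0")
            case True then show ?thesis using q'(2) by (simp add: smean_def mean_const)
          next
            case False then show ?thesis using less.IH[of "l - 1" q' H r] q'(1) less.prems(2) r Suc by simp
          qed
          finally show ?thesis by simp
        qed
        define u where "u = smean (\<lambda>x. (x \<bullet> b) * \<phi> x)"
        have su: "smooth_on {0..1} u" unfolding u_def by (rule smean_smooth[OF sb])
        have u0: "u 0 = 0" by (simp add: u_def smean_def mean_const)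
        have ode: "r * dd {0..1} 1 u r + (real DIM('a) - 2) * u r = 0" if r: "r \<in> {0..1}" for r
        proof -
          have "0 = smean (\<lambda>x. (x \<bullet> x) * dd K b \<phi> x) r" by (simp add: smean_inner_self z[OF r])
          also have "\<dots> = smean (\<lambda>x. euler (\<lambda>x. (x \<bullet> b) * \<phi> x) x + (real DIM('a) - 2) * ((x \<bullet> b) * \<phi> x)) r"
            by (rule smean_divergence[OF s\<phi> r])
          also have "\<dots> = smean (euler (\<lambda>x. (x \<bullet> b) * \<phi> x)) r + (real DIM('a) - 2) * u r"
            unfolding smean_def u_def mean_cmult[symmetric]
            by (rule mean_add) (rule cont_ray[OF _ r], intro smooth_on_continuous smooth_on_cmult euler_smooth sb)+
          finally show ?thesis using smean_euler[OF sb r] by (simp add: u_def)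
        qed
        define m where "m = DIM('a) - 2"
        have m: "real m = real DIM('a) - 2" using n by (simp add: m_def of_nat_diff)
        \<comment> \<open>For \<open>n = 2\<close> the factor \<open>0 ^ m\<close> is \<open>1\<close>, but \<open>u 0 = 0\<close> in all cases.\<close>
        have "0 ^ m * u 0 = r ^ m * u r"
        proof (rule const_of_deriv_0[where f="\<lambda>r. r ^ m * u r"])
          show "0 \<le> r" using r by simp
          show "continuous_on {0..r} (\<lambda>r. r ^ m * u r)"
            by (intro continuous_intros continuous_on_subset[OF smooth_on_continuous[OF su]]) (use r in auto)
          fix y assume y: "0 < y" "y < r"
          then have y1: "y \<in> {0..1}" using r by auto
          have "0 + y *\<^sub>R 1 \<in> interior {0..1::real}" using y r by auto
          from dd_line_derivative[OF convex_body_unit_interval su this]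
          have "(u has_real_derivative dd {0..1} 1 u y) (at y)" by simp
          then have "((\<lambda>r. r ^ m * u r) has_real_derivative (real m * y ^ (m - 1)) * u y + dd {0..1} 1 u y * y ^ m) (at y)"
            by (intro DERIV_mult) (auto intro!: derivative_eq_intros)
          moreover have "(real m * y ^ (m - 1)) * u y + dd {0..1} 1 u y * y ^ m = 0"
          proof -
            have "y * ((real m * y ^ (m - 1)) * u y + dd {0..1} 1 u y * y ^ m) = y ^ m * (y * dd {0..1} 1 u y + real m * u y)"
              by (cases m) (auto simp: algebra_simps)
            then show ?thesis using ode[OF y1] y by (simp add: m)
          qed
          ultimately show "((\<lambda>r. r ^ m * u r) has_real_derivative 0) (at y)" by simp
        qed
        then have "r ^ m * u r = 0" using u0 by simp
        then have "u r = 0" using u0 by (cases "r = 0") auto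
        then show ?thesis by (simp add: u_def \<phi>_def)
      qed
      have "smean (\<lambda>x. p x * H (x, t)) r = smean (\<lambda>x. \<Sum>b\<in>Basis. (x \<bullet> b) * (q b x * H (x, t))) r"
        by (simp add: q(2) sum_distrib_right mult.assoc)
      also have "\<dots> = (\<Sum>b\<in>Basis. smean (\<lambda>x. (x \<bullet> b) * (q b x * H (x, t))) r)"
        unfolding smean_def
        by (rule mean_sum, rule cont_ray[OF _ less.prems(3)], intro smooth_on_continuous smooth_ball sH)
          (use q(1) hom_poly_smooth in blast)
      also have "\<dots> = 0" using one less.prems(3) by simp
      finally show ?thesis .
    qed
  qed
  have CH: "C H" using H init by (simp add: C_def)
  have s: "smooth_on cyl H" using cyl_darboux_smooth[OF H(1)] .
  show ?thesis
  proof (cases "x = 0")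
    case True
    have "smean (\<lambda>x. H (x, t)) 0 = 0" using cyl_darboux_smean_zero[OF n H init, of 0 t] t by simp
    then show ?thesis using True by (simp add: smean_def mean_const)
  next
    case False
    define r where "r = norm x"
    have r: "r \<in> {0..1}" "r > 0" using x False by (auto simp: r_def)
    have "H (r *\<^sub>R (x /\<^sub>R r), t) = 0"
    proof (rule mean_hom_poly_zero[where \<phi>="\<lambda>w. H (r *\<^sub>R w, t)"])
      show "continuous_on K (\<lambda>w. H (r *\<^sub>R w, t))"
        by (rule cont_ray[OF smooth_on_continuous[OF slice_smooth[OF s t]] r(1)])
      show "x /\<^sub>R r \<in> sphere 0 1" using r by (simp add: r_def)
      fix k and p :: "'a \<Rightarrow> real" assume p: "hom_poly k p"
      have "smean (\<lambda>x. p x * H (x, t)) r = r ^ k * mean (\<lambda>w. p w * H (r *\<^sub>R w, t))"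
        unfolding smean_def hom_poly_scale[OF p] mult.assoc mean_cmult ..
      then show "mean (\<lambda>w. p w * H (r *\<^sub>R w, t)) = 0" using zero[OF p CH r(1)] r(2) by simp
    qed
    then show ?thesis using r by simp
  qed
qed

section \<open>Smoothness of the initial value across the sphere\<close>

text \<open>
At a point of the sphere the derivative relative to the ball is zero, hence the zero map is also the
derivative of the extension. The derivatives belong to the same class of functions.
\<close>
lemma smooth_on_extend_by_zero:
  fixes Z :: "('a::euclidean_space \<Rightarrow> real) set"
  assumes s: "\<And>\<phi>. \<phi> \<in> Z \<Longrightarrow> smooth_on K \<phi>" and z: "\<And>\<phi> w. \<phi> \<in> Z \<Longrightarrow> w \<in> sphere 0 1 \<Longrightarrow> \<phi> w = 0"
    and cl: "\<And>\<phi> v. \<phi> \<in> Z \<Longrightarrow> dd K v \<phi> \<in> Z" and f: "f \<in> Z"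
  shows "smooth_on UNIV (extend_by_zero K f)"
proof (rule smooth_on_coinduct[where P="\<lambda>h. \<exists>\<phi>\<in>Z. h = extend_by_zero K \<phi>"])
  fix h :: "'a \<Rightarrow> real" assume "\<exists>\<phi>\<in>Z. h = extend_by_zero K \<phi>"
  then obtain \<phi> where \<phi>: "\<phi> \<in> Z" "h = extend_by_zero K \<phi>" by blast
  have der: "(h has_derivative (\<lambda>v. extend_by_zero K (dd K v \<phi>) x)) (at x)" for x
  proof -
    consider "norm x < 1" | "norm x > 1" | "norm x = 1" by linarith
    then show ?thesis
    proof cases
      case 1
      then have x: "x \<in> K" "x \<in> interior K" by auto
      have "(\<phi> has_derivative (\<lambda>v. dd K v \<phi> x)) (at x)"
        using smooth_on_has_derivative[OF convex_body_cball s[OF \<phi>(1)] x(1)] at_within_interior[OF x(2)] by simp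
      then have "(h has_derivative (\<lambda>v. dd K v \<phi> x)) (at x)"
        by (rule has_derivative_transform_within_open[where s="ball 0 1"]) (use 1 in \<open>auto simp: \<phi>(2) extend_by_zero_def\<close>)
      then show ?thesis using x(1) by (simp add: extend_by_zero_def)
    next
      case 2
      have "((\<lambda>x::'a. 0::real) has_derivative (\<lambda>v. 0)) (at x)" by simp
      then have "(h has_derivative (\<lambda>v. 0)) (at x)"
        by (rule has_derivative_transform_within_open[where s="- K"]) (use 2 in \<open>auto simp: \<phi>(2) extend_by_zero_def\<close>)
      then show ?thesis using 2 by (simp add: extend_by_zero_def)
    next
      case 3
      then have x: "x \<in> K" "x \<in> sphere 0 1" by auto
      have d0: "dd K v \<phi> x = 0" for v using z[OF cl[OF \<phi>(1)] x(2)] .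
      have "(\<phi> has_derivative (\<lambda>v. 0)) (at x within K)"
        using smooth_on_has_derivative[OF convex_body_cball s[OF \<phi>(1)] x(1)] by (simp add: d0)
      then have \<phi>d: "\<forall>e>0. \<exists>d>0. \<forall>y\<in>K. norm (y - x) < d \<longrightarrow> norm (\<phi> y - \<phi> x - 0) \<le> e * norm (y - x)"
        unfolding has_derivative_within_alt by simp
      have "(h has_derivative (\<lambda>v. 0)) (at x)"
        unfolding has_derivative_at_alt
      proof (intro conjI allI impI)
        fix e :: real assume "e > 0"
        then obtain d where d: "d > 0" "\<forall>y\<in>K. norm (y - x) < d \<longrightarrow> norm (\<phi> y - \<phi> x - 0) \<le> e * norm (y - x)"
          using \<phi>d by blast
        have "norm (h y - h x - 0) \<le> e * norm (y - x)" if "norm (y - x) < d" for y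
          using d(2) that x z[OF \<phi>(1) x(2)] \<open>e > 0\<close> by (cases "y \<in> K") (auto simp: \<phi>(2) extend_by_zero_def)
        then show "\<exists>d>0. \<forall>y. norm (y - x) < d \<longrightarrow> norm (h y - h x - 0) \<le> e * norm (y - x)" using d(1) by blast
      qed simp
      then show ?thesis using d0 x(1) by (simp add: extend_by_zero_def)
    qed
  qed
  show "\<exists>f'. (\<forall>x\<in>UNIV. (h has_derivative f' x) (at x)) \<and> (\<forall>v. \<exists>\<phi>\<in>Z. (\<lambda>x. f' x v) = extend_by_zero K \<phi>)"
    by (rule exI[of _ "\<lambda>x v. extend_by_zero K (dd K v \<phi>) x"]) (use der cl[OF \<phi>(1)] in auto)
qed (use f in auto)

lemma dd2_sum:
  assumes X: "convex_body X" "x \<in> X" and s: "\<And>i. i \<in> I \<Longrightarrow> smooth_on X (F i)"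
  shows "dd X v (dd X v (\<lambda>x. \<Sum>i\<in>I. F i x)) x = (\<Sum>i\<in>I. dd X v (dd X v (F i)) x)"
proof -
  have "dd X v (dd X v (\<lambda>x. \<Sum>i\<in>I. F i x)) x = dd X v (\<lambda>x. \<Sum>i\<in>I. dd X v (F i) x) x"
    by (rule dd_cong[OF X]) (intro smooth_on_dd X smooth_on_sum s, assumption, rule dd_sum[OF X(1)], use s in auto)
  also have "\<dots> = (\<Sum>i\<in>I. dd X v (dd X v (F i)) x)"
    by (rule dd_sum[OF X]) (intro smooth_on_dd X s)
  finally show ?thesis .
qed

lemma cyl_darboux_sum:
  fixes F :: "'i \<Rightarrow> 'a::euclidean_space \<times> real \<Rightarrow> real"
  assumes F: "\<And>i. i \<in> I \<Longrightarrow> cyl_darboux (F i)"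
  shows "cyl_darboux (\<lambda>p. \<Sum>i\<in>I. F i p)"
  unfolding cyl_darboux_def
proof (intro conjI ballI)
  have s: "smooth_on cyl (F i)" if "i \<in> I" for i using cyl_darboux_smooth[OF F[OF that]] .
  show "smooth_on cyl (\<lambda>p. \<Sum>i\<in>I. F i p)" by (intro smooth_cyl s)
  fix p :: "'a \<times> real" assume p: "p \<in> cyl"
  have "xlap (\<lambda>p. \<Sum>i\<in>I. F i p) p = (\<Sum>i\<in>I. xlap (F i) p)"
    unfolding xlap_def by (simp add: dd2_sum[OF convex_body_cyl p s] sum.swap[of _ I])
  then show "snd p * Dt (Dt (\<lambda>p. \<Sum>i\<in>I. F i p)) p + (real DIM('a) - 1) * Dt (\<lambda>p. \<Sum>i\<in>I. F i p) p = snd p * xlap (\<lambda>p. \<Sum>i\<in>I. F i p) p"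
    using F p by (simp add: dd2_sum[OF convex_body_cyl p s] dd_sum[OF convex_body_cyl p s] sum_distrib_left sum.distrib[symmetric] cyl_darboux_def)
qed

lemma cyl_darboux_xlap: "cyl_darboux H \<Longrightarrow> cyl_darboux (xlap H)"
  unfolding xlap_def[abs_def] by (intro cyl_darboux_sum cyl_darboux_Dx)

lemma cyl_darboux_diff:
  fixes G H :: "'a::euclidean_space \<times> real \<Rightarrow> real"
  assumes G: "cyl_darboux G" and H: "cyl_darboux H" shows "cyl_darboux (\<lambda>p. G p - H p)"
proof -
  note s = G[THEN cyl_darboux_smooth] H[THEN cyl_darboux_smooth]
  have d2: "dd cyl v (dd cyl v (\<lambda>p. G p - H p)) p = dd cyl v (dd cyl v G) p - dd cyl v (dd cyl v H) p" if p: "p \<in> cyl" for v p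
  proof -
    have "dd cyl v (dd cyl v (\<lambda>p. G p - H p)) p = dd cyl v (\<lambda>p. dd cyl v G p - dd cyl v H p) p"
      by (rule dd_cong[OF convex_body_cyl p smooth_on_dd[OF convex_body_cyl smooth_on_diff[OF s]]]) (rule dd_diff[OF convex_body_cyl _ s])
    then show ?thesis using dd_diff[OF convex_body_cyl p smooth_on_dd[OF convex_body_cyl s(1)] smooth_on_dd[OF convex_body_cyl s(2)]] by simp
  qed
  show ?thesis
    unfolding cyl_darboux_def
  proof (intro conjI ballI)
    show "smooth_on cyl (\<lambda>p. G p - H p)" by (intro smooth_cyl s)
    fix p :: "'a \<times> real" assume p: "p \<in> cyl"
    have e: "snd p * Dt (Dt G) p + (real DIM('a) - 1) * Dt G p = snd p * xlap G p"
      "snd p * Dt (Dt H) p + (real DIM('a) - 1) * Dt H p = snd p * xlap H p"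
      using G H p by (auto simp: cyl_darboux_def)
    have x: "xlap (\<lambda>p. G p - H p) p = xlap G p - xlap H p"
      by (simp add: xlap_def d2[OF p] sum_subtractf)
    show "snd p * Dt (Dt (\<lambda>p. G p - H p)) p + (real DIM('a) - 1) * Dt (\<lambda>p. G p - H p) p = snd p * xlap (\<lambda>p. G p - H p) p"
      unfolding d2[OF p] dd_diff[OF convex_body_cyl p s] x right_diff_distrib using e by linarith
  qed
qed

lemma vanishes_late_xlap: "smooth_on cyl H \<Longrightarrow> vanishes_late H \<Longrightarrow> vanishes_late (xlap H)"
proof -
  assume H: "smooth_on cyl H" "vanishes_late H"
  have "vanishes_late (Dx b (Dx b H))" for b
    by (intro vanishes_late_Dx smooth_on_dd convex_body_cyl H)
  then show ?thesis by (auto simp: vanishes_late_def xlap_def)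
qed

lemma xlap_pow:
  assumes "cyl_darboux H" "vanishes_late H"
  shows "cyl_darboux ((xlap ^^ m) H)" "vanishes_late ((xlap ^^ m) H)"
proof -
  have "cyl_darboux ((xlap ^^ m) H) \<and> vanishes_late ((xlap ^^ m) H)"
    by (induction m) (simp_all add: assms cyl_darboux_xlap vanishes_late_xlap cyl_darboux_smooth)
  then show "cyl_darboux ((xlap ^^ m) H)" "vanishes_late ((xlap ^^ m) H)" by auto
qed

lemma lap_cong:
  assumes s: "smooth_on K f" and e: "\<And>y. y \<in> K \<Longrightarrow> f y = g y" and x: "x \<in> K"
  shows "lap f x = lap g x"
  unfolding lap_def
proof (intro sum.cong refl)
  fix b show "dd K b (dd K b f) x = dd K b (dd K b g) x"
    by (rule dd_cong[OF convex_body_cball x smooth_on_dd[OF convex_body_cball s]]) (rule dd_cong[OF convex_body_cball _ s e])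
qed

text \<open>
This combines the flatness of the averages of all derivatives with the Dirichlet condition on the
iterated Laplacians; the conclusion is that all derivatives vanish on the sphere.
\<close>
lemma initial_value_extend_by_zero_smooth:
  fixes H :: "'a::euclidean_space \<times> real \<Rightarrow> real"
  assumes n: "DIM('a) \<ge> 2" and H: "cyl_darboux H" "vanishes_late H"
    and bdry: "\<And>m w. w \<in> sphere 0 1 \<Longrightarrow> (xlap ^^ m) H (w, 0) = 0"
  shows "smooth_on UNIV (extend_by_zero K (\<lambda>x. H (x, 0)))"
proof -
  define F :: "('a \<Rightarrow> real) set" where "F = {\<phi>. smooth_on K \<phi> \<and>
     (\<exists>H. cyl_darboux H \<and> vanishes_late H \<and> (\<forall>x\<in>K. \<phi> x = H (x, 0)))}"
  have Ff: "flat \<phi>" if \<phi>: "\<phi> \<in> F" for \<phi>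
  proof -
    obtain H where H: "cyl_darboux H" "vanishes_late H" "\<forall>x\<in>K. \<phi> x = H (x, 0)" using \<phi> by (auto simp: F_def)
    show ?thesis by (rule flat_cong[OF initial_value_flat[OF n H(1,2)]]) (use H(3) in simp)
  qed
  have Fd: "dd K b \<phi> \<in> F" if \<phi>: "\<phi> \<in> F" for \<phi> b
  proof -
    obtain H where H: "cyl_darboux H" "vanishes_late H" "\<forall>x\<in>K. \<phi> x = H (x, 0)" and s: "smooth_on K \<phi>"
      using \<phi> by (auto simp: F_def)
    note sH = cyl_darboux_smooth[OF H(1)]
    have "dd K b \<phi> x = Dx b H (x, 0)" if x: "x \<in> K" for x
      using dd_cong[OF convex_body_cball x s, of "\<lambda>x. H (x, 0)" b] H(3) slice_dd[OF sH order_refl x] by simp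
    then show ?thesis
      unfolding F_def using cyl_darboux_Dx[OF H(1)] vanishes_late_Dx[OF sH H(2)] smooth_on_dd[OF convex_body_cball s] by blast
  qed
  define f where "f = (\<lambda>x. H (x, 0))"
  have sf: "smooth_on K f" unfolding f_def by (rule slice_smooth[OF cyl_darboux_smooth[OF H(1)]]) simp
  define h where "h = (\<lambda>m. (lap ^^ m) f)"
  have sh: "smooth_on K (h m)" for m unfolding h_def by (induction m) (auto intro: lap_smooth sf)
  have hx: "h m x = (xlap ^^ m) H (x, 0)" if "x \<in> K" for m x
    using that
  proof (induction m arbitrary: x)
    case 0 then show ?case by (simp add: h_def f_def)
  next
    case (Suc m)
    have "h (Suc m) x = lap (h m) x" by (simp add: h_def)
    also have "\<dots> = lap (\<lambda>x. (xlap ^^ m) H (x, 0)) x" by (rule lap_cong[OF sh Suc.IH Suc.prems])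
    also have "\<dots> = (xlap ^^ Suc m) H (x, 0)"
      using slice_lap[OF cyl_darboux_smooth[OF xlap_pow(1)[OF H]] order_refl Suc.prems] by simp
    finally show ?case .
  qed
  have hF: "h m \<in> F" for m unfolding F_def using sh hx xlap_pow[OF H] by blast
  have flat0: "flat (\<lambda>x. p x * f x)" if "hom_poly k p" for k p
  proof -
    have "flat (\<lambda>x. p x * h 0 x)"
    proof (rule flat_hom_poly_iterated_lap[OF n sh _ _ _ that])
      show "lap (h m) x = h (Suc m) x" for m x by (simp add: h_def)
      show "h m w = 0" if "w \<in> sphere 0 1" for m w
        using hx[OF sphere_subset_K[OF that]] bdry[OF that] by simp
      show "flat (euler_shifts k (real DIM('a) - 2) (\<lambda>x. p x * h m x))" if "hom_poly k p" for k p m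
        by (rule flat_euler_shifts_hom_poly[OF Ff Fd that hF])
    qed
    then show ?thesis by (simp add: h_def)
  qed
  define Z :: "('a \<Rightarrow> real) set" where "Z = {\<phi>. smooth_on K \<phi> \<and> (\<forall>k p. hom_poly k p \<longrightarrow> flat (\<lambda>x. p x * \<phi> x))}"
  have "smooth_on UNIV (extend_by_zero K f)"
  proof (rule smooth_on_extend_by_zero[where Z=Z])
    show "smooth_on K \<phi>" if "\<phi> \<in> Z" for \<phi> using that by (simp add: Z_def)
    show "\<phi> w = 0" if "\<phi> \<in> Z" "w \<in> sphere 0 1" for \<phi> w
    proof (rule mean_hom_poly_zero[OF _ _ that(2)])
      show "continuous_on K \<phi>" using that(1) smooth_on_continuous by (auto simp: Z_def)
      show "mean (\<lambda>x. p x * \<phi> x) = 0" if "hom_poly k p" for k p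
        using \<open>\<phi> \<in> Z\<close> that flat_mean unfolding Z_def by blast
    qed
    show "dd K v \<phi> \<in> Z" if "\<phi> \<in> Z" for \<phi> v
      using that unfolding Z_def by (auto intro: smooth_on_dd[OF convex_body_cball] flat_hom_poly_dd)
    show "f \<in> Z" using sf flat0 by (auto simp: Z_def)
  qed
  then show ?thesis by (simp add: f_def)
qed

lemma dd_pow_smooth: "convex_body X \<Longrightarrow> smooth_on X f \<Longrightarrow> smooth_on X ((dd X v ^^ j) f)"
  by (induction j) (auto intro: smooth_on_dd)

lemma dd_pow_cong:
  "convex_body X \<Longrightarrow> smooth_on X f \<Longrightarrow> (\<And>y. y \<in> X \<Longrightarrow> f y = g y) \<Longrightarrow> x \<in> X \<Longrightarrow> (dd X v ^^ j) f x = (dd X v ^^ j) g x"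
  by (induction j arbitrary: x) (auto intro: dd_cong dd_pow_smooth)

lemma dd_pow_add:
  "convex_body X \<Longrightarrow> smooth_on X f \<Longrightarrow> smooth_on X g \<Longrightarrow> x \<in> X \<Longrightarrow>
    (dd X v ^^ j) (\<lambda>x. f x + g x) x = (dd X v ^^ j) f x + (dd X v ^^ j) g x"
proof (induction j arbitrary: x)
  case (Suc j)
  have "(dd X v ^^ Suc j) (\<lambda>x. f x + g x) x = dd X v (\<lambda>x. (dd X v ^^ j) f x + (dd X v ^^ j) g x) x"
    unfolding funpow.simps o_apply
    by (rule dd_cong) (use Suc in \<open>auto intro!: dd_pow_smooth smooth_on_add\<close>)
  then show ?case using Suc.prems by (simp add: dd_add dd_pow_smooth)
qed auto

lemma dd_pow_cmult:
  "convex_body X \<Longrightarrow> smooth_on X f \<Longrightarrow> x \<in> X \<Longrightarrow> (dd X v ^^ j) (\<lambda>x. c * f x) x = c * (dd X v ^^ j) f x"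
proof (induction j arbitrary: x)
  case (Suc j)
  have "(dd X v ^^ Suc j) (\<lambda>x. c * f x) x = dd X v (\<lambda>x. c * (dd X v ^^ j) f x) x"
    unfolding funpow.simps o_apply
    by (rule dd_cong) (use Suc in \<open>auto intro!: dd_pow_smooth smooth_on_cmult\<close>)
  then show ?case using Suc.prems by (simp add: dd_cmult dd_pow_smooth)
qed auto

lemma dd_pow_subset:
  assumes X: "convex_body X" and Y: "convex_body Y" "Y \<subseteq> X" and f: "smooth_on X f" and x: "x \<in> Y"
  shows "(dd Y v ^^ j) f x = (dd X v ^^ j) f x"
  using x
proof (induction j arbitrary: x)
  case (Suc j)
  have sj: "smooth_on X ((dd X v ^^ j) f)" by (rule dd_pow_smooth[OF X f])
  have "(dd Y v ^^ Suc j) f x = dd Y v ((dd X v ^^ j) f) x"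
    unfolding funpow.simps o_apply
    by (rule dd_cong[symmetric, OF Y(1) Suc.prems smooth_on_subset[OF sj Y(2)]]) (rule Suc.IH[symmetric])
  also have "\<dots> = dd X v ((dd X v ^^ j) f) x"
    using dd_affine[OF X bounded_linear_ident _ sj Y(1) Suc.prems, of 0 v] Y(2) by auto
  finally show ?case by simp
qed auto

lemma Dt_pow_snd_mult:
  assumes F: "smooth_on cyl F" and p: "p \<in> cyl"
  shows "(Dt ^^ Suc j) (\<lambda>p. snd p * F p) p = snd p * (Dt ^^ Suc j) F p + real (Suc j) * (Dt ^^ j) F p"
  using p
proof (induction j arbitrary: p)
  case 0 then show ?case using dd_snd_mult[OF 0 F, of "(0,1)"] by simp
next
  case (Suc j)
  have sj: "smooth_on cyl ((Dt ^^ j) F)" for j by (rule dd_pow_smooth[OF convex_body_cyl F])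
  have s1: "smooth_on cyl (\<lambda>p. snd p * (Dt ^^ Suc j) F p)" "smooth_on cyl (\<lambda>p. real (Suc j) * (Dt ^^ j) F p)"
    by (intro smooth_on_mult smooth_on_snd smooth_on_const sj)+
  have "(Dt ^^ Suc (Suc j)) (\<lambda>p. snd p * F p) p = Dt ((Dt ^^ Suc j) (\<lambda>p. snd p * F p)) p" by simp
  also have "\<dots> = Dt (\<lambda>p. snd p * (Dt ^^ Suc j) F p + real (Suc j) * (Dt ^^ j) F p) p"
    by (rule dd_cong[OF convex_body_cyl Suc.prems dd_pow_smooth[OF convex_body_cyl smooth_on_mult[OF smooth_on_snd F]]]) (rule Suc.IH)
  also have "\<dots> = (snd p * Dt ((Dt ^^ Suc j) F) p + (Dt ^^ Suc j) F p) + real (Suc j) * Dt ((Dt ^^ j) F) p"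
    unfolding dd_add[OF convex_body_cyl Suc.prems s1] dd_snd_mult[OF Suc.prems sj] dd_cmult[OF convex_body_cyl Suc.prems sj] by simp
  finally show ?case by (simp add: algebra_simps)
qed

text \<open>
Differentiate the cleared equation \<open>j + 1\<close> times in \<open>t\<close> and set \<open>t = 0\<close>. The factor \<open>t\<close> leaves \<open>j + 1\<close>
times the derivative of order \<open>j\<close> of the Laplacian on one side, and time derivatives of \<open>H\<close> on the other.
\<close>
lemma flat_in_time_xlap:
  fixes H :: "'a::euclidean_space \<times> real \<Rightarrow> real"
  assumes H: "cyl_darboux H" and w: "w \<in> K" and z: "\<And>j. (Dt ^^ j) H (w, 0) = 0"
  shows "(Dt ^^ j) (xlap H) (w, 0) = 0"
proof -
  note s = cyl_darboux_smooth[OF H]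
  have p: "(w, 0) \<in> cyl" using w by (simp add: mem_cyl)
  have s1: "smooth_on cyl (\<lambda>p. snd p * Dt (Dt H) p)" "smooth_on cyl (Dt H)" by (intro smooth_cyl s)+
  have s2: "smooth_on cyl (\<lambda>p. (real DIM('a) - 1) * Dt H p)" by (intro smooth_cyl s)
  have sh: "(Dt ^^ j) (Dt F) = (Dt ^^ Suc j) F" for j and F :: "'a \<times> real \<Rightarrow> real"
    by (simp add: funpow_swap1)
  have "(Dt ^^ Suc j) (\<lambda>p. snd p * xlap H p) (w, 0)
      = (Dt ^^ Suc j) (\<lambda>p. snd p * Dt (Dt H) p + (real DIM('a) - 1) * Dt H p) (w, 0)"
    by (rule dd_pow_cong[symmetric, OF convex_body_cyl smooth_on_add[OF s1(1) s2] _ p]) (use H in \<open>simp add: cyl_darboux_def\<close>)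
  also have "\<dots> = (Dt ^^ Suc j) (\<lambda>p. snd p * Dt (Dt H) p) (w, 0) + (real DIM('a) - 1) * (Dt ^^ Suc j) (Dt H) (w, 0)"
    using dd_pow_add[OF convex_body_cyl s1(1) s2 p] dd_pow_cmult[OF convex_body_cyl s1(2) p] by metis
  also have "(Dt ^^ Suc j) (\<lambda>p. snd p * Dt (Dt H) p) (w, 0) = real (Suc j) * (Dt ^^ j) (Dt (Dt H)) (w, 0)"
    using Dt_pow_snd_mult[OF smooth_on_dd[OF convex_body_cyl s1(2)] p, of j] by simp
  also have "\<dots> = 0" unfolding sh using z[of "Suc (Suc j)"] by simp
  also have "(Dt ^^ Suc j) (Dt H) (w, 0) = 0" unfolding sh using z[of "Suc (Suc j)"] by simp
  finally have "(Dt ^^ Suc j) (\<lambda>p. snd p * xlap H p) (w, 0) = 0" by simp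
  then show ?thesis using Dt_pow_snd_mult[OF xlap_smooth[OF s] p, of j] by simp
qed

lemma flat_in_time_xlap_pow:
  assumes H: "cyl_darboux H" "vanishes_late H" and w: "w \<in> K" and z: "\<And>j. (Dt ^^ j) H (w, 0) = 0"
  shows "(Dt ^^ j) ((xlap ^^ m) H) (w, 0) = 0"
proof (induction m arbitrary: j)
  case (Suc m)
  show ?case unfolding funpow.simps o_apply
    by (rule flat_in_time_xlap[OF xlap_pow(1)[OF H] w Suc])
qed (use z in simp)

section \<open>Spherical means on the whole space\<close>

definition sphere_map :: "'a::euclidean_space \<Rightarrow> 'a \<times> real \<Rightarrow> 'a" where
  "sphere_map w p = fst p + snd p *\<^sub>R w"

definition spherical_mean :: "('a::euclidean_space \<Rightarrow> real) \<Rightarrow> 'a \<times> real \<Rightarrow> real" where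
  "spherical_mean F p = mean (\<lambda>w. F (fst p + snd p *\<^sub>R w))"

lemma convex_body_UNIV: "convex_body UNIV" by (simp add: convex_body_def)

lemma sphere_map_pullback: "pullback UNIV UNIV (sphere_map :: 'a::euclidean_space \<Rightarrow> _)"
proof (rule pullback.intro)
  show "bounded_linear (sphere_map w)" for w :: 'a
    unfolding sphere_map_def
    by (intro bounded_linear_add bounded_linear_fst bounded_linear_compose[OF bounded_linear_scaleR_left bounded_linear_snd])
  show "continuous_on UNIV (\<lambda>p. sphere_map (fst p) (snd p))"
    unfolding sphere_map_def by (intro continuous_intros)
qed (auto simp: convex_body_UNIV)

lemma spherical_mean_eq: "spherical_mean F = pmean (\<lambda>w. 1) sphere_map F"
  by (simp add: spherical_mean_def[abs_def] pmean_def[abs_def] sphere_map_def)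

lemma spherical_mean_smooth: "smooth_on UNIV F \<Longrightarrow> smooth_on UNIV (spherical_mean F)"
  unfolding spherical_mean_eq by (intro pullback.pmean_smooth[OF sphere_map_pullback] continuous_intros)

lemma spherical_mean_dd: "smooth_on UNIV F \<Longrightarrow> dd UNIV (b, 0) (spherical_mean F) = spherical_mean (dd UNIV b F)"
  unfolding spherical_mean_eq
  by (rule ext, subst pullback.dd_pmean[OF sphere_map_pullback convex_body_UNIV continuous_on_const])
    (auto simp: sphere_map_def pmean_def)

text \<open>
A rescaling of \<open>smean_lap\<close>: with \<open>s = t + 1\<close>, the sphere of radius \<open>t\<close> about \<open>x\<close> is the image of the sphere of
radius \<open>t / s < 1\<close> about the origin under \<open>y \<mapsto> x + s y\<close>.
\<close>
lemma spherical_mean_darboux: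
  fixes F :: "'a::euclidean_space \<Rightarrow> real"
  assumes F: "smooth_on UNIV F" and t: "t \<ge> 0"
  shows "t * dd UNIV (0,1) (dd UNIV (0,1) (spherical_mean F)) (x, t) + (real DIM('a) - 1) * dd UNIV (0,1) (spherical_mean F) (x, t)
    = t * (\<Sum>b\<in>Basis. dd UNIV (b,0) (dd UNIV (b,0) (spherical_mean F)) (x, t))"
proof -
  let ?G = "spherical_mean F" and ?I = "{0..1::real}"
  define s where "s = t + 1"
  define r where "r = t / s"
  have s: "s > 0" and r: "r \<in> ?I" and sr: "s * r = t" using t by (auto simp: s_def r_def)
  note fU = convex_body_UNIV[where 'a='a] note fU2 = convex_body_UNIV[where 'a="'a \<times> real"]
  note fI = convex_body_unit_interval
  have sG: "smooth_on UNIV ?G" by (rule spherical_mean_smooth[OF F])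
  define \<phi> where "\<phi> = (\<lambda>y. F (x + s *\<^sub>R y))"
  have L: "bounded_linear (\<lambda>y::'a. s *\<^sub>R y)" by (rule bounded_linear_scaleR_right)
  have affK: "smooth_on K (\<lambda>y. E (x + s *\<^sub>R y))" "\<And>b y. y \<in> K \<Longrightarrow> dd K b (\<lambda>y. E (x + s *\<^sub>R y)) y = s * dd UNIV b E (x + s *\<^sub>R y)"
    if E: "smooth_on UNIV E" for E
  proof -
    show "smooth_on K (\<lambda>y. E (x + s *\<^sub>R y))" using smooth_on_affine[OF fU L _ E, of K x] by simp
    show "dd K b (\<lambda>y. E (x + s *\<^sub>R y)) y = s * dd UNIV b E (x + s *\<^sub>R y)" if "y \<in> K" for b y
      using dd_affine[OF fU L _ E convex_body_cball that, of x b]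
        linear_scale[OF bounded_linear.linear[OF dd_bounded_linear[OF fU E, of "x + s *\<^sub>R y"]], of s b] by simp
  qed
  have s\<phi>: "smooth_on K \<phi>" unfolding \<phi>_def by (rule affK(1)[OF F])
  have lap\<phi>: "lap \<phi> y = s\<^sup>2 * (\<Sum>b\<in>Basis. dd UNIV b (dd UNIV b F) (x + s *\<^sub>R y))" if y: "y \<in> K" for y
  proof -
    have "dd K b (dd K b \<phi>) y = s\<^sup>2 * dd UNIV b (dd UNIV b F) (x + s *\<^sub>R y)" for b
    proof -
      have sF: "smooth_on UNIV (dd UNIV b F)" by (rule smooth_on_dd[OF fU F])
      have "dd K b (dd K b \<phi>) y = dd K b (\<lambda>y. s * dd UNIV b F (x + s *\<^sub>R y)) y"
        by (rule dd_cong[OF convex_body_cball y smooth_on_dd[OF convex_body_cball s\<phi>]]) (simp add: \<phi>_def affK(2)[OF F])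
      also have "\<dots> = s * dd K b (\<lambda>y. dd UNIV b F (x + s *\<^sub>R y)) y"
        by (rule dd_cmult[OF convex_body_cball y affK(1)[OF sF]])
      finally show ?thesis using affK(2)[OF sF y, of b] by (simp add: power2_eq_square)
    qed
    then show ?thesis by (simp add: lap_def sum_distrib_left)
  qed
  have L2: "bounded_linear (\<lambda>r::real. (0::'a, s * r))"
    by (intro bounded_linear_Pair bounded_linear_mult_right bounded_linear_zero)
  have affI: "smooth_on ?I (\<lambda>r. E (x, s * r))" "\<And>r. r \<in> ?I \<Longrightarrow> dd ?I 1 (\<lambda>r. E (x, s * r)) r = s * dd UNIV (0,1) E (x, s * r)"
    if E: "smooth_on UNIV E" for E :: "'a \<times> real \<Rightarrow> real"
  proof -
    show "smooth_on ?I (\<lambda>r. E (x, s * r))" using smooth_on_affine[OF fU2 L2 _ E, of ?I "(x, 0)"] by simp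
    show "dd ?I 1 (\<lambda>r. E (x, s * r)) r = s * dd UNIV (0,1) E (x, s * r)" if "r \<in> ?I" for r
      using dd_affine[OF fU2 L2 _ E fI that, of "(x, 0)" 1]
        linear_scale[OF bounded_linear.linear[OF dd_bounded_linear[OF fU2 E, of "(x, s * r)"]], of s "(0, 1)"] by simp
  qed
  have M: "smean \<phi> = (\<lambda>r. ?G (x, s * r))"
    by (auto simp: smean_def spherical_mean_def \<phi>_def)
  have d1: "dd ?I 1 (smean \<phi>) r = s * dd UNIV (0,1) ?G (x, s * r)" if "r \<in> ?I" for r
    unfolding M by (rule affI(2)[OF sG that])
  have sGt: "smooth_on UNIV (dd UNIV (0,1) ?G)" by (rule smooth_on_dd[OF fU2 sG])
  have d2: "dd ?I 1 (dd ?I 1 (smean \<phi>)) r = s\<^sup>2 * dd UNIV (0,1) (dd UNIV (0,1) ?G) (x, s * r)"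
  proof -
    have "dd ?I 1 (dd ?I 1 (smean \<phi>)) r = dd ?I 1 (\<lambda>r. s * dd UNIV (0,1) ?G (x, s * r)) r"
      by (rule dd_cong[OF fI r smooth_on_dd[OF fI smean_smooth[OF s\<phi>]] d1])
    also have "\<dots> = s * dd ?I 1 (\<lambda>r. dd UNIV (0,1) ?G (x, s * r)) r"
      by (rule dd_cmult[OF fI r affI(1)[OF sGt]])
    finally show ?thesis using affI(2)[OF sGt r] by (simp add: power2_eq_square)
  qed
  have "smean (lap \<phi>) r = smean (\<lambda>y. s\<^sup>2 * (\<Sum>b\<in>Basis. dd UNIV b (dd UNIV b F) (x + s *\<^sub>R y))) r"
    unfolding smean_def by (rule mean_cong_K, rule lap\<phi>, rule scale_in_cball[OF r])
  also have "\<dots> = s\<^sup>2 * (\<Sum>b\<in>Basis. smean (\<lambda>y. dd UNIV b (dd UNIV b F) (x + s *\<^sub>R y)) r)"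
  proof -
    have "continuous_on K (\<lambda>w. dd UNIV b (dd UNIV b F) (x + s *\<^sub>R (r *\<^sub>R w)))" for b
      by (rule cont_ray[OF smooth_on_continuous[OF affK(1)] r]) (intro smooth_on_dd fU F)
    then have "mean (\<lambda>w. \<Sum>b\<in>Basis. dd UNIV b (dd UNIV b F) (x + s *\<^sub>R (r *\<^sub>R w)))
        = (\<Sum>b\<in>Basis. mean (\<lambda>w. dd UNIV b (dd UNIV b F) (x + s *\<^sub>R (r *\<^sub>R w))))"
      by (rule mean_sum)
    then show ?thesis unfolding smean_def mean_cmult by simp
  qed
  also have "(\<Sum>b\<in>Basis. smean (\<lambda>y. dd UNIV b (dd UNIV b F) (x + s *\<^sub>R y)) r) = (\<Sum>b\<in>Basis. dd UNIV (b,0) (dd UNIV (b,0) ?G) (x, t))"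
  proof (intro sum.cong refl)
    fix b :: 'a
    have "dd UNIV (b,0) (dd UNIV (b,0) ?G) = spherical_mean (dd UNIV b (dd UNIV b F))"
      using spherical_mean_dd[OF F] spherical_mean_dd[OF smooth_on_dd[OF fU F]] by simp
    then show "smean (\<lambda>y. dd UNIV b (dd UNIV b F) (x + s *\<^sub>R y)) r = dd UNIV (b,0) (dd UNIV (b,0) ?G) (x, t)"
      by (simp add: smean_def spherical_mean_def sr)
  qed
  finally have e: "smean (lap \<phi>) r = s\<^sup>2 * (\<Sum>b\<in>Basis. dd UNIV (b,0) (dd UNIV (b,0) ?G) (x, t))" .
  have "r * (s\<^sup>2 * dd UNIV (0,1) (dd UNIV (0,1) ?G) (x, t)) + (real DIM('a) - 1) * (s * dd UNIV (0,1) ?G (x, t))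
      = r * (s\<^sup>2 * (\<Sum>b\<in>Basis. dd UNIV (b,0) (dd UNIV (b,0) ?G) (x, t)))"
    using smean_lap[OF s\<phi> r] unfolding d1[OF r] d2 e sr .
  then have "s * (t * dd UNIV (0,1) (dd UNIV (0,1) ?G) (x, t) + (real DIM('a) - 1) * dd UNIV (0,1) ?G (x, t))
      = s * (t * (\<Sum>b\<in>Basis. dd UNIV (b,0) (dd UNIV (b,0) ?G) (x, t)))"
    unfolding sr[symmetric] by (simp add: power2_eq_square algebra_simps)
  then show ?thesis using s by simp
qed

lemma dd_cyl_UNIV:
  assumes "smooth_on UNIV E" "p \<in> cyl" shows "dd cyl v E p = dd UNIV v E p"
  using dd_pow_subset[OF convex_body_UNIV convex_body_cyl subset_UNIV assms, where v=v and j=1] by simp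

lemma dd2_cyl_UNIV:
  assumes "smooth_on UNIV E" "p \<in> cyl" shows "dd cyl v (dd cyl v E) p = dd UNIV v (dd UNIV v E) p"
  using dd_pow_subset[OF convex_body_UNIV convex_body_cyl subset_UNIV assms, where v=v and j=2] by (simp add: numeral_2_eq_2)

lemma spherical_mean_cyl_darboux:
  assumes F: "smooth_on UNIV F" shows "cyl_darboux (spherical_mean F)"
  unfolding cyl_darboux_def
proof (intro conjI ballI)
  note sG = spherical_mean_smooth[OF F]
  show "smooth_on cyl (spherical_mean F)" using smooth_on_subset[OF sG] by auto
  fix p :: "'a \<times> real" assume p: "p \<in> cyl"
  obtain x t where xt: "p = (x, t)" by (cases p)
  have t: "t \<ge> 0" using p xt by (simp add: mem_cyl)
  show "snd p * Dt (Dt (spherical_mean F)) p + (real DIM('a) - 1) * Dt (spherical_mean F) p = snd p * xlap (spherical_mean F) p"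
    unfolding xlap_def dd2_cyl_UNIV[OF sG p] dd_cyl_UNIV[OF sG p] using spherical_mean_darboux[OF F t, of x] by (simp add: xt)
qed

text \<open>
A sphere of radius \<open>t \<ge> 2\<close> about a point of the ball does not meet the open ball, so the spherical means
vanish late. Hence uniqueness applies to the difference.
\<close>
lemma cyl_darboux_eq_spherical_mean:
  fixes H :: "'a::euclidean_space \<times> real \<Rightarrow> real"
  assumes n: "DIM('a) \<ge> 2" and H: "cyl_darboux H" "vanishes_late H"
    and bdry: "\<And>w. w \<in> sphere 0 1 \<Longrightarrow> H (w, 0) = 0"
    and F: "smooth_on UNIV F" "F = extend_by_zero K (\<lambda>x. H (x, 0))" and p: "p \<in> cyl"
  shows "H p = spherical_mean F p"
proof -
  have F0: "F y = 0" if "norm y \<ge> 1" for y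
    using that bdry[of y] by (cases "norm y = 1") (auto simp: F(2) extend_by_zero_def)
  have "H (x, t) - spherical_mean F (x, t) = 0" if xt: "(x, t) \<in> cyl" for x t
  proof (rule cyl_darboux_unique[where H="\<lambda>p. H p - spherical_mean F p", OF n cyl_darboux_diff[OF H(1) spherical_mean_cyl_darboux[OF F(1)]] _ _ xt])
    show "H (x, 0) - spherical_mean F (x, 0) = 0" if "x \<in> K" for x
      using that by (simp add: spherical_mean_def mean_const F(2) extend_by_zero_def)
    have "spherical_mean F (x, t) = 0" if x: "x \<in> K" and t: "t \<ge> 2" for x t
    proof -
      have "mean (\<lambda>w. F (x + t *\<^sub>R w)) = mean (\<lambda>w::'a. 0)"
      proof (rule mean_cong_sphere, rule F0)
        fix w :: 'a assume "w \<in> sphere 0 1"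
        then have "norm (t *\<^sub>R w) = t" using t by simp
        then show "1 \<le> norm (x + t *\<^sub>R w)" using norm_diff_ineq[of "t *\<^sub>R w" x] x t by (simp add: add.commute)
      qed
      then show ?thesis by (simp add: spherical_mean_def mean_const)
    qed
    then show "vanishes_late (\<lambda>p. H p - spherical_mean F p)" using H(2) by (simp add: vanishes_late_def)
  qed
  then show ?thesis using p by (cases p) auto
qed

section \<open>Extension of the solution\<close>

lemma sum_Basis_axis:
  fixes f :: "real^'n \<Rightarrow> real"
  shows "(\<Sum>b\<in>Basis. f b) = (\<Sum>i\<in>UNIV. f (axis i 1 :: real^'n))"
proof -
  have B: "(Basis :: (real^'n) set) = range (\<lambda>i. axis i 1)" by (auto simp: Basis_vec_def)
  have inj: "inj (\<lambda>i. axis i 1 :: real^'n)" by (auto simp: inj_on_def axis_eq_axis)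
  show ?thesis unfolding B sum.reindex[OF inj] o_def ..
qed

text \<open>
Relates directional derivatives to the iterated one-variable derivatives in the definition of the
Darboux operator.
\<close>
lemma deriv_line:
  assumes X: "convex_body X" and H: "smooth_on X H" and p: "p + s *\<^sub>R v \<in> interior X"
  shows "deriv (\<lambda>s. H (p + s *\<^sub>R v)) s = dd X v H (p + s *\<^sub>R v)"
    and "(deriv ^^ 2) (\<lambda>s. H (p + s *\<^sub>R v)) s = dd X v (dd X v H) (p + s *\<^sub>R v)"
proof -
  have 1: "deriv (\<lambda>s. H (p + s *\<^sub>R v)) s = dd X v H (p + s *\<^sub>R v)" if "p + s *\<^sub>R v \<in> interior X" for s
    by (rule DERIV_imp_deriv[OF dd_line_derivative[OF X H that]])
  show "deriv (\<lambda>s. H (p + s *\<^sub>R v)) s = dd X v H (p + s *\<^sub>R v)" by (rule 1[OF p])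
  define S where "S = (\<lambda>s. p + s *\<^sub>R v) -` interior X"
  have S: "open S" unfolding S_def
    by (rule open_vimage[OF open_interior]) (intro continuous_intros)
  have "((\<lambda>s. dd X v H (p + s *\<^sub>R v)) has_real_derivative dd X v (dd X v H) (p + s *\<^sub>R v)) (at s)"
    by (rule dd_line_derivative[OF X smooth_on_dd[OF X H] p])
  then have "(deriv (\<lambda>s. H (p + s *\<^sub>R v)) has_real_derivative dd X v (dd X v H) (p + s *\<^sub>R v)) (at s)"
    by (rule has_field_derivative_transform_within_open[OF _ S]) (use p 1 in \<open>auto simp: S_def\<close>)
  then show "(deriv ^^ 2) (\<lambda>s. H (p + s *\<^sub>R v)) s = dd X v (dd X v H) (p + s *\<^sub>R v)"
    by (simp add: numeral_2_eq_2 DERIV_imp_deriv)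
qed

lemma darboux_eq_dd:
  fixes H :: "(real^'n) \<times> real \<Rightarrow> real"
  assumes X: "convex_body X" and H: "smooth_on X H" and p: "(x, t) \<in> interior X"
  shows "darboux H x t = dd X (0,1) (dd X (0,1) H) (x,t) + (real CARD('n) - 1) / t * dd X (0,1) H (x,t)
    - (\<Sum>b\<in>Basis. dd X (b,0) (dd X (b,0) H) (x,t))"
proof -
  have "(deriv ^^ 2) (\<lambda>s. H (x + s *\<^sub>R b, t)) 0 = dd X (b,0) (dd X (b,0) H) (x,t)" for b
    using deriv_line(2)[OF X H, of "(x, t)" 0 "(b, 0)"] p by simp
  moreover have "deriv (\<lambda>s. H (x, s)) t = dd X (0,1) H (x,t)" "(deriv ^^ 2) (\<lambda>s. H (x, s)) t = dd X (0,1) (dd X (0,1) H) (x,t)"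
    using deriv_line[OF X H, of "(x, 0)" t "(0, 1)"] p by simp_all
  ultimately show ?thesis by (simp add: darboux_def laplacian_def sum_Basis_axis)
qed

lemma interior_cyl: "interior cyl = ball 0 1 \<times> {0<..}"
  by (simp add: cyl_def interior_Times)

lemma darboux_iff_cleared:
  fixes H :: "(real^'n) \<times> real \<Rightarrow> real"
  assumes "convex_body X" "smooth_on X H" "(x, t) \<in> interior X" "t > 0"
  shows "darboux H x t = 0 \<longleftrightarrow> t * dd X (0,1) (dd X (0,1) H) (x,t) + (real CARD('n) - 1) * dd X (0,1) H (x,t)
    = t * (\<Sum>b\<in>Basis. dd X (b,0) (dd X (b,0) H) (x,t))"
  unfolding darboux_eq_dd[OF assms(1-3)] using assms(4) by (auto simp: field_simps)

lemma cyl_darbouxI: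
  fixes H :: "(real^'n) \<times> real \<Rightarrow> real"
  assumes s: "smooth_on cyl H" and d: "\<forall>x\<in>ball 0 1. \<forall>t>0. darboux H x t = 0"
  shows "cyl_darboux H"
  unfolding cyl_darboux_def
proof (intro conjI ballI s)
  fix p :: "(real^'n) \<times> real" assume p: "p \<in> cyl"
  show "snd p * Dt (Dt H) p + (real DIM(real^'n) - 1) * Dt H p = snd p * xlap H p"
  proof (rule eq_of_eq_on_interior[OF convex_body_cyl _ _ _ p])
    show "continuous_on cyl (\<lambda>p. snd p * Dt (Dt H) p + (real DIM(real^'n) - 1) * Dt H p)"
      by (intro smooth_on_continuous smooth_cyl s)
    show "continuous_on cyl (\<lambda>p. snd p * xlap H p)"
      by (intro smooth_on_continuous smooth_on_mult smooth_on_snd xlap_smooth s)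
    fix p :: "(real^'n) \<times> real" assume p: "p \<in> interior cyl"
    obtain x t where xt: "p = (x, t)" by (cases p)
    then have "x \<in> ball 0 1" "t > 0" using p by (auto simp: interior_cyl)
    then show "snd p * Dt (Dt H) p + (real DIM(real^'n) - 1) * Dt H p = snd p * xlap H p"
      using d darboux_iff_cleared[OF convex_body_cyl s, of x t] p xt by (simp add: xlap_def)
  qed
qed

text \<open>
On the line above \<open>w\<close>, the zero extension of \<open>g\<close> is a smooth function of \<open>t\<close> in a neighbourhood of \<open>0\<close>. Its
derivatives at \<open>0\<close> can be computed from \<open>t \<le> 0\<close>, where it is zero, and from \<open>t \<ge> 0\<close>, where it is
\<open>H\<close>.
\<close>
lemma boundary_value_flat_in_time:
  fixes H g :: "(real^'n) \<times> real \<Rightarrow> real"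
  assumes s: "smooth_on cyl H" and g: "\<forall>p\<in>lateral_boundary. g p = H p" and C: "C0_infinity_cylinder g"
    and w: "w \<in> sphere 0 1"
  shows "(Dt ^^ j) H (w, 0) = 0"
proof -
  define h where "h = extend_by_zero lateral_boundary g"
  have "smooth_on_submanifold (sphere 0 1 \<times> UNIV) h" using C by (simp add: C0_infinity_cylinder_def h_def Let_def)
  then obtain U F where U: "open U" "(w, 0) \<in> U" "smooth_on U F" "\<And>q. q \<in> (sphere 0 1 \<times> UNIV) \<inter> U \<Longrightarrow> F q = h q"
    using w unfolding smooth_on_submanifold_def by (metis (no_types, lifting) SigmaI UNIV_I)
  obtain e where e: "e > 0" "ball (w, 0) e \<subseteq> U" using U(1,2) open_contains_ball by blast
  define B where "B = ball (w, 0::real) e"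
  have fB: "convex_body B" using e by (simp add: convex_body_def B_def)
  have sB: "smooth_on B F" using smooth_on_subset[OF U(3)] e(2) by (simp add: B_def)
  define d where "d = e / 2"
  have d: "d > 0" using e by (simp add: d_def)
  define I where "I = {-d..d}"
  define J where "J = {0..d}"
  define N where "N = {-d..0}"
  have bodies: "convex_body I" "convex_body J" "convex_body N" using d by (auto simp: convex_body_def I_def J_def N_def)
  have subs: "J \<subseteq> I" "N \<subseteq> I" "J \<subseteq> {0..}" using d by (auto simp: I_def J_def N_def)
  define \<phi> where "\<phi> = (\<lambda>s. F (w, s))"
  have inB: "(w, s) \<in> B" if "s \<in> I" for s
    using that d by (auto simp: B_def I_def d_def dist_Pair_Pair dist_real_def)
  have L: "bounded_linear (\<lambda>s::real. (0 :: real^'n, s))"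
    by (intro bounded_linear_Pair bounded_linear_ident bounded_linear_zero)
  have s\<phi>: "smooth_on I \<phi>"
    using smooth_on_affine[OF fB L _ sB, of I "(w, 0)"] inB by (simp add: \<phi>_def)
  have F: "F (w, s) = h (w, s)" if "s \<in> I" for s
    using U(4)[of "(w, s)"] w inB[OF that] e(2) by (auto simp: B_def)
  have neg: "\<phi> s = 0" if "s \<in> N" for s
    using F[of s] that subs(2) by (auto simp: \<phi>_def h_def extend_by_zero_def lateral_boundary_def N_def)
  have wK: "w \<in> K" using w by auto
  define v where "v = (\<lambda>t. H (w, t))"
  have sv: "smooth_on J v" unfolding v_def by (rule vertical_smooth[OF s wK bodies(2) subs(3)])
  have eq: "\<phi> t = v t" if t: "t \<in> J" for t
  proof (rule eq_of_eq_on_interior[OF bodies(2) _ smooth_on_continuous[OF sv] _ t])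
    show "continuous_on J \<phi>" using smooth_on_continuous[OF s\<phi>] subs(1) continuous_on_subset by blast
    fix t assume "t \<in> interior J"
    then have t: "0 < t" "t < d" by (auto simp: J_def)
    then have "(w, t) \<in> lateral_boundary" using w by (simp add: lateral_boundary_def)
    then show "\<phi> t = v t" using F[of t] g t by (auto simp: \<phi>_def v_def h_def extend_by_zero_def I_def)
  qed
  have vD: "(dd J 1 ^^ j) v t = (Dt ^^ j) H (w, t)" if "t \<in> J" for t
    using that
  proof (induction j arbitrary: t)
    case (Suc j)
    have "(dd J 1 ^^ Suc j) v t = dd J 1 (\<lambda>t. (Dt ^^ j) H (w, t)) t"
      unfolding funpow.simps o_apply by (rule dd_cong[OF bodies(2) Suc.prems dd_pow_smooth[OF bodies(2) sv] Suc.IH])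
    then show ?case
      using vertical_dd[OF dd_pow_smooth[OF convex_body_cyl s] wK bodies(2) subs(3) Suc.prems] by simp
  qed (simp add: v_def)
  have zJ: "0 \<in> J" and zN: "0 \<in> N" using d by (auto simp: J_def N_def)
  have "(Dt ^^ j) H (w, 0) = (dd J 1 ^^ j) v 0" by (rule vD[OF zJ, symmetric])
  also have "\<dots> = (dd J 1 ^^ j) \<phi> 0"
    by (rule dd_pow_cong[OF bodies(2) sv eq[symmetric] zJ])
  also have "\<dots> = (dd I 1 ^^ j) \<phi> 0" by (rule dd_pow_subset[OF bodies(1,2) subs(1) s\<phi> zJ])
  also have "\<dots> = (dd N 1 ^^ j) \<phi> 0" by (rule dd_pow_subset[symmetric, OF bodies(1,3) subs(2) s\<phi> zN])
  also have "\<dots> = (dd N 1 ^^ j) (\<lambda>s. 0) 0"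
    by (rule dd_pow_cong[OF bodies(3) smooth_on_subset[OF s\<phi> subs(2)] neg zN])
  also have "\<dots> = 0" using dd_pow_cmult[OF bodies(3) smooth_on_const zN, where v=1 and j=j and c=0] by simp
  finally show ?thesis .
qed

theorem theorem2p4:
  fixes Gp g :: "(real^'n) \<times> real \<Rightarrow> real" and fstar :: "real^'n \<Rightarrow> real"
  assumes "CARD('n) \<ge> 2"
    and "smooth_on (cball 0 1 \<times> {0..}) Gp"
    and "\<forall>x\<in>ball 0 1. \<forall>t>0. darboux Gp x t = 0"
    and "\<forall>x\<in>ball 0 1. initial_velocity_zero Gp x"
    and "\<forall>x\<in>ball 0 1. \<forall>t>2. Gp (x, t) = 0"
    and "\<forall>p\<in>lateral_boundary. g p = Gp p"
    and "C0_infinity_cylinder g"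
    and "fstar = extend_by_zero (cball 0 1) (\<lambda>x. Gp (x, 0))"
  shows "smooth_on UNIV fstar \<and>
    (\<exists>G. global_solution g fstar G \<and> (\<forall>x\<in>ball 0 1. \<forall>t>0. G (x, t) = Gp (x, t)))"
proof -
  have n: "DIM(real^'n) \<ge> 2" using assms(1) by simp
  have s: "smooth_on cyl Gp" using assms(2) by (simp add: cyl_def)
  have H: "cyl_darboux Gp" by (rule cyl_darbouxI[OF s assms(3)])
  have late: "vanishes_late Gp"
    unfolding vanishes_late_def
  proof (intro ballI allI impI)
    fix x :: "real^'n" and t :: real assume xt: "x \<in> K" "2 \<le> t"
    have "convex_body (K \<times> {2..} :: ((real^'n) \<times> real) set)" by (intro convex_body_Times convex_body_cball) (simp add: convex_body_def)
    then show "Gp (x, t) = 0"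
    proof (rule eq_of_eq_on_interior[where g="\<lambda>p. 0"])
      show "continuous_on (K \<times> {2..}) Gp"
        by (rule continuous_on_subset[OF smooth_on_continuous[OF s]]) (auto simp: cyl_def)
      show "Gp p = 0" if "p \<in> interior (K \<times> {2..})" for p
        using that assms(5) by (cases p) (auto simp: interior_Times)
    qed (use xt in auto)
  qed
  have bdry: "(xlap ^^ m) Gp (w, 0) = 0" if "w \<in> sphere 0 1" for m w
    using flat_in_time_xlap_pow[OF H late sphere_subset_K[OF that] boundary_value_flat_in_time[OF s assms(6,7) that], of 0 m]
    by simp
  have sf: "smooth_on UNIV fstar"
    unfolding assms(8) by (rule initial_value_extend_by_zero_smooth[OF n H late bdry])
  define G where "G = spherical_mean fstar"
  have sG: "smooth_on UNIV G" unfolding G_def by (rule spherical_mean_smooth[OF sf])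
  have eq: "Gp p = G p" if "p \<in> cyl" for p
    unfolding G_def by (rule cyl_darboux_eq_spherical_mean[OF n H late _ sf assms(8) that]) (use bdry[of _ 0] in simp)
  have pde: "t * dd UNIV (0,1) (dd UNIV (0,1) G) (x, t) + (real CARD('n) - 1) * dd UNIV (0,1) G (x, t)
    = t * (\<Sum>b\<in>Basis. dd UNIV (b,0) (dd UNIV (b,0) G) (x, t))" if "t \<ge> 0" for x t
    using spherical_mean_darboux[OF sf that, of x] by (simp add: G_def)
  have "global_solution g fstar G"
    unfolding global_solution_def
  proof (intro conjI allI impI ballI)
    show "Ck_on 2 (UNIV \<times> {0..}) G"
      by (rule Ck_on_subset[OF sG[unfolded smooth_on_def, rule_format]]) simp
    show "darboux G x t = 0" if "t > 0" for x t
      using darboux_iff_cleared[OF convex_body_UNIV sG _ that, of x] pde[of t x] that by simp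
    show "G p = g p" if "p \<in> lateral_boundary" for p
    proof -
      have "p \<in> cyl" using that by (auto simp: lateral_boundary_def cyl_def)
      then show ?thesis using eq assms(6) that by simp
    qed
    fix x :: "real^'n"
    show "G (x, 0) = fstar x" by (simp add: G_def spherical_mean_def mean_const)
    have "(x, 0) + (0::real) *\<^sub>R (0, 1) \<in> interior UNIV" by simp
    from dd_line_derivative[OF convex_body_UNIV sG this]
    have "((\<lambda>t. G (x, t)) has_real_derivative dd UNIV (0,1) G (x, 0)) (at 0)" by simp
    moreover have "dd UNIV (0,1) G (x, 0) = 0" using pde[of 0 x] assms(1) by simp
    ultimately show "initial_velocity_zero G x"
      unfolding initial_velocity_zero_def using has_field_derivative_at_within by fastforce
  qed
  moreover have "\<forall>x\<in>ball 0 1. \<forall>t>0. G (x, t) = Gp (x, t)"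
    using eq by (auto simp: mem_cyl)
  ultimately show ?thesis using sf by blast
qed

end
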